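(* A monad $T$ on a category $\mathcal{E}$ with dense generator $\mathcal{A}$ has arities $\mathcal{A}$ if and only if (the underlying functor of) $T$ is an arity-respecting endofunctor of $(\mathcal{E},\mathcal{A})$. If this is the case, the pair $(\mathcal{E}^T,\Theta_T)$ is an Eilenberg-Moore object of $T$ in the $2$-category of categories with arities, arity-respecting functors and natural transformations.
   Context: All categories are locally small; $\widehat{\mathcal{A}}$ denotes the category of set-valued presheaves on $\mathcal{A}$. A dense generator of $\mathcal{E}$ is the inclusion $i_{\mathcal{A}}:\mathcal{A}\hookrightarrow\mathcal{E}$ of a small full subcategory such that the nerve functor $\nu_{\mathcal{A}}:\mathcal{E}\to\widehat{\mathcal{A}}$, $\nu_{\mathcal{A}}(X)(A)=\mathcal{E}(i_{\mathcal{A}}(A),X)$, is fully faithful. For an object $X$ of $\mathcal{E}$, $\mathcal{A}/X$ is the full subcategory of $\mathcal{E}/X$ on the arrows $A\to X$ with $A$ in $\mathcal{A}$; the $\mathcal{A}$-cocone over $X$ is the canonical natural transformation from the projection $\mathcal{A}/X\to\mathcal{E}$ to the constant functor at $X$. A monad $T$ on $\mathcal{E}$ has arities $\mathcal{A}$ if $\nu_{\mathcal{A}}T$ takes the $\mathcal{A}$-cocones in $\mathcal{E}$ to colimit-cocones in $\widehat{\mathcal{A}}$. A category with arities is a pair $(\mathcal{E},\mathcal{A})$ consisting of a category $\mathcal{E}$ with a dense generator $\mathcal{A}$. A functor $F:\mathcal{E}\to\mathcal{F}$ is arity-respecting as a functor $(\mathcal{E},\mathcal{A})\to(\mathcal{F},\mathcal{B})$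 if $\nu_{\mathcal{B}}F$ takes the $\mathcal{A}$-cocones in $\mathcal{E}$ to colimit-cocones in $\widehat{\mathcal{B}}$. Categories with arities, arity-respecting functors and natural transformations form a $2$-category. $\mathcal{E}^T$ is the Eilenberg-Moore category of $T$, and $\Theta_T$ is its full subcategory spanned by the free $T$-algebras on the objects of $\mathcal{A}$. Monads in a $2$-category and their Eilenberg-Moore objects are understood in the sense of Street's formal theory of monads; the universal $1$-cell here is the forgetful functor $\mathcal{E}^T\to\mathcal{E}$. *)

theory Defs
  imports "HOL-Library.FuncSet" "HOL-Library.Equipollence"
begin

section \<open>Size\<close>

text \<open>
  A type of class \<open>universe\<close> plays the role of the universe of sets: a set is \<^emph>\<open>small\<close> if its
  cardinality is strictly below that of the type, and the class axioms are the closure properties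
  of a Grothendieck universe (the cardinality of the type is a regular strong limit cardinal).
  Every small set is in bijection with a subset of the type, so the small subsets form a category
  equivalent to the category of sets. Uncountability is not demanded; hence \<open>nat\<close>, whose small
  sets are the finite ones, is an instance.
\<close>

class universe =
  assumes infinite_universe: "infinite (UNIV :: 'a set)"
    and universe_Pow: "A \<prec> (UNIV :: 'a set) \<Longrightarrow> Pow (A :: 'a set) \<prec> (UNIV :: 'a set)"
    and universe_UN: "I \<prec> (UNIV :: 'a set) \<Longrightarrow> (\<And>i. i \<in> I \<Longrightarrow> F i \<prec> (UNIV :: 'a set))
           \<Longrightarrow> (\<Union>i\<in>(I :: 'a set). F i :: 'a set) \<prec> (UNIV :: 'a set)"

lemma nat_lesspoll_iff_finite: "A \<prec> (UNIV :: nat set) \<longleftrightarrow> finite A"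
proof
  assume A: "A \<prec> (UNIV :: nat set)"
  show "finite A"
  proof (rule ccontr)
    assume "infinite A"
    then have "(UNIV :: nat set) \<lesssim> A"
      by (simp add: infinite_le_lepoll)
    with A show False
      by (meson lepoll_antisym lesspoll_def)
  qed
next
  assume "finite A"
  then show "A \<prec> (UNIV :: nat set)"
    by (simp add: finite_lesspoll_infinite)
qed

instance nat :: universe
  by standard (auto simp: nat_lesspoll_iff_finite)

definition small :: "'u::universe itself \<Rightarrow> 'x set \<Rightarrow> bool"
  where "small _ S \<longleftrightarrow> S \<prec> (UNIV :: 'u set)"


section \<open>Categories, functors, natural transformations\<close>

text \<open>
  Hom-sets are indexed by source and target and need not be disjoint, so composition takes the three
  objects as arguments: \<open>Comp C X Y Z g f\<close> is \<open>g \<circ> f\<close> for \<open>f : X \<rightarrow> Y\<close> and \<open>g : Y \<rightarrow> Z\<close>.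
  The values of \<open>Hom\<close>, \<open>Id\<close>, \<open>Comp\<close> outside \<open>Obj\<close> are irrelevant.
\<close>

record ('o, 'm) category =
  Obj :: "'o set"
  Hom :: "'o \<Rightarrow> 'o \<Rightarrow> 'm set"
  Id :: "'o \<Rightarrow> 'm"
  Comp :: "'o \<Rightarrow> 'o \<Rightarrow> 'o \<Rightarrow> 'm \<Rightarrow> 'm \<Rightarrow> 'm"

definition category :: "('o, 'm) category \<Rightarrow> bool" where
  "category C \<longleftrightarrow>
     (\<forall>X\<in>Obj C. Id C X \<in> Hom C X X) \<and>
     (\<forall>X\<in>Obj C. \<forall>Y\<in>Obj C. \<forall>Z\<in>Obj C. \<forall>f\<in>Hom C X Y. \<forall>g\<in>Hom C Y Z.
        Comp C X Y Z g f \<in> Hom C X Z) \<and>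
     (\<forall>X\<in>Obj C. \<forall>Y\<in>Obj C. \<forall>f\<in>Hom C X Y.
        Comp C X X Y f (Id C X) = f \<and> Comp C X Y Y (Id C Y) f = f) \<and>
     (\<forall>W\<in>Obj C. \<forall>X\<in>Obj C. \<forall>Y\<in>Obj C. \<forall>Z\<in>Obj C.
        \<forall>f\<in>Hom C W X. \<forall>g\<in>Hom C X Y. \<forall>h\<in>Hom C Y Z.
        Comp C W Y Z h (Comp C W X Y g f) = Comp C W X Z (Comp C X Y Z h g) f)"

definition locally_small :: "('o, 'u::universe) category \<Rightarrow> bool" where
  "locally_small C \<longleftrightarrow> (\<forall>X\<in>Obj C. \<forall>Y\<in>Obj C. small TYPE('u) (Hom C X Y))"

definition full_sub :: "('o, 'm) category \<Rightarrow> 'o set \<Rightarrow> ('o, 'm) category" where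
  "full_sub C S = C\<lparr>Obj := S\<rparr>"

definition op_cat :: "('o, 'm) category \<Rightarrow> ('o, 'm) category" where
  "op_cat C = \<lparr>Obj = Obj C, Hom = (\<lambda>X Y. Hom C Y X), Id = Id C,
               Comp = (\<lambda>X Y Z g f. Comp C Z Y X f g)\<rparr>"

definition set_cat :: "('u::universe set, 'u \<Rightarrow> 'u) category" where
  "set_cat = \<lparr>Obj = {S. small TYPE('u) S}, Hom = (\<lambda>S S'. S \<rightarrow>\<^sub>E S'), Id = (\<lambda>S. \<lambda>x\<in>S. x),
              Comp = (\<lambda>S S' S'' g f. compose S g f)\<rparr>"

record ('o, 'm, 'p, 'n) ftr =
  omap :: "'o \<Rightarrow> 'p"
  amap :: "'o \<Rightarrow> 'o \<Rightarrow> 'm \<Rightarrow> 'n"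

text \<open>
  Functors and natural transformations are normalised to be \<open>undefined\<close> outside their domain, so that
  equality in HOL is equality of functors and of natural transformations.
\<close>

definition mk_ftr :: "('o, 'm) category \<Rightarrow> ('o \<Rightarrow> 'p) \<Rightarrow> ('o \<Rightarrow> 'o \<Rightarrow> 'm \<Rightarrow> 'n) \<Rightarrow> ('o, 'm, 'p, 'n) ftr"
  where "mk_ftr C fo fa =
    \<lparr>omap = restrict fo (Obj C),
     amap = (\<lambda>X Y f. if X \<in> Obj C \<and> Y \<in> Obj C \<and> f \<in> Hom C X Y then fa X Y f else undefined)\<rparr>"

definition is_functor ::
  "('o, 'm) category \<Rightarrow> ('p, 'n) category \<Rightarrow> ('o, 'm, 'p, 'n) ftr \<Rightarrow> bool" where
  "is_functor C D F \<longleftrightarrow> category C \<and> category D \<and> F = mk_ftr C (omap F) (amap F) \<and>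
     (\<forall>X\<in>Obj C. omap F X \<in> Obj D) \<and>
     (\<forall>X\<in>Obj C. \<forall>Y\<in>Obj C. \<forall>f\<in>Hom C X Y. amap F X Y f \<in> Hom D (omap F X) (omap F Y)) \<and>
     (\<forall>X\<in>Obj C. amap F X X (Id C X) = Id D (omap F X)) \<and>
     (\<forall>X\<in>Obj C. \<forall>Y\<in>Obj C. \<forall>Z\<in>Obj C. \<forall>f\<in>Hom C X Y. \<forall>g\<in>Hom C Y Z.
        amap F X Z (Comp C X Y Z g f)
          = Comp D (omap F X) (omap F Y) (omap F Z) (amap F Y Z g) (amap F X Y f))"

definition id_ftr :: "('o, 'm) category \<Rightarrow> ('o, 'm, 'o, 'm) ftr" where
  "id_ftr C = mk_ftr C (\<lambda>X. X) (\<lambda>X Y f. f)"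

definition const_ftr :: "('o, 'm) category \<Rightarrow> ('p, 'n) category \<Rightarrow> 'p \<Rightarrow> ('o, 'm, 'p, 'n) ftr" where
  "const_ftr C D L = mk_ftr C (\<lambda>X. L) (\<lambda>X Y f. Id D L)"

text \<open>The composite \<open>G \<circ> F\<close>; the first argument is the domain of \<open>F\<close>.\<close>

definition comp_ftr :: "('o, 'm) category \<Rightarrow> ('p, 'n, 'q, 'k) ftr \<Rightarrow> ('o, 'm, 'p, 'n) ftr
    \<Rightarrow> ('o, 'm, 'q, 'k) ftr" where
  "comp_ftr C G F = mk_ftr C (\<lambda>X. omap G (omap F X))
                             (\<lambda>X Y f. amap G (omap F X) (omap F Y) (amap F X Y f))"

definition fully_faithful ::
  "('o, 'm) category \<Rightarrow> ('p, 'n) category \<Rightarrow> ('o, 'm, 'p, 'n) ftr \<Rightarrow> bool" where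
  "fully_faithful C D F \<longleftrightarrow> is_functor C D F \<and>
     (\<forall>X\<in>Obj C. \<forall>Y\<in>Obj C. bij_betw (amap F X Y) (Hom C X Y) (Hom D (omap F X) (omap F Y)))"

definition iso_of_categories ::
  "('o, 'm) category \<Rightarrow> ('p, 'n) category \<Rightarrow> ('o, 'm, 'p, 'n) ftr \<Rightarrow> bool" where
  "iso_of_categories C D F \<longleftrightarrow> fully_faithful C D F \<and> bij_betw (omap F) (Obj C) (Obj D)"

definition nat_trans :: "('o, 'm) category \<Rightarrow> ('p, 'n) category \<Rightarrow> ('o, 'm, 'p, 'n) ftr
    \<Rightarrow> ('o, 'm, 'p, 'n) ftr \<Rightarrow> ('o \<Rightarrow> 'n) \<Rightarrow> bool" where
  "nat_trans C D F G \<alpha> \<longleftrightarrow> is_functor C D F \<and> is_functor C D G \<and> \<alpha> \<in> extensional (Obj C) \<and>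
     (\<forall>X\<in>Obj C. \<alpha> X \<in> Hom D (omap F X) (omap G X)) \<and>
     (\<forall>X\<in>Obj C. \<forall>Y\<in>Obj C. \<forall>f\<in>Hom C X Y.
        Comp D (omap F X) (omap F Y) (omap G Y) (\<alpha> Y) (amap F X Y f)
          = Comp D (omap F X) (omap G X) (omap G Y) (amap G X Y f) (\<alpha> X))"

text \<open>
  Whiskering: \<open>post_whisker C H F G \<alpha>\<close> is \<open>H\<alpha> : HF \<Rightarrow> HG\<close> for \<open>\<alpha> : F \<Rightarrow> G\<close>, and
  \<open>pre_whisker C \<alpha> F\<close> is \<open>\<alpha>F\<close>; in both cases \<open>C\<close> is the domain of the resulting functors.
\<close>

definition post_whisker :: "('o, 'm) category \<Rightarrow> ('p, 'n, 'q, 'k) ftr \<Rightarrow> ('o, 'm, 'p, 'n) ftr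
    \<Rightarrow> ('o, 'm, 'p, 'n) ftr \<Rightarrow> ('o \<Rightarrow> 'n) \<Rightarrow> ('o \<Rightarrow> 'k)" where
  "post_whisker C H F G \<alpha> = (\<lambda>X\<in>Obj C. amap H (omap F X) (omap G X) (\<alpha> X))"

definition pre_whisker ::
  "('o, 'm) category \<Rightarrow> ('p \<Rightarrow> 'n) \<Rightarrow> ('o, 'm, 'p, 'k) ftr \<Rightarrow> ('o \<Rightarrow> 'n)" where
  "pre_whisker C \<alpha> F = (\<lambda>X\<in>Obj C. \<alpha> (omap F X))"

definition functor_cat :: "('o, 'm) category \<Rightarrow> ('p, 'n) category
    \<Rightarrow> (('o, 'm, 'p, 'n) ftr, 'o \<Rightarrow> 'n) category" where
  "functor_cat C D =
    \<lparr>Obj = {F. is_functor C D F},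
     Hom = (\<lambda>F G. {\<alpha>. nat_trans C D F G \<alpha>}),
     Id = (\<lambda>F. \<lambda>X\<in>Obj C. Id D (omap F X)),
     Comp = (\<lambda>F G H \<beta> \<alpha>. \<lambda>X\<in>Obj C. Comp D (omap F X) (omap G X) (omap H X) (\<beta> X) (\<alpha> X))\<rparr>"

definition presheaf_cat :: "('o, 'u::universe) category
    \<Rightarrow> (('o, 'u, 'u set, 'u \<Rightarrow> 'u) ftr, 'o \<Rightarrow> 'u \<Rightarrow> 'u) category" where
  "presheaf_cat A = functor_cat (op_cat A) set_cat"

definition colimit_cocone :: "('j, 'k) category \<Rightarrow> ('o, 'm) category \<Rightarrow> ('j, 'k, 'o, 'm) ftr
    \<Rightarrow> 'o \<Rightarrow> ('j \<Rightarrow> 'm) \<Rightarrow> bool" where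
  "colimit_cocone J C D L c \<longleftrightarrow> L \<in> Obj C \<and> nat_trans J C D (const_ftr J C L) c \<and>
     (\<forall>L'\<in>Obj C. \<forall>c'. nat_trans J C D (const_ftr J C L') c' \<longrightarrow>
        (\<exists>!h. h \<in> Hom C L L' \<and> (\<forall>j\<in>Obj J. Comp C (omap D j) L L' h (c j) = c' j)))"


section \<open>Dense generators and arities\<close>

definition nerve :: "('o, 'u::universe) category \<Rightarrow> 'o set
    \<Rightarrow> ('o, 'u, ('o, 'u, 'u set, 'u \<Rightarrow> 'u) ftr, 'o \<Rightarrow> 'u \<Rightarrow> 'u) ftr" where
  "nerve E \<A> = mk_ftr E
     (\<lambda>X. mk_ftr (op_cat (full_sub E \<A>)) (\<lambda>A. Hom E A X)
            (\<lambda>A B f. \<lambda>x\<in>Hom E A X. Comp E B A X x f))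
     (\<lambda>X Y g. \<lambda>A\<in>\<A>. \<lambda>x\<in>Hom E A X. Comp E A X Y g x)"

text \<open>
  A full subcategory is given by its set of objects. \<open>dense_generator E \<A>\<close> thus says that \<open>(E, \<A>)\<close>
  is a category with arities.
\<close>

definition dense_generator :: "('o, 'u::universe) category \<Rightarrow> 'o set \<Rightarrow> bool" where
  "dense_generator E \<A> \<longleftrightarrow> category E \<and> locally_small E \<and> \<A> \<subseteq> Obj E \<and> small TYPE('u) \<A> \<and>
     fully_faithful E (presheaf_cat (full_sub E \<A>)) (nerve E \<A>)"

definition slice_cat :: "('o, 'm) category \<Rightarrow> 'o \<Rightarrow> ('o \<times> 'm, 'm) category" where
  "slice_cat E X =
    \<lparr>Obj = {(Y, p). Y \<in> Obj E \<and> p \<in> Hom E Y X},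
     Hom = (\<lambda>(Y, p) (Z, q). {h \<in> Hom E Y Z. Comp E Y Z X q h = p}),
     Id = (\<lambda>(Y, p). Id E Y),
     Comp = (\<lambda>(Y, p) (Z, q) (W, r). Comp E Y Z W)\<rparr>"

definition arity_slice :: "('o, 'm) category \<Rightarrow> 'o set \<Rightarrow> 'o \<Rightarrow> ('o \<times> 'm, 'm) category" where
  "arity_slice E \<A> X = full_sub (slice_cat E X) {(A, p). A \<in> \<A> \<and> p \<in> Hom E A X}"

definition slice_proj ::
  "('o, 'm) category \<Rightarrow> 'o set \<Rightarrow> 'o \<Rightarrow> ('o \<times> 'm, 'm, 'o, 'm) ftr" where
  "slice_proj E \<A> X = mk_ftr (arity_slice E \<A> X) fst (\<lambda>a b h. h)"

definition arity_cocone :: "('o, 'm) category \<Rightarrow> 'o set \<Rightarrow> 'o \<Rightarrow> ('o \<times> 'm \<Rightarrow> 'm)" where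
  "arity_cocone E \<A> X = restrict snd (Obj (arity_slice E \<A> X))"

definition takes_arity_cocones_to_colimits :: "('o, 'm) category \<Rightarrow> 'o set \<Rightarrow> ('p, 'n) category
    \<Rightarrow> ('o, 'm, 'p, 'n) ftr \<Rightarrow> bool" where
  "takes_arity_cocones_to_colimits E \<A> C H \<longleftrightarrow>
     (\<forall>X\<in>Obj E. let J = arity_slice E \<A> X in
        colimit_cocone J C (comp_ftr J H (slice_proj E \<A> X)) (omap H X)
          (post_whisker J H (slice_proj E \<A> X) (const_ftr J E X) (arity_cocone E \<A> X)))"

definition arity_respecting :: "('o, 'u::universe) category \<Rightarrow> 'o set
    \<Rightarrow> ('p, 'u) category \<Rightarrow> 'p set \<Rightarrow> ('o, 'u, 'p, 'u) ftr \<Rightarrow> bool" where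
  "arity_respecting E \<A> F \<B> H \<longleftrightarrow> is_functor E F H \<and>
     takes_arity_cocones_to_colimits E \<A> (presheaf_cat (full_sub F \<B>)) (comp_ftr E (nerve F \<B>) H)"


section \<open>Monads and their algebras\<close>

record ('o, 'm) monad =
  mfun :: "('o, 'm, 'o, 'm) ftr"
  munit :: "'o \<Rightarrow> 'm"
  mmult :: "'o \<Rightarrow> 'm"

definition monad :: "('o, 'm) category \<Rightarrow> ('o, 'm) monad \<Rightarrow> bool" where
  "monad C T \<longleftrightarrow> is_functor C C (mfun T) \<and>
     nat_trans C C (id_ftr C) (mfun T) (munit T) \<and>
     nat_trans C C (comp_ftr C (mfun T) (mfun T)) (mfun T) (mmult T) \<and>
     (\<forall>X\<in>Obj C. let T1 = omap (mfun T) X; T2 = omap (mfun T) T1; T3 = omap (mfun T) T2 in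
        Comp C T1 T2 T1 (mmult T X) (munit T T1) = Id C T1 \<and>
        Comp C T1 T2 T1 (mmult T X) (amap (mfun T) X T1 (munit T X)) = Id C T1 \<and>
        Comp C T3 T2 T1 (mmult T X) (mmult T T1)
          = Comp C T3 T2 T1 (mmult T X) (amap (mfun T) T2 T1 (mmult T X)))"

definition has_arities :: "('o, 'u::universe) category \<Rightarrow> 'o set \<Rightarrow> ('o, 'u) monad \<Rightarrow> bool" where
  "has_arities E \<A> T \<longleftrightarrow>
     takes_arity_cocones_to_colimits E \<A> (presheaf_cat (full_sub E \<A>))
       (comp_ftr E (nerve E \<A>) (mfun T))"

definition EM_cat :: "('o, 'm) category \<Rightarrow> ('o, 'm) monad \<Rightarrow> ('o \<times> 'm, 'm) category" where
  "EM_cat C T =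
    \<lparr>Obj = {(X, a). X \<in> Obj C \<and> a \<in> Hom C (omap (mfun T) X) X \<and>
       (let T1 = omap (mfun T) X; T2 = omap (mfun T) T1 in
          Comp C X T1 X a (munit T X) = Id C X \<and>
          Comp C T2 T1 X a (mmult T X) = Comp C T2 T1 X a (amap (mfun T) T1 X a))},
     Hom = (\<lambda>(X, a) (Y, b). {f \<in> Hom C X Y.
       Comp C (omap (mfun T) X) X Y f a
         = Comp C (omap (mfun T) X) (omap (mfun T) Y) Y b (amap (mfun T) X Y f)}),
     Id = (\<lambda>(X, a). Id C X),
     Comp = (\<lambda>(X, a) (Y, b) (Z, c). Comp C X Y Z)\<rparr>"

definition forgetful :: "('o, 'm) category \<Rightarrow> ('o, 'm) monad \<Rightarrow> ('o \<times> 'm, 'm, 'o, 'm) ftr" where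
  "forgetful C T = mk_ftr (EM_cat C T) fst (\<lambda>x y f. f)"

text \<open>The canonical action \<open>TU \<Rightarrow> U\<close> on the forgetful functor \<open>U\<close>, with component \<open>a\<close> at \<open>(X, a)\<close>.\<close>

definition EM_action :: "('o, 'm) category \<Rightarrow> ('o, 'm) monad \<Rightarrow> ('o \<times> 'm \<Rightarrow> 'm)" where
  "EM_action C T = restrict snd (Obj (EM_cat C T))"

definition Theta :: "('o, 'm) monad \<Rightarrow> 'o set \<Rightarrow> ('o \<times> 'm) set" where
  "Theta T \<A> = (\<lambda>A. (omap (mfun T) A, mmult T A)) ` \<A>"


section \<open>The 2-category of categories with arities and its Eilenberg-Moore objects\<close>

text \<open>
  The 0-cells are the pairs \<open>(E, \<A>)\<close> with \<open>dense_generator E \<A>\<close>. As their objects may be of different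
  types, the 2-category \<open>K\<close> is given by its hom-categories \<open>arity_hom\<close>, with composition of functors
  and whiskering as composition. It is a locally full sub-2-category of that of all categories.
\<close>

definition arity_hom :: "('d, 'u::universe) category \<Rightarrow> 'd set \<Rightarrow> ('o, 'u) category \<Rightarrow> 'o set
    \<Rightarrow> (('d, 'u, 'o, 'u) ftr, 'd \<Rightarrow> 'u) category" where
  "arity_hom D \<D> E \<A> = full_sub (functor_cat D E) {G. arity_respecting D \<D> E \<A> G}"

text \<open>A monad in \<open>K\<close> on \<open>(E, \<A>)\<close>; there is no condition on the 2-cells since \<open>K\<close> is locally full.\<close>

definition arity_monad :: "('o, 'u::universe) category \<Rightarrow> 'o set \<Rightarrow> ('o, 'u) monad \<Rightarrow> bool" where
  "arity_monad E \<A> T \<longleftrightarrow>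
     dense_generator E \<A> \<and> monad E T \<and> arity_respecting E \<A> E \<A> (mfun T)"

text \<open>The monad \<open>K(D, T)\<close> on the hom-category \<open>K(D, E)\<close>, given by composition with \<open>T\<close>.\<close>

definition hom_monad :: "('d, 'u::universe) category \<Rightarrow> 'd set \<Rightarrow> ('o, 'u) category \<Rightarrow> 'o set
    \<Rightarrow> ('o, 'u) monad \<Rightarrow> (('d, 'u, 'o, 'u) ftr, 'd \<Rightarrow> 'u) monad" where
  "hom_monad D \<D> E \<A> T =
    \<lparr>mfun = mk_ftr (arity_hom D \<D> E \<A>)
       (\<lambda>G. comp_ftr D (mfun T) G) (\<lambda>G H \<alpha>. post_whisker D (mfun T) G H \<alpha>),
     munit = (\<lambda>G\<in>Obj (arity_hom D \<D> E \<A>). pre_whisker D (munit T) G),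
     mmult = (\<lambda>G\<in>Obj (arity_hom D \<D> E \<A>). pre_whisker D (mmult T) G)\<rparr>"

text \<open>
  The category of \<open>T\<close>-algebras with domain \<open>D\<close> in \<open>K\<close>: its objects are pairs of an arity-respecting
  \<open>G : D \<rightarrow> E\<close> and an action \<open>TG \<Rightarrow> G\<close>.
\<close>

definition algebras_on :: "('d, 'u::universe) category \<Rightarrow> 'd set \<Rightarrow> ('o, 'u) category \<Rightarrow> 'o set
    \<Rightarrow> ('o, 'u) monad \<Rightarrow> (('d, 'u, 'o, 'u) ftr \<times> ('d \<Rightarrow> 'u), 'd \<Rightarrow> 'u) category" where
  "algebras_on D \<D> E \<A> T = EM_cat (arity_hom D \<D> E \<A>) (hom_monad D \<D> E \<A> T)"

text \<open>For a \<open>T\<close>-algebra \<open>(V, \<xi>)\<close> with domain \<open>Z\<close>: the functor \<open>G \<mapsto> (VG, \<xi>G)\<close>, \<open>\<alpha> \<mapsto> V\<alpha>\<close>.\<close>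

definition comparison :: "('d, 'u::universe) category \<Rightarrow> 'd set \<Rightarrow> ('z, 'u) category \<Rightarrow> 'z set
    \<Rightarrow> ('z, 'u, 'o, 'u) ftr \<Rightarrow> ('z \<Rightarrow> 'u)
    \<Rightarrow> (('d, 'u, 'z, 'u) ftr, 'd \<Rightarrow> 'u,
        ('d, 'u, 'o, 'u) ftr \<times> ('d \<Rightarrow> 'u), 'd \<Rightarrow> 'u) ftr" where
  "comparison D \<D> Z \<Z> V \<xi> = mk_ftr (arity_hom D \<D> Z \<Z>)
     (\<lambda>G. (comp_ftr D V G, pre_whisker D \<xi> G)) (\<lambda>G H \<alpha>. post_whisker D V G H \<alpha>)"

text \<open>
  \<open>(Z, \<Z>)\<close> with universal 1-cell \<open>V\<close> and action \<open>\<xi>\<close> is an Eilenberg-Moore object of \<open>T\<close> in \<open>K\<close>: it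
  represents the 2-functor sending \<open>(D, \<D>)\<close> to the category of \<open>T\<close>-algebras with domain \<open>(D, \<D>)\<close>.
  The comparison functors are 2-natural in \<open>(D, \<D>)\<close>, and by the 2-categorical Yoneda lemma every
  2-natural isomorphism is of this form. The type argument is the type of objects of \<open>D\<close>.
\<close>

definition EM_object :: "'d itself \<Rightarrow> ('o, 'u::universe) category \<Rightarrow> 'o set \<Rightarrow> ('o, 'u) monad
    \<Rightarrow> ('z, 'u) category \<Rightarrow> 'z set \<Rightarrow> ('z, 'u, 'o, 'u) ftr \<Rightarrow> ('z \<Rightarrow> 'u) \<Rightarrow> bool" where
  "EM_object _ E \<A> T Z \<Z> V \<xi> \<longleftrightarrow>
     arity_monad E \<A> T \<and> dense_generator Z \<Z> \<and>
     (V, \<xi>) \<in> Obj (algebras_on Z \<Z> E \<A> T) \<and>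
     (\<forall>(D :: ('d, 'u) category) \<D>. dense_generator D \<D> \<longrightarrow>
        iso_of_categories (arity_hom D \<D> Z \<Z>) (algebras_on D \<D> E \<A> T) (comparison D \<D> Z \<Z> V \<xi>))"

end

theory Submission
  imports Defs
begin

text \<open>
  Everything rests on an elementary description of arity-respecting functors. The nerve of \<open>H X\<close> is
  the colimit of the nerves of the \<open>H A\<close>, over all \<open>p : A \<rightarrow> X\<close> with \<open>A\<close> in \<open>\<A>\<close>, if and only if
  every \<open>g : B \<rightarrow> H X\<close> with \<open>B\<close> in \<open>\<B>\<close> factors as \<open>B \<rightarrow> H A \<rightarrow> H X\<close>, the second arrow
  being some \<open>H p\<close>, and the category of such factorisations of \<open>g\<close> is connected
  (\<open>takes_arity_cocones_iff_connected_factorisations\<close>). This holds because colimits of presheaves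
  are pointwise, and because a cocone of sets is a colimit when it is jointly surjective and
  identifies exactly the elements linked by the diagram (\<open>presheaf_colimit_iff\<close>).

  That a monad has arities \<open>\<A>\<close> says, by definition, that its functor respects arities. Suppose
  that it does. Write \<open>U\<close> for the forgetful functor from algebras, and let the free algebras on
  the objects of \<open>\<A>\<close> be the arities for algebras.
  \<^item> Free algebras are dense (\<open>dense_generator_Theta\<close>): a map of nerves \<open>(X, a) \<rightarrow> (Y, b)\<close> restricts
    to a map of nerves \<open>X \<rightarrow> Y\<close>, hence is given by an arrow \<open>f : X \<rightarrow> Y\<close>. The equation
    \<open>f \<circ> a = b \<circ> T f\<close> can be tested on the arrows \<open>B \<rightarrow> T X\<close> with \<open>B\<close> in \<open>\<A>\<close>; as \<open>T\<close> respects
    arities, these factor through \<open>T p\<close> for some \<open>p : A \<rightarrow> X\<close>, which reduces the equation to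
    naturality.
  \<^item> \<open>U\<close> respects arities (\<open>connected_factorisations_forgetful\<close>): the factorisation
    \<open>B \<rightarrow> T B \<rightarrow> X\<close> of \<open>B \<rightarrow> X\<close> through the unit is initial.
  \<^item> A functor \<open>G\<close> to algebras respects arities if and only if \<open>U G\<close> does
    (\<open>connected_factorisations_forgetful_comp\<close>), because arity-respecting functors compose, and
    factorisations through \<open>U G\<close> can be transposed along the free-forgetful adjunction.

  The universal property (\<open>iso_of_categories_comparison\<close>) is then that of the category of algebras
  among all categories: an action of \<open>T\<close> on a functor \<open>G\<close> is a family of algebra structures on
  the values of \<open>G\<close> for which all arrows in the image of \<open>G\<close> are algebra maps. By the last
  item, \<open>G\<close> and the resulting functor to algebras respect arities simultaneously.
\<close>


section \<open>Categories, functors and natural transformations\<close>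

lemma category_Id: "category C \<Longrightarrow> X \<in> Obj C \<Longrightarrow> Id C X \<in> Hom C X X"
  by (simp add: category_def)

lemma category_Comp:
  "category C \<Longrightarrow> X \<in> Obj C \<Longrightarrow> Y \<in> Obj C \<Longrightarrow> Z \<in> Obj C \<Longrightarrow> f \<in> Hom C X Y \<Longrightarrow> g \<in> Hom C Y Z
    \<Longrightarrow> Comp C X Y Z g f \<in> Hom C X Z"
  by (simp add: category_def)

lemma category_Id_right:
  "category C \<Longrightarrow> X \<in> Obj C \<Longrightarrow> Y \<in> Obj C \<Longrightarrow> f \<in> Hom C X Y \<Longrightarrow> Comp C X X Y f (Id C X) = f"
  by (simp add: category_def)

lemma category_Id_left:
  "category C \<Longrightarrow> X \<in> Obj C \<Longrightarrow> Y \<in> Obj C \<Longrightarrow> f \<in> Hom C X Y \<Longrightarrow> Comp C X Y Y (Id C Y) f = f"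
  by (simp add: category_def)

lemma category_assoc:
  "category C \<Longrightarrow> W \<in> Obj C \<Longrightarrow> X \<in> Obj C \<Longrightarrow> Y \<in> Obj C \<Longrightarrow> Z \<in> Obj C
    \<Longrightarrow> f \<in> Hom C W X \<Longrightarrow> g \<in> Hom C X Y \<Longrightarrow> h \<in> Hom C Y Z
    \<Longrightarrow> Comp C W Y Z h (Comp C W X Y g f) = Comp C W X Z (Comp C X Y Z h g) f"
  by (simp add: category_def)

lemmas category_rules =
  category_Id category_Comp category_Id_right category_Id_left category_assoc

lemma full_sub_simps [simp]:
  "Obj (full_sub C S) = S" "Hom (full_sub C S) = Hom C"
  "Id (full_sub C S) = Id C" "Comp (full_sub C S) = Comp C"
  by (simp_all add: full_sub_def)

lemma op_cat_simps [simp]: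
  "Obj (op_cat C) = Obj C" "Hom (op_cat C) X Y = Hom C Y X"
  "Id (op_cat C) = Id C" "Comp (op_cat C) X Y Z g f = Comp C Z Y X f g"
  by (simp_all add: op_cat_def)

lemma set_cat_simps [simp]:
  "Obj set_cat = {S :: 'u::universe set. small TYPE('u) S}" "Hom set_cat S S' = (S \<rightarrow>\<^sub>E S')"
  "Id set_cat S = (\<lambda>x\<in>S. x)" "Comp set_cat S S' S'' g f = compose S g f"
  by (simp_all add: set_cat_def)

lemma functor_cat_simps [simp]:
  "Obj (functor_cat C D) = {F. is_functor C D F}"
  "Hom (functor_cat C D) F G = {\<alpha>. nat_trans C D F G \<alpha>}"
  "Id (functor_cat C D) F = (\<lambda>X\<in>Obj C. Id D (omap F X))"
  "Comp (functor_cat C D) F G H \<beta> \<alpha>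
     = (\<lambda>X\<in>Obj C. Comp D (omap F X) (omap G X) (omap H X) (\<beta> X) (\<alpha> X))"
  by (simp_all add: functor_cat_def)

lemma omap_mk_ftr [simp]: "X \<in> Obj C \<Longrightarrow> omap (mk_ftr C fo fa) X = fo X"
  by (simp add: mk_ftr_def)

lemma amap_mk_ftr [simp]:
  "X \<in> Obj C \<Longrightarrow> Y \<in> Obj C \<Longrightarrow> f \<in> Hom C X Y \<Longrightarrow> amap (mk_ftr C fo fa) X Y f = fa X Y f"
  by (simp add: mk_ftr_def)

lemma category_full_sub: "category C \<Longrightarrow> S \<subseteq> Obj C \<Longrightarrow> category (full_sub C S)"
  unfolding category_def full_sub_simps by (meson subsetD)

lemma category_op_cat: "category C \<Longrightarrow> category (op_cat C)"
  unfolding category_def by simp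

lemma category_set_cat: "category set_cat"
  unfolding category_def
  by (auto simp: Id_compose compose_Id compose_def fun_eq_iff PiE_iff extensional_def
      restrict_PiE_iff)

lemma is_functor_category:
  assumes "is_functor C D F"
  shows "category C" "category D"
  using assms by (simp_all add: is_functor_def)

lemma is_functor_omap: "is_functor C D F \<Longrightarrow> X \<in> Obj C \<Longrightarrow> omap F X \<in> Obj D"
  by (simp add: is_functor_def)

lemma is_functor_amap:
  "is_functor C D F \<Longrightarrow> X \<in> Obj C \<Longrightarrow> Y \<in> Obj C \<Longrightarrow> f \<in> Hom C X Y
    \<Longrightarrow> amap F X Y f \<in> Hom D (omap F X) (omap F Y)"
  by (simp add: is_functor_def)

lemma is_functor_Id: "is_functor C D F \<Longrightarrow> X \<in> Obj C \<Longrightarrow> amap F X X (Id C X) = Id D (omap F X)"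
  by (simp add: is_functor_def)

lemma is_functor_Comp:
  "is_functor C D F \<Longrightarrow> X \<in> Obj C \<Longrightarrow> Y \<in> Obj C \<Longrightarrow> Z \<in> Obj C
    \<Longrightarrow> f \<in> Hom C X Y \<Longrightarrow> g \<in> Hom C Y Z \<Longrightarrow> amap F X Z (Comp C X Y Z g f)
          = Comp D (omap F X) (omap F Y) (omap F Z) (amap F Y Z g) (amap F X Y f)"
  by (simp add: is_functor_def)

lemmas is_functor_rules = is_functor_omap is_functor_amap is_functor_Id is_functor_Comp

lemma mk_ftr_cong:
  assumes "\<And>X. X \<in> Obj C \<Longrightarrow> fo X = go X"
    and "\<And>X Y f. X \<in> Obj C \<Longrightarrow> Y \<in> Obj C \<Longrightarrow> f \<in> Hom C X Y \<Longrightarrow> fa X Y f = ga X Y f"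
  shows "mk_ftr C fo fa = mk_ftr C go ga"
  using assms by (auto simp: mk_ftr_def fun_eq_iff)

lemma is_functorI:
  assumes "category C" "category D"
    and "\<And>X. X \<in> Obj C \<Longrightarrow> fo X \<in> Obj D"
    and "\<And>X Y f. X \<in> Obj C \<Longrightarrow> Y \<in> Obj C \<Longrightarrow> f \<in> Hom C X Y \<Longrightarrow> fa X Y f \<in> Hom D (fo X) (fo Y)"
    and "\<And>X. X \<in> Obj C \<Longrightarrow> fa X X (Id C X) = Id D (fo X)"
    and "\<And>X Y Z f g. X \<in> Obj C \<Longrightarrow> Y \<in> Obj C \<Longrightarrow> Z \<in> Obj C \<Longrightarrow> f \<in> Hom C X Y \<Longrightarrow> g \<in> Hom C Y Z
      \<Longrightarrow> fa X Z (Comp C X Y Z g f) = Comp D (fo X) (fo Y) (fo Z) (fa Y Z g) (fa X Y f)"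
  shows "is_functor C D (mk_ftr C fo fa)"
proof -
  have "mk_ftr C fo fa = mk_ftr C (omap (mk_ftr C fo fa)) (amap (mk_ftr C fo fa))"
    by (rule mk_ftr_cong) simp_all
  then show ?thesis
    using assms by (simp add: is_functor_def category_rules)
qed

lemma is_functor_eqI:
  assumes "is_functor C D F" "is_functor C D' G"
    and "\<And>X. X \<in> Obj C \<Longrightarrow> omap F X = omap G X"
    and "\<And>X Y f. X \<in> Obj C \<Longrightarrow> Y \<in> Obj C \<Longrightarrow> f \<in> Hom C X Y \<Longrightarrow> amap F X Y f = amap G X Y f"
  shows "F = G"
proof -
  have "F = mk_ftr C (omap F) (amap F)" "G = mk_ftr C (omap G) (amap G)"
    using assms(1,2) unfolding is_functor_def by blast+
  moreover have "mk_ftr C (omap F) (amap F) = mk_ftr C (omap G) (amap G)"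
    by (rule mk_ftr_cong) (use assms(3,4) in simp_all)
  ultimately show ?thesis by simp
qed

lemma is_functor_const_ftr:
  "category C \<Longrightarrow> category D \<Longrightarrow> L \<in> Obj D \<Longrightarrow> is_functor C D (const_ftr C D L)"
  unfolding const_ftr_def by (rule is_functorI) (simp_all add: category_rules)

lemma comp_ftr_simps [simp]:
  "X \<in> Obj C \<Longrightarrow> omap (comp_ftr C G F) X = omap G (omap F X)"
  "X \<in> Obj C \<Longrightarrow> Y \<in> Obj C \<Longrightarrow> f \<in> Hom C X Y
    \<Longrightarrow> amap (comp_ftr C G F) X Y f = amap G (omap F X) (omap F Y) (amap F X Y f)"
  by (simp_all add: comp_ftr_def)

lemma const_ftr_simps [simp]:
  "X \<in> Obj C \<Longrightarrow> omap (const_ftr C D L) X = L"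
  "X \<in> Obj C \<Longrightarrow> Y \<in> Obj C \<Longrightarrow> f \<in> Hom C X Y \<Longrightarrow> amap (const_ftr C D L) X Y f = Id D L"
  by (simp_all add: const_ftr_def)

lemma id_ftr_simps [simp]:
  "X \<in> Obj C \<Longrightarrow> omap (id_ftr C) X = X"
  "X \<in> Obj C \<Longrightarrow> Y \<in> Obj C \<Longrightarrow> f \<in> Hom C X Y \<Longrightarrow> amap (id_ftr C) X Y f = f"
  by (simp_all add: id_ftr_def)

lemma is_functor_comp_ftr:
  assumes F: "is_functor C D F" and G: "is_functor D D' G"
  shows "is_functor C D' (comp_ftr C G F)"
  unfolding comp_ftr_def
  by (rule is_functorI)
    (simp_all add: is_functor_category[OF F] is_functor_category[OF G]
      is_functor_rules[OF F] is_functor_rules[OF G])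

lemma comp_ftr_assoc:
  assumes F: "is_functor C D F"
  shows "comp_ftr C (comp_ftr D H G) F = comp_ftr C H (comp_ftr C G F)"
  unfolding comp_ftr_def[of C "comp_ftr D H G"] comp_ftr_def[of C H]
  by (rule mk_ftr_cong) (simp_all add: is_functor_rules[OF F])

lemma comp_ftr_const_ftr:
  assumes "is_functor D D' H" "category C" "L \<in> Obj D"
  shows "comp_ftr C H (const_ftr C D L) = const_ftr C D' (omap H L)"
  unfolding comp_ftr_def const_ftr_def[of C D']
  by (rule mk_ftr_cong) (simp_all add: assms is_functor_rules[OF assms(1)])

lemma nat_transI:
  assumes "is_functor C D F" "is_functor C D G" "\<alpha> \<in> extensional (Obj C)"
    and "\<And>X. X \<in> Obj C \<Longrightarrow> \<alpha> X \<in> Hom D (omap F X) (omap G X)"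
    and "\<And>X Y f. X \<in> Obj C \<Longrightarrow> Y \<in> Obj C \<Longrightarrow> f \<in> Hom C X Y \<Longrightarrow>
        Comp D (omap F X) (omap F Y) (omap G Y) (\<alpha> Y) (amap F X Y f)
          = Comp D (omap F X) (omap G X) (omap G Y) (amap G X Y f) (\<alpha> X)"
  shows "nat_trans C D F G \<alpha>"
  using assms by (simp add: nat_trans_def)

lemma nat_trans_functors:
  assumes "nat_trans C D F G \<alpha>"
  shows "is_functor C D F" "is_functor C D G"
  using assms by (simp_all add: nat_trans_def)

lemma nat_trans_extensional: "nat_trans C D F G \<alpha> \<Longrightarrow> \<alpha> \<in> extensional (Obj C)"
  by (simp add: nat_trans_def)

lemma nat_trans_comp_in_Hom:
  "nat_trans C D F G \<alpha> \<Longrightarrow> X \<in> Obj C \<Longrightarrow> \<alpha> X \<in> Hom D (omap F X) (omap G X)"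
  by (simp add: nat_trans_def)

lemma nat_trans_naturality:
  "nat_trans C D F G \<alpha> \<Longrightarrow> X \<in> Obj C \<Longrightarrow> Y \<in> Obj C \<Longrightarrow> f \<in> Hom C X Y \<Longrightarrow>
     Comp D (omap F X) (omap F Y) (omap G Y) (\<alpha> Y) (amap F X Y f)
       = Comp D (omap F X) (omap G X) (omap G Y) (amap G X Y f) (\<alpha> X)"
  by (simp add: nat_trans_def)

lemma nat_trans_eqI:
  "nat_trans C D F G \<alpha> \<Longrightarrow> nat_trans C D' F' G' \<beta> \<Longrightarrow> (\<And>X. X \<in> Obj C \<Longrightarrow> \<alpha> X = \<beta> X) \<Longrightarrow> \<alpha> = \<beta>"
  unfolding nat_trans_def by (auto intro: extensionalityI)

lemma nat_trans_Id:
  assumes F: "is_functor C D F"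
  shows "nat_trans C D F F (\<lambda>X\<in>Obj C. Id D (omap F X))"
  by (rule nat_transI[OF F F])
    (simp_all add: is_functor_category[OF F] is_functor_rules[OF F] category_rules)

lemma nat_trans_Comp:
  assumes a: "nat_trans C D F G \<alpha>" and b: "nat_trans C D G H \<beta>"
  shows "nat_trans C D F H (\<lambda>X\<in>Obj C. Comp D (omap F X) (omap G X) (omap H X) (\<beta> X) (\<alpha> X))"
proof (rule nat_transI)
  note F = nat_trans_functors(1)[OF a] and G = nat_trans_functors(2)[OF a]
    and H = nat_trans_functors(2)[OF b]
  note cD = is_functor_category(2)[OF F]
  note r = is_functor_rules[OF F] is_functor_rules[OF G] is_functor_rules[OF H]
    nat_trans_comp_in_Hom[OF a] nat_trans_comp_in_Hom[OF b]
  show "is_functor C D F" "is_functor C D H" by (fact F H)+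
  fix X assume X: "X \<in> Obj C"
  then show "(\<lambda>X\<in>Obj C. Comp D (omap F X) (omap G X) (omap H X) (\<beta> X) (\<alpha> X)) X
      \<in> Hom D (omap F X) (omap H X)"
    by (simp add: r category_Comp[OF cD, where Y = "omap G X"])
  fix Y f assume Y: "Y \<in> Obj C" and f: "f \<in> Hom C X Y"
  have "Comp D (omap F X) (omap F Y) (omap H Y)
          (Comp D (omap F Y) (omap G Y) (omap H Y) (\<beta> Y) (\<alpha> Y)) (amap F X Y f)
      = Comp D (omap F X) (omap G Y) (omap H Y) (\<beta> Y)
          (Comp D (omap F X) (omap F Y) (omap G Y) (\<alpha> Y) (amap F X Y f))"
    by (rule category_assoc[OF cD, symmetric]) (simp_all add: X Y f r)
  also have "\<dots> = Comp D (omap F X) (omap G Y) (omap H Y) (\<beta> Y)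
          (Comp D (omap F X) (omap G X) (omap G Y) (amap G X Y f) (\<alpha> X))"
    by (simp add: nat_trans_naturality[OF a X Y f])
  also have "\<dots> = Comp D (omap F X) (omap G X) (omap H Y)
          (Comp D (omap G X) (omap G Y) (omap H Y) (\<beta> Y) (amap G X Y f)) (\<alpha> X)"
    by (rule category_assoc[OF cD]) (simp_all add: X Y f r)
  also have "\<dots> = Comp D (omap F X) (omap G X) (omap H Y)
          (Comp D (omap G X) (omap H X) (omap H Y) (amap H X Y f) (\<beta> X)) (\<alpha> X)"
    by (simp add: nat_trans_naturality[OF b X Y f])
  also have "\<dots> = Comp D (omap F X) (omap H X) (omap H Y) (amap H X Y f)
          (Comp D (omap F X) (omap G X) (omap H X) (\<beta> X) (\<alpha> X))"
    by (rule category_assoc[OF cD, symmetric]) (simp_all add: X Y f r)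
  finally show "Comp D (omap F X) (omap F Y) (omap H Y)
      ((\<lambda>X\<in>Obj C. Comp D (omap F X) (omap G X) (omap H X) (\<beta> X) (\<alpha> X)) Y) (amap F X Y f)
    = Comp D (omap F X) (omap H X) (omap H Y) (amap H X Y f)
      ((\<lambda>X\<in>Obj C. Comp D (omap F X) (omap G X) (omap H X) (\<beta> X) (\<alpha> X)) X)"
    by (simp add: X Y)
qed simp

lemma category_functor_cat:
  assumes "category C" and D: "category D"
  shows "category (functor_cat C D)"
  unfolding category_def functor_cat_simps mem_Collect_eq Ball_def
proof (intro conjI allI impI)
  fix F G \<alpha> assume a: "nat_trans C D F G \<alpha>"
  note F = nat_trans_functors(1)[OF a] and G = nat_trans_functors(2)[OF a]
  note r = is_functor_rules[OF F] is_functor_rules[OF G] nat_trans_comp_in_Hom[OF a]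
  show "(\<lambda>X\<in>Obj C. Comp D (omap F X) (omap F X) (omap G X) (\<alpha> X) ((\<lambda>X\<in>Obj C. Id D (omap F X)) X)) = \<alpha>"
    "(\<lambda>X\<in>Obj C. Comp D (omap F X) (omap G X) (omap G X) ((\<lambda>X\<in>Obj C. Id D (omap G X)) X) (\<alpha> X)) = \<alpha>"
    by (rule extensionalityI[OF restrict_extensional nat_trans_extensional[OF a]];
        simp add: r category_rules[OF D])+
next
  fix F G H K \<alpha> \<beta> \<gamma>
  assume a: "nat_trans C D F G \<alpha>" and b: "nat_trans C D G H \<beta>" and c: "nat_trans C D H K \<gamma>"
  note F = nat_trans_functors(1)[OF a] and G = nat_trans_functors(2)[OF a]
    and H = nat_trans_functors(1)[OF c] and K = nat_trans_functors(2)[OF c]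
  show "(\<lambda>X\<in>Obj C. Comp D (omap F X) (omap H X) (omap K X) (\<gamma> X)
           ((\<lambda>X\<in>Obj C. Comp D (omap F X) (omap G X) (omap H X) (\<beta> X) (\<alpha> X)) X))
      = (\<lambda>X\<in>Obj C. Comp D (omap F X) (omap G X) (omap K X)
           ((\<lambda>X\<in>Obj C. Comp D (omap G X) (omap H X) (omap K X) (\<gamma> X) (\<beta> X)) X) (\<alpha> X))"
    by (rule restrict_ext)
      (simp add: category_assoc[OF D] is_functor_omap[OF F] is_functor_omap[OF G]
        is_functor_omap[OF H] is_functor_omap[OF K] nat_trans_comp_in_Hom[OF a]
        nat_trans_comp_in_Hom[OF b] nat_trans_comp_in_Hom[OF c])
qed (auto intro: nat_trans_Id nat_trans_Comp)

lemma nat_trans_post_whisker: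
  assumes a: "nat_trans C D F G \<alpha>" and H: "is_functor D D' H"
  shows "nat_trans C D' (comp_ftr C H F) (comp_ftr C H G) (post_whisker C H F G \<alpha>)"
proof (rule nat_transI)
  note F = nat_trans_functors(1)[OF a] and G = nat_trans_functors(2)[OF a]
  note r = is_functor_rules[OF F] is_functor_rules[OF G] nat_trans_comp_in_Hom[OF a]
  show "is_functor C D' (comp_ftr C H F)" "is_functor C D' (comp_ftr C H G)"
    by (rule is_functor_comp_ftr[OF F H] is_functor_comp_ftr[OF G H])+
  show "post_whisker C H F G \<alpha> \<in> extensional (Obj C)" by (simp add: post_whisker_def)
  fix X assume X: "X \<in> Obj C"
  then show "post_whisker C H F G \<alpha> X \<in> Hom D' (omap (comp_ftr C H F) X) (omap (comp_ftr C H G) X)"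
    by (simp add: post_whisker_def r is_functor_rules[OF H])
  fix Y f assume Y: "Y \<in> Obj C" and f: "f \<in> Hom C X Y"
  have "Comp D' (omap H (omap F X)) (omap H (omap F Y)) (omap H (omap G Y))
          (amap H (omap F Y) (omap G Y) (\<alpha> Y)) (amap H (omap F X) (omap F Y) (amap F X Y f))
      = amap H (omap F X) (omap G Y) (Comp D (omap F X) (omap F Y) (omap G Y) (\<alpha> Y) (amap F X Y f))"
    by (rule is_functor_Comp[OF H, symmetric]) (simp_all add: X Y f r)
  also have "\<dots> = amap H (omap F X) (omap G Y)
      (Comp D (omap F X) (omap G X) (omap G Y) (amap G X Y f) (\<alpha> X))"
    by (simp add: nat_trans_naturality[OF a X Y f])
  also have "\<dots> = Comp D' (omap H (omap F X)) (omap H (omap G X)) (omap H (omap G Y))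
      (amap H (omap G X) (omap G Y) (amap G X Y f)) (amap H (omap F X) (omap G X) (\<alpha> X))"
    by (rule is_functor_Comp[OF H]) (simp_all add: X Y f r)
  finally show "Comp D' (omap (comp_ftr C H F) X) (omap (comp_ftr C H F) Y) (omap (comp_ftr C H G) Y)
      (post_whisker C H F G \<alpha> Y) (amap (comp_ftr C H F) X Y f)
    = Comp D' (omap (comp_ftr C H F) X) (omap (comp_ftr C H G) X) (omap (comp_ftr C H G) Y)
      (amap (comp_ftr C H G) X Y f) (post_whisker C H F G \<alpha> X)"
    by (simp add: X Y f post_whisker_def)
qed

lemma nat_trans_pre_whisker:
  assumes a: "nat_trans D D' G H \<alpha>" and F: "is_functor C D F"
  shows "nat_trans C D' (comp_ftr C G F) (comp_ftr C H F) (pre_whisker C \<alpha> F)"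
  by (rule nat_transI)
    (simp_all add: is_functor_comp_ftr[OF F nat_trans_functors(1)[OF a]]
      is_functor_comp_ftr[OF F nat_trans_functors(2)[OF a]] pre_whisker_def
      nat_trans_comp_in_Hom[OF a] nat_trans_naturality[OF a] is_functor_rules[OF F])


section \<open>Presheaves and their colimits\<close>

lemma presheaf_cat_simps [simp]:
  "Obj (presheaf_cat A) = {P. is_functor (op_cat A) set_cat P}"
  "Hom (presheaf_cat A) P Q = {\<alpha>. nat_trans (op_cat A) set_cat P Q \<alpha>}"
  "Id (presheaf_cat A) P = (\<lambda>X\<in>Obj A. \<lambda>x\<in>omap P X. x)"
  "Comp (presheaf_cat A) P Q R \<beta> \<alpha> = (\<lambda>X\<in>Obj A. compose (omap P X) (\<beta> X) (\<alpha> X))"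
  by (simp_all add: presheaf_cat_def)

lemma category_presheaf_cat: "category A \<Longrightarrow> category (presheaf_cat A)"
  unfolding presheaf_cat_def by (intro category_functor_cat category_op_cat category_set_cat)

lemma presheafI:
  fixes fo :: "'a \<Rightarrow> 'u::universe set"
  assumes A: "category A" and fo: "\<And>X. X \<in> Obj A \<Longrightarrow> small TYPE('u) (fo X)"
    and fa: "\<And>X Y f. X \<in> Obj A \<Longrightarrow> Y \<in> Obj A \<Longrightarrow> f \<in> Hom A Y X \<Longrightarrow> fa X Y f \<in> fo X \<rightarrow>\<^sub>E fo Y"
    and fid: "\<And>X x. X \<in> Obj A \<Longrightarrow> x \<in> fo X \<Longrightarrow> fa X X (Id A X) x = x"
    and fcomp: "\<And>X Y Z f g x. X \<in> Obj A \<Longrightarrow> Y \<in> Obj A \<Longrightarrow> Z \<in> Obj A \<Longrightarrow> f \<in> Hom A Y X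
      \<Longrightarrow> g \<in> Hom A Z Y \<Longrightarrow> x \<in> fo X \<Longrightarrow> fa X Z (Comp A Z Y X f g) x = fa Y Z g (fa X Y f x)"
  shows "is_functor (op_cat A) set_cat (mk_ftr (op_cat A) fo fa)"
proof (rule is_functorI)
  fix X assume X: "X \<in> Obj (op_cat A)"
  then have "fa X X (Id A X) \<in> fo X \<rightarrow>\<^sub>E fo X"
    using fa category_Id[OF A] by simp
  then show "fa X X (Id (op_cat A) X) = Id set_cat (fo X)"
    using X by (auto simp: fid PiE_iff intro!: extensionalityI[where A = "fo X"])
next
  fix X Y Z f g assume h: "X \<in> Obj (op_cat A)" "Y \<in> Obj (op_cat A)" "Z \<in> Obj (op_cat A)"
    "f \<in> Hom (op_cat A) X Y" "g \<in> Hom (op_cat A) Y Z"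
  then have "fa X Z (Comp A Z Y X f g) \<in> fo X \<rightarrow>\<^sub>E fo Z"
    using fa category_Comp[OF A] by simp
  then show "fa X Z (Comp (op_cat A) X Y Z g f)
      = Comp set_cat (fo X) (fo Y) (fo Z) (fa Y Z g) (fa X Y f)"
    using h by (auto simp: fcomp compose_eq PiE_iff intro!: extensionalityI[where A = "fo X"])
qed (use assms in \<open>simp_all add: category_op_cat category_set_cat\<close>)

lemma presheaf_simps:
  fixes P :: "('a, 'm, 'u::universe set, 'u \<Rightarrow> 'u) ftr"
  assumes P: "is_functor (op_cat A) set_cat P" and X: "X \<in> Obj A"
  shows "small TYPE('u) (omap P X)"
    and "x \<in> omap P X \<Longrightarrow> amap P X X (Id A X) x = x"
    and "Y \<in> Obj A \<Longrightarrow> f \<in> Hom A Y X \<Longrightarrow> amap P X Y f \<in> omap P X \<rightarrow>\<^sub>E omap P Y"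
    and "Y \<in> Obj A \<Longrightarrow> f \<in> Hom A Y X \<Longrightarrow> x \<in> omap P X \<Longrightarrow> amap P X Y f x \<in> omap P Y"
    and "Y \<in> Obj A \<Longrightarrow> Z \<in> Obj A \<Longrightarrow> f \<in> Hom A Y X \<Longrightarrow> g \<in> Hom A Z Y \<Longrightarrow> x \<in> omap P X
      \<Longrightarrow> amap P X Z (Comp A Z Y X f g) x = amap P Y Z g (amap P X Y f x)"
proof -
  show "small TYPE('u) (omap P X)" using is_functor_omap[OF P] X by simp
  show "x \<in> omap P X \<Longrightarrow> amap P X X (Id A X) x = x" using is_functor_Id[OF P] X by simp
  show *: "Y \<in> Obj A \<Longrightarrow> f \<in> Hom A Y X \<Longrightarrow> amap P X Y f \<in> omap P X \<rightarrow>\<^sub>E omap P Y"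
    using is_functor_amap[OF P, of X Y f] X by simp
  then show "Y \<in> Obj A \<Longrightarrow> f \<in> Hom A Y X \<Longrightarrow> x \<in> omap P X \<Longrightarrow> amap P X Y f x \<in> omap P Y" by blast
  show "Y \<in> Obj A \<Longrightarrow> Z \<in> Obj A \<Longrightarrow> f \<in> Hom A Y X \<Longrightarrow> g \<in> Hom A Z Y \<Longrightarrow> x \<in> omap P X
      \<Longrightarrow> amap P X Z (Comp A Z Y X f g) x = amap P Y Z g (amap P X Y f x)"
    using is_functor_Comp[OF P, of X Y Z f g] X by (simp add: compose_eq)
qed

lemma presheaf_mapI:
  assumes P: "is_functor (op_cat A) set_cat P" and Q: "is_functor (op_cat A) set_cat Q"
    and "\<alpha> \<in> extensional (Obj A)" and a: "\<And>X. X \<in> Obj A \<Longrightarrow> \<alpha> X \<in> omap P X \<rightarrow>\<^sub>E omap Q X"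
    and nat: "\<And>X Y f x. X \<in> Obj A \<Longrightarrow> Y \<in> Obj A \<Longrightarrow> f \<in> Hom A Y X \<Longrightarrow> x \<in> omap P X
      \<Longrightarrow> \<alpha> Y (amap P X Y f x) = amap Q X Y f (\<alpha> X x)"
  shows "nat_trans (op_cat A) set_cat P Q \<alpha>"
proof (rule nat_transI[OF P Q])
  fix X Y f assume h: "X \<in> Obj (op_cat A)" "Y \<in> Obj (op_cat A)" "f \<in> Hom (op_cat A) X Y"
  have "compose (omap P X) (\<alpha> Y) (amap P X Y f) = compose (omap P X) (amap Q X Y f) (\<alpha> X)"
    by (rule extensionalityI[OF compose_extensional compose_extensional])
      (use h in \<open>simp add: compose_eq nat\<close>)
  then show "Comp set_cat (omap P X) (omap P Y) (omap Q Y) (\<alpha> Y) (amap P X Y f)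
      = Comp set_cat (omap P X) (omap Q X) (omap Q Y) (amap Q X Y f) (\<alpha> X)"
    by simp
qed (use assms in simp_all)

lemma presheaf_map_simps:
  assumes a: "nat_trans (op_cat A) set_cat P Q \<alpha>" and X: "X \<in> Obj A"
  shows "\<alpha> X \<in> omap P X \<rightarrow>\<^sub>E omap Q X"
    and "x \<in> omap P X \<Longrightarrow> \<alpha> X x \<in> omap Q X"
    and "Y \<in> Obj A \<Longrightarrow> f \<in> Hom A Y X \<Longrightarrow> x \<in> omap P X \<Longrightarrow> \<alpha> Y (amap P X Y f x) = amap Q X Y f (\<alpha> X x)"
proof -
  show *: "\<alpha> X \<in> omap P X \<rightarrow>\<^sub>E omap Q X" using nat_trans_comp_in_Hom[OF a] X by simp
  then show "x \<in> omap P X \<Longrightarrow> \<alpha> X x \<in> omap Q X" by blast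
  assume "Y \<in> Obj A" "f \<in> Hom A Y X" "x \<in> omap P X"
  then have "compose (omap P X) (\<alpha> Y) (amap P X Y f) x = compose (omap P X) (amap Q X Y f) (\<alpha> X) x"
    using nat_trans_naturality[OF a, of X Y f] X by simp
  then show "\<alpha> Y (amap P X Y f x) = amap Q X Y f (\<alpha> X x)"
    using \<open>x \<in> omap P X\<close> by (simp add: compose_eq)
qed

lemma presheaf_map_eqI:
  assumes "nat_trans (op_cat A) set_cat P Q \<alpha>" "nat_trans (op_cat A) set_cat P Q' \<beta>"
    and "\<And>X x. X \<in> Obj A \<Longrightarrow> x \<in> omap P X \<Longrightarrow> \<alpha> X x = \<beta> X x"
  shows "\<alpha> = \<beta>"
proof (rule nat_trans_eqI[OF assms(1,2)])
  fix X assume "X \<in> Obj (op_cat A)"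
  then have "\<alpha> X \<in> extensional (omap P X)" "\<beta> X \<in> extensional (omap P X)" "X \<in> Obj A"
    using presheaf_map_simps(1)[OF assms(1)] presheaf_map_simps(1)[OF assms(2)]
    by (auto simp: PiE_iff)
  then show "\<alpha> X = \<beta> X" using assms(3) by (auto intro: extensionalityI)
qed

lemma presheaf_coconeI:
  assumes J: "category J" and D: "is_functor J (presheaf_cat A) D"
    and L: "is_functor (op_cat A) set_cat L" and "c \<in> extensional (Obj J)"
    and c: "\<And>j. j \<in> Obj J \<Longrightarrow> nat_trans (op_cat A) set_cat (omap D j) L (c j)"
    and comp: "\<And>j k f B y. j \<in> Obj J \<Longrightarrow> k \<in> Obj J \<Longrightarrow> f \<in> Hom J j k \<Longrightarrow> B \<in> Obj A
      \<Longrightarrow> y \<in> omap (omap D j) B \<Longrightarrow> c k B (amap D j k f B y) = c j B y"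
  shows "nat_trans J (presheaf_cat A) D (const_ftr J (presheaf_cat A) L) c"
proof (rule nat_transI[OF D])
  show "is_functor J (presheaf_cat A) (const_ftr J (presheaf_cat A) L)"
    using is_functor_const_ftr[OF J is_functor_category(2)[OF D]] L by simp
next
  fix j assume "j \<in> Obj J"
  then show "c j \<in> Hom (presheaf_cat A) (omap D j) (omap (const_ftr J (presheaf_cat A) L) j)"
    using c by simp
next
  fix j k f assume jk: "j \<in> Obj J" "k \<in> Obj J" "f \<in> Hom J j k"
  then have f: "nat_trans (op_cat A) set_cat (omap D j) (omap D k) (amap D j k f)"
    using is_functor_amap[OF D] by simp
  have "compose (omap (omap D j) X) (c k X) (amap D j k f X)
      = compose (omap (omap D j) X) (\<lambda>x\<in>omap L X. x) (c j X)" if X: "X \<in> Obj A" for X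
    by (rule extensionalityI[OF compose_extensional compose_extensional])
      (simp add: compose_eq comp[OF jk X] presheaf_map_simps[OF c[OF jk(1)] X])
  then show "Comp (presheaf_cat A) (omap D j) (omap D k) (omap (const_ftr J (presheaf_cat A) L) k)
      (c k) (amap D j k f) = Comp (presheaf_cat A) (omap D j)
      (omap (const_ftr J (presheaf_cat A) L) j) (omap (const_ftr J (presheaf_cat A) L) k)
      (amap (const_ftr J (presheaf_cat A) L) j k f) (c j)"
    using jk by (auto intro!: restrict_ext)
qed fact

lemma presheaf_cocone_simps:
  assumes c: "nat_trans J (presheaf_cat A) D (const_ftr J (presheaf_cat A) L) c" and j: "j \<in> Obj J"
  shows "nat_trans (op_cat A) set_cat (omap D j) L (c j)"
    and "k \<in> Obj J \<Longrightarrow> f \<in> Hom J j k \<Longrightarrow> B \<in> Obj A \<Longrightarrow> y \<in> omap (omap D j) B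
      \<Longrightarrow> c k B (amap D j k f B y) = c j B y"
proof -
  show *: "nat_trans (op_cat A) set_cat (omap D j) L (c j)"
    using nat_trans_comp_in_Hom[OF c j] j by simp
  assume h: "k \<in> Obj J" "f \<in> Hom J j k" "B \<in> Obj A" "y \<in> omap (omap D j) B"
  have "compose (omap (omap D j) B) (c k B) (amap D j k f B) y
      = compose (omap (omap D j) B) (\<lambda>x\<in>omap L B. x) (c j B) y"
    using fun_cong[OF nat_trans_naturality[OF c j h(1,2)], of B] j h by simp
  then show "c k B (amap D j k f B y) = c j B y"
    using h(4) by (simp add: compose_eq presheaf_map_simps[OF * h(3)])
qed

lemma small_image: "small TYPE('u::universe) S \<Longrightarrow> small TYPE('u) (f ` S)"
  unfolding small_def by (rule lesspoll_trans1[OF image_lepoll])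

text \<open>
  A chosen injection of the subsets of a small set into the universe; it makes a power set an object
  of the category of sets.
\<close>

definition subset_code :: "'u::universe set \<Rightarrow> 'u set \<Rightarrow> 'u" where
  "subset_code S = (SOME e. inj_on e (Pow S))"

lemma subset_code:
  fixes S :: "'u::universe set"
  assumes "small TYPE('u) S"
  shows "inj_on (subset_code S) (Pow S)" and "small TYPE('u) (subset_code S ` Pow S)"
proof -
  have P: "Pow S \<prec> (UNIV :: 'u set)"
    using assms universe_Pow by (simp add: small_def)
  then obtain e :: "'u set \<Rightarrow> 'u" where "inj_on e (Pow S)"
    unfolding lesspoll_def lepoll_def by blast
  then show "inj_on (subset_code S) (Pow S)"
    unfolding subset_code_def by (rule someI[where P = "\<lambda>e. inj_on e (Pow S)"])
  show "small TYPE('u) (subset_code S ` Pow S)"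
    using P by (intro small_image) (simp add: small_def)
qed

text \<open>
  The presheaf \<open>X \<mapsto> Pow (Hom B X)\<close>, with inverse image as action. It is the presheaf cofreely
  generated by a two-element set at \<open>B\<close>: a subset \<open>S\<close> of \<open>P B\<close> has a characteristic map from the
  presheaf \<open>P\<close>, sending \<open>x \<in> P X\<close> to the set of those \<open>u : B \<rightarrow> X\<close> along which \<open>x\<close> restricts
  into \<open>S\<close>.
\<close>

definition power_presheaf ::
  "('a, 'u::universe) category \<Rightarrow> 'a \<Rightarrow> ('a, 'u, 'u set, 'u \<Rightarrow> 'u) ftr" where
  "power_presheaf A B = mk_ftr (op_cat A) (\<lambda>X. subset_code (Hom A B X) ` Pow (Hom A B X))
     (\<lambda>X Y f. \<lambda>s\<in>subset_code (Hom A B X) ` Pow (Hom A B X). subset_code (Hom A B Y)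
        {u \<in> Hom A B Y. Comp A B Y X f u
           \<in> inv_into (Pow (Hom A B X)) (subset_code (Hom A B X)) s})"

definition char_map :: "('a, 'u::universe) category \<Rightarrow> 'a \<Rightarrow> ('a, 'u, 'u set, 'u \<Rightarrow> 'u) ftr
    \<Rightarrow> 'u set \<Rightarrow> 'a \<Rightarrow> 'u \<Rightarrow> 'u" where
  "char_map A B P S = (\<lambda>X\<in>Obj A. \<lambda>x\<in>omap P X.
     subset_code (Hom A B X) {u \<in> Hom A B X. amap P X B u x \<in> S})"

context
  fixes A :: "('a, 'u::universe) category" and B :: 'a
  assumes A: "category A" "locally_small A" and B: "B \<in> Obj A"
begin

lemma subset_code_Hom:
  "X \<in> Obj A \<Longrightarrow> inj_on (subset_code (Hom A B X)) (Pow (Hom A B X))"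
  "X \<in> Obj A \<Longrightarrow> small TYPE('u) (subset_code (Hom A B X) ` Pow (Hom A B X))"
  using A B by (simp_all add: subset_code locally_small_def)

lemma omap_power_presheaf:
  "X \<in> Obj A \<Longrightarrow> omap (power_presheaf A B) X = subset_code (Hom A B X) ` Pow (Hom A B X)"
  by (simp add: power_presheaf_def)

lemma amap_power_presheaf:
  assumes "X \<in> Obj A" "Y \<in> Obj A" "f \<in> Hom A Y X" "S \<subseteq> Hom A B X"
  shows "amap (power_presheaf A B) X Y f (subset_code (Hom A B X) S)
    = subset_code (Hom A B Y) {u \<in> Hom A B Y. Comp A B Y X f u \<in> S}"
  using assms subset_code_Hom(1)[of X] by (simp add: power_presheaf_def inv_into_f_f)

lemma is_functor_power_presheaf: "is_functor (op_cat A) set_cat (power_presheaf A B)"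
  unfolding power_presheaf_def
proof (rule presheafI[OF A(1)])
  fix X x assume X: "X \<in> Obj A" and x: "x \<in> subset_code (Hom A B X) ` Pow (Hom A B X)"
  then obtain S where S: "S \<subseteq> Hom A B X" "x = subset_code (Hom A B X) S" by blast
  have "{u \<in> Hom A B X. Comp A B X X (Id A X) u \<in> S} = S"
    using S(1) by (auto simp: category_Id_left[OF A(1) B X])
  then show "(\<lambda>s\<in>subset_code (Hom A B X) ` Pow (Hom A B X). subset_code (Hom A B X)
        {u \<in> Hom A B X. Comp A B X X (Id A X) u
           \<in> inv_into (Pow (Hom A B X)) (subset_code (Hom A B X)) s}) x = x"
    using S subset_code_Hom(1)[OF X] by (simp add: inv_into_f_f)
next
  fix X Y Z f g x
  assume X: "X \<in> Obj A" "Y \<in> Obj A" "Z \<in> Obj A" and f: "f \<in> Hom A Y X" and g: "g \<in> Hom A Z Y"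
    and x: "x \<in> subset_code (Hom A B X) ` Pow (Hom A B X)"
  then obtain S where S: "S \<subseteq> Hom A B X" "x = subset_code (Hom A B X) S" by blast
  have "{u \<in> Hom A B Z. Comp A B Z X (Comp A Z Y X f g) u \<in> S}
      = {u \<in> Hom A B Z. Comp A B Z Y g u \<in> {v \<in> Hom A B Y. Comp A B Y X f v \<in> S}}"
    using X f g B by (auto simp: category_Comp[OF A(1)] category_assoc[OF A(1)])
  then show "(\<lambda>s\<in>subset_code (Hom A B X) ` Pow (Hom A B X). subset_code (Hom A B Z)
        {u \<in> Hom A B Z. Comp A B Z X (Comp A Z Y X f g) u
           \<in> inv_into (Pow (Hom A B X)) (subset_code (Hom A B X)) s}) x =
      (\<lambda>s\<in>subset_code (Hom A B Y) ` Pow (Hom A B Y). subset_code (Hom A B Z)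
        {u \<in> Hom A B Z. Comp A B Z Y g u
           \<in> inv_into (Pow (Hom A B Y)) (subset_code (Hom A B Y)) s})
      ((\<lambda>s\<in>subset_code (Hom A B X) ` Pow (Hom A B X). subset_code (Hom A B Y)
        {u \<in> Hom A B Y. Comp A B Y X f u
           \<in> inv_into (Pow (Hom A B X)) (subset_code (Hom A B X)) s}) x)"
    using S subset_code_Hom(1)[OF X(1)] subset_code_Hom(1)[OF X(2)] by (simp add: inv_into_f_f)
qed (auto simp: subset_code_Hom)

lemma nat_trans_char_map:
  assumes P: "is_functor (op_cat A) set_cat P"
  shows "nat_trans (op_cat A) set_cat P (power_presheaf A B) (char_map A B P S)"
proof (rule presheaf_mapI[OF P is_functor_power_presheaf])
  fix X Y f x assume h: "X \<in> Obj A" "Y \<in> Obj A" "f \<in> Hom A Y X" "x \<in> omap P X"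
  have "{u \<in> Hom A B Y. Comp A B Y X f u \<in> {u \<in> Hom A B X. amap P X B u x \<in> S}}
      = {u \<in> Hom A B Y. amap P Y B u (amap P X Y f x) \<in> S}"
    using h B by (auto simp: category_Comp[OF A(1)] presheaf_simps[OF P])
  then show "char_map A B P S Y (amap P X Y f x)
      = amap (power_presheaf A B) X Y f (char_map A B P S X x)"
    using h by (simp add: char_map_def amap_power_presheaf presheaf_simps[OF P])
qed (auto simp: char_map_def omap_power_presheaf)

lemma char_map_natural:
  assumes a: "nat_trans (op_cat A) set_cat P P' \<alpha>" and X: "X \<in> Obj A" and x: "x \<in> omap P X"
    and S: "\<And>y. y \<in> omap P B \<Longrightarrow> y \<in> S \<longleftrightarrow> \<alpha> B y \<in> S'"
  shows "char_map A B P' S' X (\<alpha> X x) = char_map A B P S X x"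
proof -
  have "{u \<in> Hom A B X. amap P' X B u (\<alpha> X x) \<in> S'} = {u \<in> Hom A B X. amap P X B u x \<in> S}"
    using X x B S presheaf_simps(4)[OF nat_trans_functors(1)[OF a]]
    by (auto simp: presheaf_map_simps(3)[OF a, symmetric])
  then show ?thesis
    using X x by (simp add: char_map_def presheaf_map_simps[OF a])
qed

lemma char_map_eq_imp:
  assumes P: "is_functor (op_cat A) set_cat P" and P': "is_functor (op_cat A) set_cat P'"
    and "x \<in> omap P B" "x' \<in> omap P' B" "char_map A B P S B x = char_map A B P' S' B x'"
  shows "x \<in> S \<longleftrightarrow> x' \<in> S'"
proof -
  have "{u \<in> Hom A B B. amap P B B u x \<in> S} = {u \<in> Hom A B B. amap P' B B u x' \<in> S'}"
    using assms B inj_onD[OF subset_code_Hom(1)[OF B]] by (simp add: char_map_def)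
  moreover have "Id A B \<in> Hom A B B" using A(1) B by (rule category_Id)
  ultimately have "amap P B B (Id A B) x \<in> S \<longleftrightarrow> amap P' B B (Id A B) x' \<in> S'" by blast
  then show ?thesis
    using assms(3,4) by (simp add: presheaf_simps(2)[OF P B] presheaf_simps(2)[OF P' B])
qed

end

text \<open>
  Colimits of presheaves are computed pointwise, and a cocone of sets is a colimit if it is jointly
  surjective and identifies only elements that are connected by the diagram. The latter is expressed
  by saying that a predicate on the elements of the diagram which is invariant under the diagram takes
  the same value at any two elements with the same image in the cocone. Conversely, a colimit has both
  properties at \<open>B\<close>, since maps from it to \<open>power_presheaf A B\<close> classify subsets of its value
  at \<open>B\<close>, while cocones to this presheaf classify invariant predicates. No smallness of the diagram
  is needed.
\<close>

proposition presheaf_colimit_iff: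
  fixes A :: "('a, 'u::universe) category"
  assumes A: "category A" "locally_small A" and L: "L \<in> Obj (presheaf_cat A)"
    and c: "nat_trans J (presheaf_cat A) D (const_ftr J (presheaf_cat A) L) c"
  shows "colimit_cocone J (presheaf_cat A) D L c \<longleftrightarrow>
    (\<forall>B\<in>Obj A.
       (\<forall>x\<in>omap L B. \<exists>j\<in>Obj J. \<exists>y\<in>omap (omap D j) B. c j B y = x) \<and>
       (\<forall>Q :: _ \<Rightarrow> _ \<Rightarrow> bool. (\<forall>j\<in>Obj J. \<forall>k\<in>Obj J. \<forall>f\<in>Hom J j k. \<forall>y\<in>omap (omap D j) B.
               Q j y = Q k (amap D j k f B y)) \<longrightarrow>
            (\<forall>j\<in>Obj J. \<forall>k\<in>Obj J. \<forall>y\<in>omap (omap D j) B. \<forall>z\<in>omap (omap D k) B.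
               c j B y = c k B z \<longrightarrow> Q j y = Q k z)))"
    (is "_ \<longleftrightarrow> (\<forall>B\<in>Obj A. ?surj B \<and> ?conn B)")
proof
  note D = nat_trans_functors(1)[OF c]
  note J = is_functor_category(1)[OF D]
  note cj = presheaf_cocone_simps[OF c]
  note fD = nat_trans_functors(1)[OF cj(1)]
  have fL: "is_functor (op_cat A) set_cat L" using L by simp
  {
    assume colim: "colimit_cocone J (presheaf_cat A) D L c"
    have univ: "\<exists>!h. nat_trans (op_cat A) set_cat L R h \<and>
        (\<forall>j\<in>Obj J. Comp (presheaf_cat A) (omap D j) L R h (c j) = c' j)"
      if "nat_trans J (presheaf_cat A) D (const_ftr J (presheaf_cat A) R) c'"
        and "is_functor (op_cat A) set_cat R" for R c'
      using colim that unfolding colimit_cocone_def by simp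
    show "\<forall>B\<in>Obj A. ?surj B \<and> ?conn B"
    proof
      fix B assume B: "B \<in> Obj A"
      let ?R = "power_presheaf A B"
      note R = is_functor_power_presheaf[OF A B]
      note char = nat_trans_char_map[OF A B]
      have cocone: "nat_trans J (presheaf_cat A) D (const_ftr J (presheaf_cat A) ?R)
          (\<lambda>j\<in>Obj J. char_map A B (omap D j) {y. Q j y})"
        if Q: "\<forall>j\<in>Obj J. \<forall>k\<in>Obj J. \<forall>f\<in>Hom J j k. \<forall>y\<in>omap (omap D j) B.
          Q j y = Q k (amap D j k f B y)" for Q
      proof (rule presheaf_coconeI[OF J D R])
        fix j k f X y assume h: "j \<in> Obj J" "k \<in> Obj J" "f \<in> Hom J j k" "X \<in> Obj A"
          "y \<in> omap (omap D j) X"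
        then have "nat_trans (op_cat A) set_cat (omap D j) (omap D k) (amap D j k f)"
          using is_functor_amap[OF D] by simp
        then have "char_map A B (omap D k) {y. Q k y} X (amap D j k f X y)
            = char_map A B (omap D j) {y. Q j y} X y"
          by (rule char_map_natural[OF A B]) (use h Q in auto)
        then show "(\<lambda>j\<in>Obj J. char_map A B (omap D j) {y. Q j y}) k X (amap D j k f X y)
            = (\<lambda>j\<in>Obj J. char_map A B (omap D j) {y. Q j y}) j X y"
          using h by simp
      qed (simp_all add: char fD)
      have "?surj B"
      proof
        fix x assume x: "x \<in> omap L B"
        \<comment> \<open>The map classifying the joint image \<open>?S\<close> and the one classifying all of \<open>L B\<close> have the
          same composites with the cocone, so they are equal.\<close>
        let ?S = "{c j B y | j y. j \<in> Obj J \<and> y \<in> omap (omap D j) B}"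
        have eq: "Comp (presheaf_cat A) (omap D j) L ?R (char_map A B L S) (c j)
            = (\<lambda>j\<in>Obj J. char_map A B (omap D j) {y. True}) j"
          if "j \<in> Obj J" "?S \<subseteq> S" for j S
        proof -
          have "compose (omap (omap D j) X) (char_map A B L S X) (c j X)
              = char_map A B (omap D j) {y. True} X" if X: "X \<in> Obj A" for X
          proof (rule extensionalityI[OF compose_extensional])
            show "char_map A B (omap D j) {y. True} X \<in> extensional (omap (omap D j) X)"
              using X by (simp add: char_map_def)
            fix y assume y: "y \<in> omap (omap D j) X"
            have "char_map A B L S X (c j X y) = char_map A B (omap D j) {y. True} X y"
              by (rule char_map_natural[OF A B cj(1)]) (use \<open>?S \<subseteq> S\<close> \<open>j \<in> Obj J\<close> X y in auto)
            then show "compose (omap (omap D j) X) (char_map A B L S X) (c j X) y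
                = char_map A B (omap D j) {y. True} X y"
              using y by (simp add: compose_eq)
          qed
          then show ?thesis
            using \<open>j \<in> Obj J\<close> by (auto simp: char_map_def)
        qed
        have factor: "nat_trans (op_cat A) set_cat L ?R (char_map A B L S) \<and>
            (\<forall>j\<in>Obj J. Comp (presheaf_cat A) (omap D j) L ?R (char_map A B L S) (c j)
              = (\<lambda>j\<in>Obj J. char_map A B (omap D j) {y. True}) j)" if "?S \<subseteq> S" for S
          using char[OF fL] eq[OF _ that] by blast
        have "\<exists>!h. nat_trans (op_cat A) set_cat L ?R h \<and>
            (\<forall>j\<in>Obj J. Comp (presheaf_cat A) (omap D j) L ?R h (c j)
              = (\<lambda>j\<in>Obj J. char_map A B (omap D j) {y. True}) j)"
          by (rule univ[OF cocone[of "\<lambda>j y. True"] R]) simp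
        with factor[OF subset_refl] factor[OF subset_UNIV]
        have "char_map A B L ?S = char_map A B L UNIV" by blast
        then have "x \<in> ?S"
          using char_map_eq_imp[OF A B fL fL x x, of ?S UNIV] by simp
        then show "\<exists>j\<in>Obj J. \<exists>y\<in>omap (omap D j) B. c j B y = x" by blast
      qed
      moreover have "?conn B"
      proof (intro allI impI ballI)
        fix Q :: "_ \<Rightarrow> _ \<Rightarrow> bool" and j k y z
        assume Q: "\<forall>j\<in>Obj J. \<forall>k\<in>Obj J. \<forall>f\<in>Hom J j k. \<forall>y\<in>omap (omap D j) B.
               Q j y = Q k (amap D j k f B y)"
          and j: "j \<in> Obj J" and k: "k \<in> Obj J" and y: "y \<in> omap (omap D j) B"
          and z: "z \<in> omap (omap D k) B" and eq: "c j B y = c k B z"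
        obtain h where h: "\<And>i. i \<in> Obj J \<Longrightarrow>
            Comp (presheaf_cat A) (omap D i) L ?R h (c i) = char_map A B (omap D i) {y. Q i y}"
          using univ[OF cocone[OF Q] R] by auto
        have hB: "h B (c i B w) = char_map A B (omap D i) {y. Q i y} B w"
          if "i \<in> Obj J" "w \<in> omap (omap D i) B" for i w
          using fun_cong[OF fun_cong[OF h[OF that(1)], of B], of w] that B
          by (simp add: compose_eq)
        have "char_map A B (omap D j) {y. Q j y} B y = char_map A B (omap D k) {y. Q k y} B z"
          using hB[OF j y] hB[OF k z] eq by simp
        then show "Q j y = Q k z"
          using char_map_eq_imp[OF A B fD[OF j] fD[OF k] y z, of "{y. Q j y}" "{y. Q k y}"] by simp
      qed
      ultimately show "?surj B \<and> ?conn B" ..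
    qed
  next
    assume ptw: "\<forall>B\<in>Obj A. ?surj B \<and> ?conn B"
    show "colimit_cocone J (presheaf_cat A) D L c"
      unfolding colimit_cocone_def
    proof (intro conjI ballI allI impI)
      fix L' c'
      assume "L' \<in> Obj (presheaf_cat A)"
        and c': "nat_trans J (presheaf_cat A) D (const_ftr J (presheaf_cat A) L') c'"
      then have fL': "is_functor (op_cat A) set_cat L'" by simp
      note cj' = presheaf_cocone_simps[OF c']
      \<comment> \<open>Having the same image under \<open>c'\<close> as a given element is an invariant predicate.\<close>
      have welldef: "c' j B y = c' k B z"
        if h: "B \<in> Obj A" "j \<in> Obj J" "k \<in> Obj J" "y \<in> omap (omap D j) B" "z \<in> omap (omap D k) B"
          "c j B y = c k B z" for B j k y z
      proof -
        have "(c' j B y = c' k B z) = (c' k B z = c' k B z)"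
          by (rule ptw[THEN bspec, OF h(1), THEN conjunct2, THEN spec[of _ "\<lambda>i w. c' i B w = c' k B z"],
                THEN mp, THEN bspec, THEN bspec, THEN bspec, THEN bspec, THEN mp])
            (use h in \<open>simp_all add: cj'(2)\<close>)
        then show ?thesis by simp
      qed
      define r where "r B x = (SOME (j, y). j \<in> Obj J \<and> y \<in> omap (omap D j) B \<and> c j B y = x)" for B x
      define h where "h = (\<lambda>B\<in>Obj A. \<lambda>x\<in>omap L B. c' (fst (r B x)) B (snd (r B x)))"
      have h: "h B (c j B y) = c' j B y"
        if "B \<in> Obj A" "j \<in> Obj J" "y \<in> omap (omap D j) B" for B j y
      proof -
        have "case r B (c j B y) of (k, z) \<Rightarrow> k \<in> Obj J \<and> z \<in> omap (omap D k) B \<and> c k B z = c j B y"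
          unfolding r_def by (rule someI[of _ "(j, y)"]) (use that in simp)
        then show ?thesis
          using that presheaf_map_simps(2)[OF cj(1)[OF that(2)] that(1,3)]
          by (auto simp: h_def split: prod.splits intro!: welldef)
      qed
      have surj: "\<exists>j y. j \<in> Obj J \<and> y \<in> omap (omap D j) B \<and> x = c j B y"
        if "B \<in> Obj A" "x \<in> omap L B" for B x
      proof -
        have "?surj B" using ptw that(1) by blast
        from bspec[OF this that(2)] show ?thesis by (elim bexE) (intro exI conjI, auto)
      qed
      have hnat: "nat_trans (op_cat A) set_cat L L' h"
      proof (rule presheaf_mapI[OF fL fL'])
        show "h \<in> extensional (Obj A)" by (simp add: h_def)
        fix X assume X: "X \<in> Obj A"
        have "h X x \<in> omap L' X" if "x \<in> omap L X" for x
          using surj[OF X that] h[OF X] presheaf_map_simps(2)[OF cj'(1) X] by auto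
        then show "h X \<in> omap L X \<rightarrow>\<^sub>E omap L' X"
          using X by (auto simp: h_def)
        fix Y f x assume Y: "Y \<in> Obj A" and f: "f \<in> Hom A Y X" and x: "x \<in> omap L X"
        obtain j y where j: "j \<in> Obj J" and y: "y \<in> omap (omap D j) X" and xy: "x = c j X y"
          using surj[OF X x] by blast
        have "h Y (amap L X Y f x) = h Y (c j Y (amap (omap D j) X Y f y))"
          by (simp add: xy presheaf_map_simps(3)[OF cj(1)[OF j] X Y f y])
        also have "\<dots> = c' j Y (amap (omap D j) X Y f y)"
          by (rule h[OF Y j]) (rule presheaf_simps(4)[OF fD[OF j] X Y f y])
        also have "\<dots> = amap L' X Y f (c' j X y)"
          by (rule presheaf_map_simps(3)[OF cj'(1)[OF j] X Y f y])
        finally show "h Y (amap L X Y f x) = amap L' X Y f (h X x)"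
          by (simp add: xy h[OF X j y])
      qed
      show "\<exists>!h. h \<in> Hom (presheaf_cat A) L L' \<and>
          (\<forall>j\<in>Obj J. Comp (presheaf_cat A) (omap D j) L L' h (c j) = c' j)"
      proof (rule ex1I[of _ h])
        have "Comp (presheaf_cat A) (omap D j) L L' h (c j) = c' j" if j: "j \<in> Obj J" for j
        proof (rule extensionalityI[where A = "Obj A"])
          show "c' j \<in> extensional (Obj A)"
            using nat_trans_extensional[OF cj'(1)[OF j]] by simp
          fix X assume X: "X \<in> Obj A"
          have "c' j X \<in> extensional (omap (omap D j) X)"
            using presheaf_map_simps(1)[OF cj'(1)[OF j] X] by (simp add: PiE_iff)
          then have "compose (omap (omap D j) X) (h X) (c j X) = c' j X"
            by (rule extensionalityI[OF compose_extensional]) (simp add: compose_eq h[OF X j])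
          then show "Comp (presheaf_cat A) (omap D j) L L' h (c j) X = c' j X"
            using X by simp
        qed simp
        then show "h \<in> Hom (presheaf_cat A) L L' \<and>
            (\<forall>j\<in>Obj J. Comp (presheaf_cat A) (omap D j) L L' h (c j) = c' j)"
          using hnat by simp
        fix h' assume h': "h' \<in> Hom (presheaf_cat A) L L' \<and>
            (\<forall>j\<in>Obj J. Comp (presheaf_cat A) (omap D j) L L' h' (c j) = c' j)"
        then have n: "nat_trans (op_cat A) set_cat L L' h'" by simp
        show "h' = h"
        proof (rule presheaf_map_eqI[OF n hnat])
          fix X x assume X: "X \<in> Obj A" and x: "x \<in> omap L X"
          obtain j y where j: "j \<in> Obj J" and y: "y \<in> omap (omap D j) X" and xy: "x = c j X y"
            using surj[OF X x] by blast
          have "Comp (presheaf_cat A) (omap D j) L L' h' (c j) X y = c' j X y"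
            using h' j by simp
          then show "h' X x = h X x"
            using X y by (simp add: xy compose_eq h[OF X j y])
        qed
      qed
    qed (use L c in simp_all)
  }
qed


section \<open>Arity-respecting functors and factorisations\<close>

text \<open>
  Every arrow \<open>g : B \<rightarrow> H X\<close> with \<open>B\<close> in \<open>\<B>\<close> factors as \<open>H p \<circ> k\<close> with \<open>p : A \<rightarrow> X\<close> and \<open>A\<close> in
  \<open>\<A>\<close>, and the category of such factorisations is connected: a predicate on the pairs \<open>(p, k)\<close>
  that is invariant under moving an arrow of \<open>\<A>\<close> across, from \<open>p\<close> to \<open>k\<close>, takes the same
  value at any two factorisations of the same arrow.
\<close>

definition connected_factorisations :: "('o, 'm) category \<Rightarrow> 'o set \<Rightarrow> ('p, 'n) category \<Rightarrow> 'p set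
    \<Rightarrow> ('o, 'm, 'p, 'n) ftr \<Rightarrow> bool" where
  "connected_factorisations E \<A> F \<B> H \<longleftrightarrow> (\<forall>X\<in>Obj E. \<forall>B\<in>\<B>.
     (\<forall>g\<in>Hom F B (omap H X). \<exists>A\<in>\<A>. \<exists>p\<in>Hom E A X. \<exists>k\<in>Hom F B (omap H A).
        Comp F B (omap H A) (omap H X) (amap H A X p) k = g) \<and>
     (\<forall>Q :: _ \<Rightarrow> _ \<Rightarrow> bool. (\<forall>A\<in>\<A>. \<forall>A'\<in>\<A>. \<forall>p\<in>Hom E A' X. \<forall>f\<in>Hom E A A'. \<forall>k\<in>Hom F B (omap H A).
             Q (A, Comp E A A' X p f) k = Q (A', p) (Comp F B (omap H A) (omap H A') (amap H A A' f) k))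
        \<longrightarrow> (\<forall>A\<in>\<A>. \<forall>A'\<in>\<A>. \<forall>p\<in>Hom E A X. \<forall>p'\<in>Hom E A' X.
             \<forall>k\<in>Hom F B (omap H A). \<forall>k'\<in>Hom F B (omap H A').
             Comp F B (omap H A) (omap H X) (amap H A X p) k
               = Comp F B (omap H A') (omap H X) (amap H A' X p') k' \<longrightarrow> Q (A, p) k = Q (A', p') k')))"

lemma connected_factorisationsI:
  assumes "\<And>X B g. X \<in> Obj E \<Longrightarrow> B \<in> \<B> \<Longrightarrow> g \<in> Hom F B (omap H X) \<Longrightarrow>
      \<exists>A\<in>\<A>. \<exists>p\<in>Hom E A X. \<exists>k\<in>Hom F B (omap H A).
        Comp F B (omap H A) (omap H X) (amap H A X p) k = g"
    and "\<And>X B (Q :: _ \<Rightarrow> _ \<Rightarrow> bool) A A' p p' k k'. X \<in> Obj E \<Longrightarrow> B \<in> \<B> \<Longrightarrow>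
      (\<And>A A' p f k. A \<in> \<A> \<Longrightarrow> A' \<in> \<A> \<Longrightarrow> p \<in> Hom E A' X \<Longrightarrow> f \<in> Hom E A A' \<Longrightarrow> k \<in> Hom F B (omap H A)
        \<Longrightarrow> Q (A, Comp E A A' X p f) k
              = Q (A', p) (Comp F B (omap H A) (omap H A') (amap H A A' f) k)) \<Longrightarrow>
      A \<in> \<A> \<Longrightarrow> A' \<in> \<A> \<Longrightarrow> p \<in> Hom E A X \<Longrightarrow> p' \<in> Hom E A' X \<Longrightarrow>
      k \<in> Hom F B (omap H A) \<Longrightarrow> k' \<in> Hom F B (omap H A') \<Longrightarrow>
      Comp F B (omap H A) (omap H X) (amap H A X p) k
        = Comp F B (omap H A') (omap H X) (amap H A' X p') k' \<Longrightarrow> Q (A, p) k = Q (A', p') k'"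
  shows "connected_factorisations E \<A> F \<B> H"
  unfolding connected_factorisations_def
proof (intro ballI conjI allI impI, goal_cases)
  case (1 X B g)
  then show ?case by (rule assms(1))
next
  case (2 X B Q A A' p p' k k')
  show ?case
    by (rule assms(2)[of X B Q A A' p p' k k', OF 2(1,2) _ 2(4-10)]) (rule 2(3)[THEN bspec, THEN bspec, THEN bspec, THEN bspec, THEN bspec])
qed

lemma connected_factorisations_exists:
  assumes "connected_factorisations E \<A> F \<B> H" "X \<in> Obj E" "B \<in> \<B>" "g \<in> Hom F B (omap H X)"
  obtains A p k where "A \<in> \<A>" "p \<in> Hom E A X" "k \<in> Hom F B (omap H A)"
    "Comp F B (omap H A) (omap H X) (amap H A X p) k = g"
proof -
  have "\<exists>A\<in>\<A>. \<exists>p\<in>Hom E A X. \<exists>k\<in>Hom F B (omap H A).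
      Comp F B (omap H A) (omap H X) (amap H A X p) k = g"
    by (rule assms(1)[unfolded connected_factorisations_def, THEN bspec, OF assms(2), THEN bspec,
          OF assms(3), THEN conjunct1, THEN bspec, OF assms(4)])
  then show ?thesis using that by blast
qed

lemma connected_factorisations_invariant:
  assumes H: "connected_factorisations E \<A> F \<B> H" and X: "X \<in> Obj E" and B: "B \<in> \<B>"
    and Q: "\<And>A A' p f k. A \<in> \<A> \<Longrightarrow> A' \<in> \<A> \<Longrightarrow> p \<in> Hom E A' X \<Longrightarrow> f \<in> Hom E A A'
      \<Longrightarrow> k \<in> Hom F B (omap H A) \<Longrightarrow> Q (A, Comp E A A' X p f) k
              = Q (A', p) (Comp F B (omap H A) (omap H A') (amap H A A' f) k)"
    and h: "A \<in> \<A>" "A' \<in> \<A>" "p \<in> Hom E A X" "p' \<in> Hom E A' X"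
      "k \<in> Hom F B (omap H A)" "k' \<in> Hom F B (omap H A')"
      "Comp F B (omap H A) (omap H X) (amap H A X p) k
        = Comp F B (omap H A') (omap H X) (amap H A' X p') k'"
  shows "(Q :: _ \<Rightarrow> _ \<Rightarrow> bool) (A, p) k = Q (A', p') k'"
proof -
  note * = H[unfolded connected_factorisations_def, THEN bspec, OF X, THEN bspec, OF B,
      THEN conjunct2, THEN spec[of _ Q], THEN mp]
  show ?thesis
    by (rule *[THEN bspec, THEN bspec, THEN bspec, THEN bspec, THEN bspec, THEN bspec, THEN mp])
      (intro ballI Q | rule h | assumption)+
qed

lemma locally_smallD:
  "locally_small (C :: ('o, 'u::universe) category) \<Longrightarrow> X \<in> Obj C \<Longrightarrow> Y \<in> Obj C \<Longrightarrow> small TYPE('u) (Hom C X Y)"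
  by (simp add: locally_small_def)

lemma nerve_simps:
  assumes "X \<in> Obj E"
  shows "A \<in> \<A> \<Longrightarrow> omap (omap (nerve E \<A>) X) A = Hom E A X"
    and "A \<in> \<A> \<Longrightarrow> B \<in> \<A> \<Longrightarrow> f \<in> Hom E B A \<Longrightarrow> x \<in> Hom E A X
      \<Longrightarrow> amap (omap (nerve E \<A>) X) A B f x = Comp E B A X x f"
    and "Y \<in> Obj E \<Longrightarrow> g \<in> Hom E X Y
      \<Longrightarrow> amap (nerve E \<A>) X Y g = (\<lambda>A\<in>\<A>. \<lambda>x\<in>Hom E A X. Comp E A X Y g x)"
    and "Y \<in> Obj E \<Longrightarrow> g \<in> Hom E X Y \<Longrightarrow> A \<in> \<A> \<Longrightarrow> x \<in> Hom E A X
      \<Longrightarrow> amap (nerve E \<A>) X Y g A x = Comp E A X Y g x"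
  using assms by (simp_all add: nerve_def)

lemma is_functor_nerve_obj:
  fixes E :: "('o, 'u::universe) category"
  assumes E: "category E" "locally_small E" "\<A> \<subseteq> Obj E" and X: "X \<in> Obj E"
  shows "is_functor (op_cat (full_sub E \<A>)) set_cat (omap (nerve E \<A>) X)"
proof -
  note AE = subsetD[OF E(3)]
  have "is_functor (op_cat (full_sub E \<A>)) set_cat (mk_ftr (op_cat (full_sub E \<A>))
      (\<lambda>A. Hom E A X) (\<lambda>A B f. \<lambda>x\<in>Hom E A X. Comp E B A X x f))"
    by (rule presheafI)
      (use X in \<open>auto simp: category_full_sub[OF E(1,3)] locally_smallD[OF E(2)] AE
        category_Id_right[OF E(1)] category_Comp[OF E(1)] category_assoc[OF E(1)]\<close>)
  then show ?thesis using X by (simp add: nerve_def)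
qed

lemma is_functor_nerve:
  fixes E :: "('o, 'u::universe) category"
  assumes E: "category E" "locally_small E" "\<A> \<subseteq> Obj E"
  shows "is_functor E (presheaf_cat (full_sub E \<A>)) (nerve E \<A>)"
proof -
  note AE = subsetD[OF E(3)]
  let ?N = "\<lambda>X. mk_ftr (op_cat (full_sub E \<A>)) (\<lambda>A. Hom E A X) (\<lambda>A B f. \<lambda>x\<in>Hom E A X. Comp E B A X x f)"
  have obj: "is_functor (op_cat (full_sub E \<A>)) set_cat (?N X)" if "X \<in> Obj E" for X
    using is_functor_nerve_obj[OF E that] that by (simp add: nerve_def)
  show ?thesis
    unfolding nerve_def
  proof (rule is_functorI[OF E(1) category_presheaf_cat[OF category_full_sub[OF E(1,3)]]])
    fix X Y f assume h: "X \<in> Obj E" "Y \<in> Obj E" "f \<in> Hom E X Y"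
    have "nat_trans (op_cat (full_sub E \<A>)) set_cat (?N X) (?N Y)
        (\<lambda>A\<in>\<A>. \<lambda>x\<in>Hom E A X. Comp E A X Y f x)"
      by (rule presheaf_mapI[OF obj[OF h(1)] obj[OF h(2)]])
        (use h in \<open>auto simp: AE category_Comp[OF E(1)] category_assoc[OF E(1)]\<close>)
    then show "(\<lambda>A\<in>\<A>. \<lambda>x\<in>Hom E A X. Comp E A X Y f x) \<in> Hom (presheaf_cat (full_sub E \<A>)) (?N X) (?N Y)"
      by simp
  next
    fix X assume h: "X \<in> Obj E"
    show "(\<lambda>A\<in>\<A>. \<lambda>x\<in>Hom E A X. Comp E A X X (Id E X) x) = Id (presheaf_cat (full_sub E \<A>)) (?N X)"
      using h by (auto simp: AE category_Id_left[OF E(1)] intro!: restrict_ext)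
  next
    fix X Y Z f g
    assume h: "X \<in> Obj E" "Y \<in> Obj E" "Z \<in> Obj E" "f \<in> Hom E X Y" "g \<in> Hom E Y Z"
    show "(\<lambda>A\<in>\<A>. \<lambda>x\<in>Hom E A X. Comp E A X Z (Comp E X Y Z g f) x)
        = Comp (presheaf_cat (full_sub E \<A>)) (?N X) (?N Y) (?N Z)
            (\<lambda>A\<in>\<A>. \<lambda>x\<in>Hom E A Y. Comp E A Y Z g x) (\<lambda>A\<in>\<A>. \<lambda>x\<in>Hom E A X. Comp E A X Y f x)"
      using h by (auto simp: compose_def AE category_Comp[OF E(1)] category_assoc[OF E(1)]
          intro!: restrict_ext)
  qed (simp add: obj)
qed

lemma arity_slice_simps:
  "(a \<in> Obj (arity_slice E \<A> X)) = (fst a \<in> \<A> \<and> snd a \<in> Hom E (fst a) X)"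
  "Hom (arity_slice E \<A> X) a b
    = {h \<in> Hom E (fst a) (fst b). Comp E (fst a) (fst b) X (snd b) h = snd a}"
  "Id (arity_slice E \<A> X) a = Id E (fst a)"
  "Comp (arity_slice E \<A> X) a b c = Comp E (fst a) (fst b) (fst c)"
  by (auto simp: arity_slice_def slice_cat_def split: prod.splits)

lemma category_arity_slice:
  assumes E: "category E" "\<A> \<subseteq> Obj E" and X: "X \<in> Obj E"
  shows "category (arity_slice E \<A> X)"
proof -
  note AE = subsetD[OF E(2)]
  show ?thesis
    unfolding category_def arity_slice_simps(2-4)
    using X by (auto simp: arity_slice_simps(1) AE category_rules[OF E(1)])
qed

lemma is_functor_slice_proj:
  assumes "category E" "\<A> \<subseteq> Obj E" "X \<in> Obj E"
  shows "is_functor (arity_slice E \<A> X) E (slice_proj E \<A> X)"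
  unfolding slice_proj_def
  by (rule is_functorI[OF category_arity_slice[OF assms] assms(1)])
    (use assms(2) in \<open>auto simp: arity_slice_simps\<close>)

lemma nat_trans_arity_cocone:
  assumes E: "category E" "\<A> \<subseteq> Obj E" and X: "X \<in> Obj E"
  shows "nat_trans (arity_slice E \<A> X) E (slice_proj E \<A> X)
    (const_ftr (arity_slice E \<A> X) E X) (arity_cocone E \<A> X)"
proof (rule nat_transI[OF is_functor_slice_proj[OF assms]
      is_functor_const_ftr[OF category_arity_slice[OF assms] E(1) X]])
qed (use X E(2) in \<open>auto simp: arity_cocone_def slice_proj_def arity_slice_simps
    category_Id_left[OF E(1)]\<close>)

lemma ball_arity_slice:
  "(\<forall>a\<in>Obj (arity_slice E \<A> X). P a) \<longleftrightarrow> (\<forall>A\<in>\<A>. \<forall>p\<in>Hom E A X. P (A, p))"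
  by (auto simp: arity_slice_simps)

lemma bex_arity_slice:
  "(\<exists>a\<in>Obj (arity_slice E \<A> X). P a) \<longleftrightarrow> (\<exists>A\<in>\<A>. \<exists>p\<in>Hom E A X. P (A, p))"
  by (force simp: arity_slice_simps)

text \<open>
  The elements at \<open>B\<close> of the diagram of nerves indexed by \<open>\<A>/X\<close> are the pairs \<open>p : A \<rightarrow> X\<close>,
  \<open>k : B \<rightarrow> H A\<close>; hence the pointwise criterion for colimits of presheaves is connectedness of
  factorisations.
\<close>

proposition takes_arity_cocones_iff_connected_factorisations:
  fixes F :: "('p, 'u::universe) category"
  assumes E: "category E" "\<A> \<subseteq> Obj E" and F: "category F" "locally_small F" "\<B> \<subseteq> Obj F"
    and H: "is_functor E F H"
  shows "takes_arity_cocones_to_colimits E \<A> (presheaf_cat (full_sub F \<B>)) (comp_ftr E (nerve F \<B>) H)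
    \<longleftrightarrow> connected_factorisations E \<A> F \<B> H"
proof -
  let ?P = "presheaf_cat (full_sub F \<B>)" and ?K = "comp_ftr E (nerve F \<B>) H"
  have sub: "category (full_sub F \<B>)" "locally_small (full_sub F \<B>)"
    using category_full_sub[OF F(1,3)] F(2,3) by (auto simp: locally_small_def)
  have K: "is_functor E ?P ?K"
    by (rule is_functor_comp_ftr[OF H is_functor_nerve[OF F]])
  note AE = subsetD[OF E(2)] and HF = is_functor_rules[OF H]
  have "colimit_cocone (arity_slice E \<A> X) ?P (comp_ftr (arity_slice E \<A> X) ?K (slice_proj E \<A> X))
      (omap ?K X) (post_whisker (arity_slice E \<A> X) ?K (slice_proj E \<A> X)
        (const_ftr (arity_slice E \<A> X) E X) (arity_cocone E \<A> X))
    \<longleftrightarrow> (\<forall>B\<in>\<B>.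
      (\<forall>g\<in>Hom F B (omap H X). \<exists>A\<in>\<A>. \<exists>p\<in>Hom E A X. \<exists>k\<in>Hom F B (omap H A).
        Comp F B (omap H A) (omap H X) (amap H A X p) k = g) \<and>
      (\<forall>Q :: _ \<Rightarrow> _ \<Rightarrow> bool.
        (\<forall>A\<in>\<A>. \<forall>A'\<in>\<A>. \<forall>p\<in>Hom E A' X. \<forall>f\<in>Hom E A A'. \<forall>k\<in>Hom F B (omap H A).
             Q (A, Comp E A A' X p f) k = Q (A', p) (Comp F B (omap H A) (omap H A') (amap H A A' f) k))
        \<longrightarrow> (\<forall>A\<in>\<A>. \<forall>A'\<in>\<A>. \<forall>p\<in>Hom E A X. \<forall>p'\<in>Hom E A' X.
             \<forall>k\<in>Hom F B (omap H A). \<forall>k'\<in>Hom F B (omap H A').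
             Comp F B (omap H A) (omap H X) (amap H A X p) k
               = Comp F B (omap H A') (omap H X) (amap H A' X p') k' \<longrightarrow> Q (A, p) k = Q (A', p') k')))"
    (is "?colim X \<longleftrightarrow> ?fact X")
    if X: "X \<in> Obj E" for X
  proof -
    let ?J = "arity_slice E \<A> X"
    let ?D = "comp_ftr ?J ?K (slice_proj E \<A> X)"
    let ?c = "post_whisker ?J ?K (slice_proj E \<A> X) (const_ftr ?J E X) (arity_cocone E \<A> X)"
    have "nat_trans ?J ?P ?D (comp_ftr ?J ?K (const_ftr ?J E X)) ?c"
      by (rule nat_trans_post_whisker[OF nat_trans_arity_cocone[OF E X] K])
    then have c: "nat_trans ?J ?P ?D (const_ftr ?J ?P (omap ?K X)) ?c"
      by (simp add: comp_ftr_const_ftr[OF K category_arity_slice[OF E X] X])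
    have L: "omap ?K X \<in> Obj ?P" by (rule is_functor_omap[OF K X])
    have LB: "omap (omap ?K X) B = Hom F B (omap H X)" if "B \<in> \<B>" for B
      using X that by (simp add: nerve_simps HF)
    have DB: "omap (omap ?D (A, p)) B = Hom F B (omap H A)"
      if "B \<in> \<B>" "A \<in> \<A>" "p \<in> Hom E A X" for A p B
      using that X AE by (simp add: slice_proj_def arity_slice_simps nerve_simps HF)
    have aD: "amap ?D (A, r) (A', p) f B k = Comp F B (omap H A) (omap H A') (amap H A A' f) k"
      if "B \<in> \<B>" "A \<in> \<A>" "A' \<in> \<A>" "r \<in> Hom E A X" "p \<in> Hom E A' X" "f \<in> Hom ?J (A, r) (A', p)"
        "k \<in> Hom F B (omap H A)" for A A' r p f k B
      using that X AE by (simp add: slice_proj_def arity_slice_simps nerve_simps HF)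
    have cB: "?c (A, p) B k = Comp F B (omap H A) (omap H X) (amap H A X p) k"
      if "B \<in> \<B>" "A \<in> \<A>" "p \<in> Hom E A X" "k \<in> Hom F B (omap H A)" for A p k B
      using that X AE
      by (simp add: post_whisker_def arity_cocone_def slice_proj_def arity_slice_simps nerve_simps HF)
    have inv: "(\<forall>a\<in>Obj ?J. \<forall>b\<in>Obj ?J. \<forall>f\<in>Hom ?J a b. \<forall>k\<in>omap (omap ?D a) B.
            Q a k = Q b (amap ?D a b f B k))
        \<longleftrightarrow> (\<forall>A\<in>\<A>. \<forall>A'\<in>\<A>. \<forall>p\<in>Hom E A' X. \<forall>f\<in>Hom E A A'. \<forall>k\<in>Hom F B (omap H A).
             Q (A, Comp E A A' X p f) k = Q (A', p) (Comp F B (omap H A) (omap H A') (amap H A A' f) k))"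
      (is "?l \<longleftrightarrow> ?r") if B: "B \<in> \<B>" for B and Q :: "_ \<Rightarrow> _ \<Rightarrow> bool"
    proof
      assume l: ?l
      show ?r
      proof (intro ballI)
        fix A A' p f k assume h: "A \<in> \<A>" "A' \<in> \<A>" "p \<in> Hom E A' X" "f \<in> Hom E A A'"
          "k \<in> Hom F B (omap H A)"
        then have r: "Comp E A A' X p f \<in> Hom E A X"
          using X AE by (simp add: category_Comp[OF E(1), where Y = A'])
        have f: "f \<in> Hom ?J (A, Comp E A A' X p f) (A', p)"
          using h by (simp add: arity_slice_simps)
        have k: "k \<in> omap (omap ?D (A, Comp E A A' X p f)) B"
          using h(5) by (simp only: DB[OF B h(1) r])
        have "Q (A, Comp E A A' X p f) k = Q (A', p) (amap ?D (A, Comp E A A' X p f) (A', p) f B k)"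
          by (rule l[THEN bspec, THEN bspec, THEN bspec, OF _ _ f, THEN bspec, OF _ _ k])
            (use h r in \<open>simp_all add: arity_slice_simps(1)\<close>)
        then show "Q (A, Comp E A A' X p f) k
            = Q (A', p) (Comp F B (omap H A) (omap H A') (amap H A A' f) k)"
          by (simp add: aD[OF B h(1,2) r h(3) f h(5)])
      qed
    next
      assume r: ?r
      show ?l
        unfolding ball_arity_slice
      proof (intro ballI)
        fix A p A' p' f k assume h: "A \<in> \<A>" "p \<in> Hom E A X" "A' \<in> \<A>" "p' \<in> Hom E A' X"
          "f \<in> Hom ?J (A, p) (A', p')" and k: "k \<in> omap (omap ?D (A, p)) B"
        have f: "f \<in> Hom E A A'" "p = Comp E A A' X p' f"
          using h(5) by (auto simp: arity_slice_simps)
        have k: "k \<in> Hom F B (omap H A)" using k by (simp add: DB[OF B h(1,2)])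
        show "Q (A, p) k = Q (A', p') (amap ?D (A, p) (A', p') f B k)"
          unfolding aD[OF B h(1,3,2,4,5) k]
          using r[THEN bspec, OF h(1), THEN bspec, OF h(3), THEN bspec, OF h(4), THEN bspec, OF f(1),
              THEN bspec, OF k] by (simp add: f(2))
      qed
    qed
    have surj: "(\<forall>g\<in>omap (omap ?K X) B. \<exists>j\<in>Obj ?J. \<exists>k\<in>omap (omap ?D j) B. ?c j B k = g)
        \<longleftrightarrow> (\<forall>g\<in>Hom F B (omap H X). \<exists>A\<in>\<A>. \<exists>p\<in>Hom E A X. \<exists>k\<in>Hom F B (omap H A).
          Comp F B (omap H A) (omap H X) (amap H A X p) k = g)" if B: "B \<in> \<B>" for B
      unfolding bex_arity_slice by (simp only: LB[OF B] DB[OF B] cB[OF B] cong: ball_cong bex_cong)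
    have conn: "(\<forall>j\<in>Obj ?J. \<forall>j'\<in>Obj ?J. \<forall>k\<in>omap (omap ?D j) B. \<forall>k'\<in>omap (omap ?D j') B.
          ?c j B k = ?c j' B k' \<longrightarrow> Q j k = Q j' k')
        \<longleftrightarrow> (\<forall>A\<in>\<A>. \<forall>A'\<in>\<A>. \<forall>p\<in>Hom E A X. \<forall>p'\<in>Hom E A' X.
          \<forall>k\<in>Hom F B (omap H A). \<forall>k'\<in>Hom F B (omap H A').
             Comp F B (omap H A) (omap H X) (amap H A X p) k
               = Comp F B (omap H A') (omap H X) (amap H A' X p') k' \<longrightarrow> Q (A, p) k = Q (A', p') k')"
      if B: "B \<in> \<B>" for B and Q :: "_ \<Rightarrow> _ \<Rightarrow> bool"
      unfolding ball_arity_slice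
      by (simp only: DB[OF B] cB[OF B] cong: ball_cong) blast
    have "?colim X \<longleftrightarrow> (\<forall>B\<in>Obj (full_sub F \<B>).
       (\<forall>x\<in>omap (omap ?K X) B. \<exists>j\<in>Obj ?J. \<exists>y\<in>omap (omap ?D j) B. ?c j B y = x) \<and>
       (\<forall>Q :: _ \<Rightarrow> _ \<Rightarrow> bool. (\<forall>j\<in>Obj ?J. \<forall>k\<in>Obj ?J. \<forall>f\<in>Hom ?J j k. \<forall>y\<in>omap (omap ?D j) B.
               Q j y = Q k (amap ?D j k f B y)) \<longrightarrow>
            (\<forall>j\<in>Obj ?J. \<forall>k\<in>Obj ?J. \<forall>y\<in>omap (omap ?D j) B. \<forall>z\<in>omap (omap ?D k) B.
               ?c j B y = ?c k B z \<longrightarrow> Q j y = Q k z)))"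
      by (rule presheaf_colimit_iff[OF sub L c])
    also have "\<dots> \<longleftrightarrow> ?fact X"
      unfolding full_sub_simps
      by (intro surj inv conn ball_cong conj_cong all_cong1 imp_cong refl) assumption+
    finally show ?thesis .
  qed
  then show ?thesis
    by (simp add: takes_arity_cocones_to_colimits_def connected_factorisations_def Let_def
        cong: ball_cong)
qed

lemma arity_respecting_iff:
  fixes F :: "('p, 'u::universe) category"
  assumes "category E" "\<A> \<subseteq> Obj E" "category F" "locally_small F" "\<B> \<subseteq> Obj F"
  shows "arity_respecting E \<A> F \<B> H
    \<longleftrightarrow> is_functor E F H \<and> connected_factorisations E \<A> F \<B> H"
  using takes_arity_cocones_iff_connected_factorisations[OF assms]
  by (auto simp: arity_respecting_def)

lemma connected_factorisations_comp_ftr: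
  assumes G: "is_functor D E G" and H: "is_functor E F H"
    and D: "\<D> \<subseteq> Obj D" and A: "\<A> \<subseteq> Obj E" and B: "\<B> \<subseteq> Obj F"
    and cG: "connected_factorisations D \<D> E \<A> G" and cH: "connected_factorisations E \<A> F \<B> H"
  shows "connected_factorisations D \<D> F \<B> (comp_ftr D H G)"
proof (rule connected_factorisationsI)
  note cat = is_functor_category(2)[OF G] is_functor_category(2)[OF H]
  note sub = subsetD[OF D] subsetD[OF A] subsetD[OF B]
  note r = is_functor_rules[OF G] is_functor_rules[OF H]
  fix X B g assume X: "X \<in> Obj D" and B: "B \<in> \<B>" and g: "g \<in> Hom F B (omap (comp_ftr D H G) X)"
  obtain A q l where A: "A \<in> \<A>" and q: "q \<in> Hom E A (omap G X)" and l: "l \<in> Hom F B (omap H A)"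
    and g: "Comp F B (omap H A) (omap H (omap G X)) (amap H A (omap G X) q) l = g"
    by (rule connected_factorisations_exists[OF cH is_functor_omap[OF G X] B]) (use g X in auto)
  obtain Y p k where Y: "Y \<in> \<D>" and p: "p \<in> Hom D Y X" and k: "k \<in> Hom E A (omap G Y)"
    and q': "Comp E A (omap G Y) (omap G X) (amap G Y X p) k = q"
    by (rule connected_factorisations_exists[OF cG X A q])
  have "Comp F B (omap H (omap G Y)) (omap H (omap G X)) (amap H (omap G Y) (omap G X) (amap G Y X p))
      (Comp F B (omap H A) (omap H (omap G Y)) (amap H A (omap G Y) k) l) = g"
    unfolding g[symmetric] q'[symmetric]
    using A B X Y p k l by (simp add: category_assoc[OF cat(2)] r sub)
  then show "\<exists>A\<in>\<D>. \<exists>p\<in>Hom D A X. \<exists>k\<in>Hom F B (omap (comp_ftr D H G) A).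
      Comp F B (omap (comp_ftr D H G) A) (omap (comp_ftr D H G) X) (amap (comp_ftr D H G) A X p) k = g"
    by (intro bexI[of _ Y] bexI[of _ p]
        bexI[of _ "Comp F B (omap H A) (omap H (omap G Y)) (amap H A (omap G Y) k) l"])
      (use A B X Y p k l in \<open>simp_all add: r sub category_Comp[OF cat(2)]\<close>)
next
  note cat = is_functor_category(2)[OF G] is_functor_category(2)[OF H]
  note sub = subsetD[OF D] subsetD[OF A] subsetD[OF B]
  note r = is_functor_rules[OF G] is_functor_rules[OF H]
  fix X B Y Y' p p' k k' and Q :: "_ \<Rightarrow> _ \<Rightarrow> bool"
  let ?HG = "comp_ftr D H G"
  assume X: "X \<in> Obj D" and B: "B \<in> \<B>"
    and Q: "\<And>Y Y' p f k. Y \<in> \<D> \<Longrightarrow> Y' \<in> \<D> \<Longrightarrow> p \<in> Hom D Y' X \<Longrightarrow> f \<in> Hom D Y Y'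
      \<Longrightarrow> k \<in> Hom F B (omap ?HG Y) \<Longrightarrow> Q (Y, Comp D Y Y' X p f) k
            = Q (Y', p) (Comp F B (omap ?HG Y) (omap ?HG Y') (amap ?HG Y Y' f) k)"
    and Y: "Y \<in> \<D>" and Y': "Y' \<in> \<D>" and p: "p \<in> Hom D Y X" and p': "p' \<in> Hom D Y' X"
    and k: "k \<in> Hom F B (omap ?HG Y)" and k': "k' \<in> Hom F B (omap ?HG Y')"
    and eq: "Comp F B (omap ?HG Y) (omap ?HG X) (amap ?HG Y X p) k
      = Comp F B (omap ?HG Y') (omap ?HG X) (amap ?HG Y' X p') k'"
  have GX: "omap G X \<in> Obj E" by (rule is_functor_omap[OF G X])
  \<comment> \<open>The predicate induced by \<open>Q\<close> on the factorisations \<open>(q, l)\<close> through \<open>H\<close>: \<open>Q\<close> holds for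
    every factorisation of \<open>q : A \<rightarrow> G X\<close> through \<open>G\<close>, composed with \<open>l\<close>. As the factorisations of
    \<open>q\<close> are connected, it is enough to look at one of them; that is the next fact.\<close>
  define Q' where "Q' = (\<lambda>(A, q) l. \<forall>Z r m. Z \<in> \<D> \<longrightarrow> r \<in> Hom D Z X \<longrightarrow> m \<in> Hom E A (omap G Z)
    \<longrightarrow> Comp E A (omap G Z) (omap G X) (amap G Z X r) m = q
    \<longrightarrow> Q (Z, r) (Comp F B (omap H A) (omap H (omap G Z)) (amap H A (omap G Z) m) l))"
  have Q': "Q' (A, Comp E A (omap G Z) (omap G X) (amap G Z X s) m) l
      = Q (Z, s) (Comp F B (omap H A) (omap H (omap G Z)) (amap H A (omap G Z) m) l)"
    if h: "A \<in> \<A>" "Z \<in> \<D>" "s \<in> Hom D Z X" "m \<in> Hom E A (omap G Z)" "l \<in> Hom F B (omap H A)"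
    for A Z s m l
  proof -
    have *: "Q (Z', s') (Comp F B (omap H A) (omap H (omap G Z')) (amap H A (omap G Z') m') l)
        = Q (Z, s) (Comp F B (omap H A) (omap H (omap G Z)) (amap H A (omap G Z) m) l)"
      if h': "Z' \<in> \<D>" "s' \<in> Hom D Z' X" "m' \<in> Hom E A (omap G Z')"
        "Comp E A (omap G Z') (omap G X) (amap G Z' X s') m'
          = Comp E A (omap G Z) (omap G X) (amap G Z X s) m" for Z' s' m'
    proof -
      let ?Q = "\<lambda>(Z, s) m. Q (Z, s) (Comp F B (omap H A) (omap H (omap G Z)) (amap H A (omap G Z) m) l)"
      have "?Q (Z', s') m' = ?Q (Z, s) m"
      proof (rule connected_factorisations_invariant[OF cG X h(1), where Q = ?Q])
        fix Z Z' s f m assume "Z \<in> \<D>" "Z' \<in> \<D>" "s \<in> Hom D Z' X" "f \<in> Hom D Z Z'"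
          "m \<in> Hom E A (omap G Z)"
        then show "?Q (Z, Comp D Z Z' X s f) m
            = ?Q (Z', s) (Comp E A (omap G Z) (omap G Z') (amap G Z Z' f) m)"
          using X B h(1,5) by (simp add: Q r sub category_Comp[OF cat(2)] category_assoc[OF cat(2)])
      qed (use h h' in simp_all)
      then show ?thesis by simp
    qed
    then show ?thesis
      using h unfolding Q'_def prod.case by blast
  qed
  have inv: "Q' (A, Comp E A A' (omap G X) q f) l
      = Q' (A', q) (Comp F B (omap H A) (omap H A') (amap H A A' f) l)"
    if h: "A \<in> \<A>" "A' \<in> \<A>" "q \<in> Hom E A' (omap G X)" "f \<in> Hom E A A'" "l \<in> Hom F B (omap H A)"
    for A A' q f l
  proof -
    obtain Z s m where Z: "Z \<in> \<D>" and s: "s \<in> Hom D Z X" and m: "m \<in> Hom E A' (omap G Z)"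
      and q: "Comp E A' (omap G Z) (omap G X) (amap G Z X s) m = q"
      by (rule connected_factorisations_exists[OF cG X h(2,3)])
    have mf: "Comp E A A' (omap G Z) m f \<in> Hom E A (omap G Z)"
      using h Z m by (simp add: r sub category_Comp[OF cat(1), where Y = A'])
    have "Comp E A A' (omap G X) q f
        = Comp E A (omap G Z) (omap G X) (amap G Z X s) (Comp E A A' (omap G Z) m f)"
      unfolding q[symmetric] using h X Z s m by (simp add: r sub category_assoc[OF cat(1)])
    then have "Q' (A, Comp E A A' (omap G X) q f) l
        = Q (Z, s) (Comp F B (omap H A) (omap H (omap G Z))
            (amap H A (omap G Z) (Comp E A A' (omap G Z) m f)) l)"
      using Q'[OF h(1) Z s mf h(5)] by simp
    also have "\<dots> = Q (Z, s) (Comp F B (omap H A') (omap H (omap G Z)) (amap H A' (omap G Z) m)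
        (Comp F B (omap H A) (omap H A') (amap H A A' f) l))"
      using h B Z s m by (simp add: r sub category_assoc[OF cat(2)])
    also have "\<dots> = Q' (A', q) (Comp F B (omap H A) (omap H A') (amap H A A' f) l)"
      unfolding q[symmetric]
      by (rule Q'[OF h(2) Z s m, symmetric]) (use h B in \<open>simp add: r sub category_Comp[OF cat(2)]\<close>)
    finally show ?thesis .
  qed
  obtain A q l where A: "A \<in> \<A>" and q: "q \<in> Hom E A (omap G Y)" and l: "l \<in> Hom F B (omap H A)"
    and kl: "Comp F B (omap H A) (omap H (omap G Y)) (amap H A (omap G Y) q) l = k"
    by (rule connected_factorisations_exists[OF cH is_functor_omap[OF G sub(1)[OF Y]] B])
      (use k Y sub in auto)
  obtain A' q' l' where A': "A' \<in> \<A>" and q': "q' \<in> Hom E A' (omap G Y')"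
    and l': "l' \<in> Hom F B (omap H A')"
    and kl': "Comp F B (omap H A') (omap H (omap G Y')) (amap H A' (omap G Y') q') l' = k'"
    by (rule connected_factorisations_exists[OF cH is_functor_omap[OF G sub(1)[OF Y']] B])
      (use k' Y' sub in auto)
  have "Q (Y, p) k = Q' (A, Comp E A (omap G Y) (omap G X) (amap G Y X p) q) l"
    using Q'[OF A Y p q l] kl by simp
  also have "\<dots> = Q' (A', Comp E A' (omap G Y') (omap G X) (amap G Y' X p') q') l'"
  proof (rule connected_factorisations_invariant[OF cH GX B, where Q = Q'])
    show "Comp F B (omap H A) (omap H (omap G X))
          (amap H A (omap G X) (Comp E A (omap G Y) (omap G X) (amap G Y X p) q)) l
        = Comp F B (omap H A') (omap H (omap G X))
          (amap H A' (omap G X) (Comp E A' (omap G Y') (omap G X) (amap G Y' X p') q')) l'"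
      using eq[folded kl kl'] A A' B X Y Y' p p' q q' l l'
      by (simp add: r sub category_assoc[OF cat(2)])
  qed (use inv A A' X Y Y' p p' q q' l l' in \<open>simp_all add: r sub category_Comp[OF cat(1)]\<close>)
  also have "\<dots> = Q (Y', p') k'"
    using Q'[OF A' Y' p' q' l'] kl' by simp
  finally show "Q (Y, p) k = Q (Y', p') k'" .
qed


section \<open>Dense generators\<close>

text \<open>
  Density says that a compatible family of maps \<open>Hom A X \<rightarrow> Hom A Y\<close> with \<open>A\<close> in \<open>\<A>\<close> is given by
  composition with a unique arrow \<open>X \<rightarrow> Y\<close>.
\<close>

lemma dense_generator_iff:
  fixes E :: "('o, 'u::universe) category"
  assumes E: "category E" "locally_small E" "\<A> \<subseteq> Obj E" "small TYPE('u) \<A>"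
  shows "dense_generator E \<A> \<longleftrightarrow> (\<forall>X\<in>Obj E. \<forall>Y\<in>Obj E. \<forall>\<phi>.
    (\<forall>A\<in>\<A>. \<forall>x\<in>Hom E A X. \<phi> A x \<in> Hom E A Y) \<longrightarrow>
    (\<forall>A\<in>\<A>. \<forall>B\<in>\<A>. \<forall>f\<in>Hom E B A. \<forall>x\<in>Hom E A X.
       \<phi> B (Comp E B A X x f) = Comp E B A Y (\<phi> A x) f) \<longrightarrow>
    (\<exists>!g. g \<in> Hom E X Y \<and> (\<forall>A\<in>\<A>. \<forall>x\<in>Hom E A X. Comp E A X Y g x = \<phi> A x)))"
    (is "_ \<longleftrightarrow> ?ext")
proof
  let ?P = "presheaf_cat (full_sub E \<A>)" and ?N = "nerve E \<A>"
  note N = is_functor_nerve[OF E(1-3)]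
  note fN = is_functor_nerve_obj[OF E(1-3)]
  note AE = subsetD[OF E(3)]
  {
    assume dense: "dense_generator E \<A>"
    show ?ext
    proof (intro ballI allI impI)
      fix X Y \<phi> assume X: "X \<in> Obj E" and Y: "Y \<in> Obj E"
        and \<phi>: "\<forall>A\<in>\<A>. \<forall>x\<in>Hom E A X. \<phi> A x \<in> Hom E A Y"
        and nat: "\<forall>A\<in>\<A>. \<forall>B\<in>\<A>. \<forall>f\<in>Hom E B A. \<forall>x\<in>Hom E A X.
          \<phi> B (Comp E B A X x f) = Comp E B A Y (\<phi> A x) f"
      let ?\<phi> = "\<lambda>A\<in>\<A>. \<lambda>x\<in>Hom E A X. \<phi> A x"
      have "nat_trans (op_cat (full_sub E \<A>)) set_cat (omap ?N X) (omap ?N Y) ?\<phi>"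
        by (rule presheaf_mapI[OF fN[OF X] fN[OF Y]])
          (use X Y \<phi> nat in \<open>auto simp: nerve_simps AE category_Comp[OF E(1)]\<close>)
      then have "?\<phi> \<in> Hom ?P (omap ?N X) (omap ?N Y)" by simp
      moreover have bij: "bij_betw (amap ?N X Y) (Hom E X Y) (Hom ?P (omap ?N X) (omap ?N Y))"
        using dense X Y unfolding dense_generator_def fully_faithful_def by blast
      ultimately obtain g where g: "g \<in> Hom E X Y" "amap ?N X Y g = ?\<phi>"
        by (metis (no_types, lifting) bij_betw_imp_surj_on imageE)
      show "\<exists>!g. g \<in> Hom E X Y \<and> (\<forall>A\<in>\<A>. \<forall>x\<in>Hom E A X. Comp E A X Y g x = \<phi> A x)"
      proof (rule ex1I[of _ g])
        show "g \<in> Hom E X Y \<and> (\<forall>A\<in>\<A>. \<forall>x\<in>Hom E A X. Comp E A X Y g x = \<phi> A x)"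
        proof (intro conjI ballI g(1))
          fix A x assume h: "A \<in> \<A>" "x \<in> Hom E A X"
          show "Comp E A X Y g x = \<phi> A x"
            using fun_cong[OF fun_cong[OF g(2), of A], of x] h
            by (simp add: nerve_simps[OF X] g(1) Y)
        qed
        fix g' assume g': "g' \<in> Hom E X Y \<and> (\<forall>A\<in>\<A>. \<forall>x\<in>Hom E A X. Comp E A X Y g' x = \<phi> A x)"
        then have "amap ?N X Y g' = ?\<phi>"
          using X Y by (auto simp: nerve_simps(3) intro!: restrict_ext)
        then show "g' = g"
          using g g' bij by (auto simp: bij_betw_def inj_on_def)
      qed
    qed
  next
    assume ext: ?ext
    have "bij_betw (amap ?N X Y) (Hom E X Y) (Hom ?P (omap ?N X) (omap ?N Y))"
      if X: "X \<in> Obj E" and Y: "Y \<in> Obj E" for X Y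
    proof -
      have uniq: "\<exists>!g. g \<in> Hom E X Y \<and> amap ?N X Y g = \<alpha>"
        if "\<alpha> \<in> Hom ?P (omap ?N X) (omap ?N Y)" for \<alpha>
      proof -
        have \<alpha>: "nat_trans (op_cat (full_sub E \<A>)) set_cat (omap ?N X) (omap ?N Y) \<alpha>"
          using that by simp
        note a = presheaf_map_simps[OF \<alpha>]
        have eq: "amap ?N X Y g = \<alpha> \<longleftrightarrow> (\<forall>A\<in>\<A>. \<forall>x\<in>Hom E A X. Comp E A X Y g x = \<alpha> A x)"
          if g: "g \<in> Hom E X Y" for g
        proof
          assume *: "amap ?N X Y g = \<alpha>"
          show "\<forall>A\<in>\<A>. \<forall>x\<in>Hom E A X. Comp E A X Y g x = \<alpha> A x"
            unfolding *[symmetric] using X Y g by (simp add: nerve_simps)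
        next
          assume *: "\<forall>A\<in>\<A>. \<forall>x\<in>Hom E A X. Comp E A X Y g x = \<alpha> A x"
          have "nat_trans (op_cat (full_sub E \<A>)) set_cat (omap ?N X) (omap ?N Y) (amap ?N X Y g)"
            using is_functor_amap[OF N X Y g] by simp
          then show "amap ?N X Y g = \<alpha>"
            by (rule presheaf_map_eqI[OF _ \<alpha>]) (use * X Y g in \<open>auto simp: nerve_simps\<close>)
        qed
        have "\<exists>!g. g \<in> Hom E X Y \<and> (\<forall>A\<in>\<A>. \<forall>x\<in>Hom E A X. Comp E A X Y g x = \<alpha> A x)"
        proof (rule ext[THEN bspec, OF X, THEN bspec, OF Y, THEN spec[of _ \<alpha>], THEN mp, THEN mp])
          show "\<forall>A\<in>\<A>. \<forall>x\<in>Hom E A X. \<alpha> A x \<in> Hom E A Y"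
            using a(2) X Y by (simp add: nerve_simps)
          show "\<forall>A\<in>\<A>. \<forall>B\<in>\<A>. \<forall>f\<in>Hom E B A. \<forall>x\<in>Hom E A X.
              \<alpha> B (Comp E B A X x f) = Comp E B A Y (\<alpha> A x) f"
          proof (intro ballI)
            fix A B f x assume h: "A \<in> \<A>" "B \<in> \<A>" "f \<in> Hom E B A" "x \<in> Hom E A X"
            have "\<alpha> A x \<in> Hom E A Y"
              using a(2)[of A x] h X Y by (simp add: nerve_simps)
            then show "\<alpha> B (Comp E B A X x f) = Comp E B A Y (\<alpha> A x) f"
              using a(3)[of A B f x] h X Y by (simp add: nerve_simps)
          qed
        qed
        then show ?thesis using eq by (metis (no_types, lifting))
      qed
      show ?thesis
        unfolding bij_betw_def
      proof
        show "inj_on (amap ?N X Y) (Hom E X Y)"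
          using uniq is_functor_amap[OF N X Y] by (intro inj_onI) blast
        show "amap ?N X Y ` Hom E X Y = Hom ?P (omap ?N X) (omap ?N Y)"
          using uniq is_functor_amap[OF N X Y] by blast
      qed
    qed
    then show "dense_generator E \<A>"
      using E N by (auto simp: dense_generator_def fully_faithful_def)
  }
qed


section \<open>Algebras of a monad\<close>

lemma EM_cat_simps:
  "x \<in> Obj (EM_cat C T) \<longleftrightarrow> fst x \<in> Obj C \<and> snd x \<in> Hom C (omap (mfun T) (fst x)) (fst x) \<and>
     Comp C (fst x) (omap (mfun T) (fst x)) (fst x) (snd x) (munit T (fst x)) = Id C (fst x) \<and>
     Comp C (omap (mfun T) (omap (mfun T) (fst x))) (omap (mfun T) (fst x)) (fst x) (snd x) (mmult T (fst x))
       = Comp C (omap (mfun T) (omap (mfun T) (fst x))) (omap (mfun T) (fst x)) (fst x) (snd x)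
           (amap (mfun T) (omap (mfun T) (fst x)) (fst x) (snd x))"
  "f \<in> Hom (EM_cat C T) x y \<longleftrightarrow> f \<in> Hom C (fst x) (fst y) \<and>
     Comp C (omap (mfun T) (fst x)) (fst x) (fst y) f (snd x)
       = Comp C (omap (mfun T) (fst x)) (omap (mfun T) (fst y)) (fst y) (snd y)
           (amap (mfun T) (fst x) (fst y) f)"
  "Id (EM_cat C T) x = Id C (fst x)"
  "Comp (EM_cat C T) x y z = Comp C (fst x) (fst y) (fst z)"
  by (auto simp: EM_cat_def Let_def split: prod.splits)

text \<open>
  The unit and the multiplication need not satisfy the monad laws here. So the lemma also applies to
  the monad on a hom-category given by composition with a monad, for which only functoriality
  will be checked.
\<close>

lemma category_EM_cat:
  assumes T: "is_functor C C (mfun T)"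
  shows "category (EM_cat C T)"
proof -
  note C = is_functor_category(1)[OF T]
  note r = is_functor_rules[OF T] category_Id[OF C] category_Id_left[OF C] category_Id_right[OF C]
  have comp: "Comp C (fst x) (fst y) (fst z) g f \<in> Hom (EM_cat C T) x z"
    if x: "x \<in> Obj (EM_cat C T)" and y: "y \<in> Obj (EM_cat C T)" and z: "z \<in> Obj (EM_cat C T)"
      and f: "f \<in> Hom (EM_cat C T) x y" and g: "g \<in> Hom (EM_cat C T) y z" for x y z f g
  proof -
    let ?T = "omap (mfun T)" and ?X = "fst x" and ?Y = "fst y" and ?Z = "fst z"
    note h = x[unfolded EM_cat_simps] y[unfolded EM_cat_simps] z[unfolded EM_cat_simps]
      f[unfolded EM_cat_simps] g[unfolded EM_cat_simps]
    have "Comp C (?T ?X) ?X ?Z (Comp C ?X ?Y ?Z g f) (snd x)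
        = Comp C (?T ?X) ?Y ?Z g (Comp C (?T ?X) ?X ?Y f (snd x))"
      by (rule category_assoc[OF C, symmetric]) (use h in \<open>simp_all add: r\<close>)
    also have "\<dots> = Comp C (?T ?X) ?Y ?Z g (Comp C (?T ?X) (?T ?Y) ?Y (snd y) (amap (mfun T) ?X ?Y f))"
      using h by simp
    also have "\<dots> = Comp C (?T ?X) (?T ?Y) ?Z (Comp C (?T ?Y) ?Y ?Z g (snd y)) (amap (mfun T) ?X ?Y f)"
      by (rule category_assoc[OF C]) (use h in \<open>simp_all add: r\<close>)
    also have "\<dots> = Comp C (?T ?X) (?T ?Y) ?Z (Comp C (?T ?Y) (?T ?Z) ?Z (snd z) (amap (mfun T) ?Y ?Z g))
        (amap (mfun T) ?X ?Y f)"
      using h by simp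
    also have "\<dots> = Comp C (?T ?X) (?T ?Z) ?Z (snd z)
        (Comp C (?T ?X) (?T ?Y) (?T ?Z) (amap (mfun T) ?Y ?Z g) (amap (mfun T) ?X ?Y f))"
      by (rule category_assoc[OF C, symmetric]) (use h in \<open>simp_all add: r\<close>)
    also have "\<dots> = Comp C (?T ?X) (?T ?Z) ?Z (snd z) (amap (mfun T) ?X ?Z (Comp C ?X ?Y ?Z g f))"
      using h by (simp add: r)
    finally show ?thesis
      using h by (simp add: EM_cat_simps category_Comp[OF C, where Y = ?Y])
  qed
  have id: "Id C (fst x) \<in> Hom (EM_cat C T) x x" if "x \<in> Obj (EM_cat C T)" for x
    using that by (simp add: EM_cat_simps r)
  show ?thesis
    unfolding category_def EM_cat_simps(3,4)
    using comp id by (auto simp: EM_cat_simps(1,2) r category_assoc[OF C])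
qed

lemma is_functor_forgetful:
  assumes "is_functor C C (mfun T)"
  shows "is_functor (EM_cat C T) C (forgetful C T)"
  unfolding forgetful_def
  by (rule is_functorI[OF category_EM_cat[OF assms] is_functor_category(1)[OF assms]])
    (simp_all add: EM_cat_simps)

lemma forgetful_simps [simp]:
  "x \<in> Obj (EM_cat C T) \<Longrightarrow> omap (forgetful C T) x = fst x"
  "x \<in> Obj (EM_cat C T) \<Longrightarrow> y \<in> Obj (EM_cat C T) \<Longrightarrow> f \<in> Hom (EM_cat C T) x y
    \<Longrightarrow> amap (forgetful C T) x y f = f"
  by (simp_all add: forgetful_def)

text \<open>The free algebra on an object.\<close>

definition free_alg :: "('o, 'm) monad \<Rightarrow> 'o \<Rightarrow> 'o \<times> 'm" where
  "free_alg T A = (omap (mfun T) A, mmult T A)"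

text \<open>The algebra map \<open>T A \<rightarrow> X\<close> corresponding to \<open>g : A \<rightarrow> X\<close>, for an algebra \<open>x\<close> on \<open>X\<close>.\<close>

definition extend :: "('o, 'm) category \<Rightarrow> ('o, 'm) monad \<Rightarrow> 'o \<Rightarrow> 'o \<times> 'm \<Rightarrow> 'm \<Rightarrow> 'm" where
  "extend C T A x g = Comp C (omap (mfun T) A) (omap (mfun T) (fst x)) (fst x) (snd x)
     (amap (mfun T) A (fst x) g)"

lemma fst_free_alg [simp]: "fst (free_alg T A) = omap (mfun T) A"
  by (simp add: free_alg_def)

lemma Theta_eq: "Theta T \<A> = free_alg T ` \<A>"
  by (simp add: Theta_def free_alg_def)

locale monad_on =
  fixes C :: "('o, 'm) category" and T :: "('o, 'm) monad"
  assumes monad: "monad C T"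
begin

abbreviation "T\<^sub>o \<equiv> omap (mfun T)"
abbreviation "T\<^sub>a \<equiv> amap (mfun T)"
abbreviation "\<eta> \<equiv> munit T"
abbreviation "\<mu> \<equiv> mmult T"

lemma functor_T: "is_functor C C (mfun T)"
  and nat_trans_unit: "nat_trans C C (id_ftr C) (mfun T) \<eta>"
  and nat_trans_mult: "nat_trans C C (comp_ftr C (mfun T) (mfun T)) (mfun T) \<mu>"
  using monad by (simp_all add: monad_def)

lemmas C = is_functor_category(1)[OF functor_T]

lemma T_rules:
  "X \<in> Obj C \<Longrightarrow> T\<^sub>o X \<in> Obj C"
  "X \<in> Obj C \<Longrightarrow> Y \<in> Obj C \<Longrightarrow> f \<in> Hom C X Y \<Longrightarrow> T\<^sub>a X Y f \<in> Hom C (T\<^sub>o X) (T\<^sub>o Y)"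
  "X \<in> Obj C \<Longrightarrow> \<eta> X \<in> Hom C X (T\<^sub>o X)"
  "X \<in> Obj C \<Longrightarrow> \<mu> X \<in> Hom C (T\<^sub>o (T\<^sub>o X)) (T\<^sub>o X)"
  using is_functor_rules(1,2)[OF functor_T] nat_trans_comp_in_Hom[OF nat_trans_unit]
    nat_trans_comp_in_Hom[OF nat_trans_mult] by auto

lemma unit_naturality:
  "X \<in> Obj C \<Longrightarrow> Y \<in> Obj C \<Longrightarrow> f \<in> Hom C X Y \<Longrightarrow>
    Comp C X Y (T\<^sub>o Y) (\<eta> Y) f = Comp C X (T\<^sub>o X) (T\<^sub>o Y) (T\<^sub>a X Y f) (\<eta> X)"
  using nat_trans_naturality[OF nat_trans_unit, of X Y f] by simp

lemma mult_naturality: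
  "X \<in> Obj C \<Longrightarrow> Y \<in> Obj C \<Longrightarrow> f \<in> Hom C X Y \<Longrightarrow>
    Comp C (T\<^sub>o (T\<^sub>o X)) (T\<^sub>o (T\<^sub>o Y)) (T\<^sub>o Y) (\<mu> Y) (T\<^sub>a (T\<^sub>o X) (T\<^sub>o Y) (T\<^sub>a X Y f))
      = Comp C (T\<^sub>o (T\<^sub>o X)) (T\<^sub>o X) (T\<^sub>o Y) (T\<^sub>a X Y f) (\<mu> X)"
  using nat_trans_naturality[OF nat_trans_mult, of X Y f] by simp

lemma monad_laws:
  assumes "X \<in> Obj C"
  shows "Comp C (T\<^sub>o X) (T\<^sub>o (T\<^sub>o X)) (T\<^sub>o X) (\<mu> X) (\<eta> (T\<^sub>o X)) = Id C (T\<^sub>o X)"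
    and "Comp C (T\<^sub>o X) (T\<^sub>o (T\<^sub>o X)) (T\<^sub>o X) (\<mu> X) (T\<^sub>a X (T\<^sub>o X) (\<eta> X)) = Id C (T\<^sub>o X)"
    and "Comp C (T\<^sub>o (T\<^sub>o (T\<^sub>o X))) (T\<^sub>o (T\<^sub>o X)) (T\<^sub>o X) (\<mu> X) (\<mu> (T\<^sub>o X))
      = Comp C (T\<^sub>o (T\<^sub>o (T\<^sub>o X))) (T\<^sub>o (T\<^sub>o X)) (T\<^sub>o X) (\<mu> X) (T\<^sub>a (T\<^sub>o (T\<^sub>o X)) (T\<^sub>o X) (\<mu> X))"
  using monad assms by (auto simp: monad_def Let_def)

lemmas category_EM = category_EM_cat[OF functor_T]
lemmas functor_U = is_functor_forgetful[OF functor_T]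

lemma free_alg_EM: "A \<in> Obj C \<Longrightarrow> free_alg T A \<in> Obj (EM_cat C T)"
  by (simp add: EM_cat_simps free_alg_def T_rules monad_laws)

lemma extend_Hom:
  assumes A: "A \<in> Obj C" and x: "x \<in> Obj (EM_cat C T)" and g: "g \<in> Hom C A (fst x)"
  shows "extend C T A x g \<in> Hom (EM_cat C T) (free_alg T A) x"
proof -
  let ?X = "fst x"
  note h = x[unfolded EM_cat_simps]
  note r = T_rules is_functor_Comp[OF functor_T]
  have "Comp C (T\<^sub>o (T\<^sub>o A)) (T\<^sub>o A) ?X (Comp C (T\<^sub>o A) (T\<^sub>o ?X) ?X (snd x) (T\<^sub>a A ?X g)) (\<mu> A)
      = Comp C (T\<^sub>o (T\<^sub>o A)) (T\<^sub>o ?X) ?X (snd x) (Comp C (T\<^sub>o (T\<^sub>o A)) (T\<^sub>o A) (T\<^sub>o ?X) (T\<^sub>a A ?X g) (\<mu> A))"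
    by (rule category_assoc[OF C, symmetric]) (use A h g in \<open>simp_all add: r\<close>)
  also have "\<dots> = Comp C (T\<^sub>o (T\<^sub>o A)) (T\<^sub>o ?X) ?X (snd x)
      (Comp C (T\<^sub>o (T\<^sub>o A)) (T\<^sub>o (T\<^sub>o ?X)) (T\<^sub>o ?X) (\<mu> ?X) (T\<^sub>a (T\<^sub>o A) (T\<^sub>o ?X) (T\<^sub>a A ?X g)))"
    using A h g by (simp add: mult_naturality)
  also have "\<dots> = Comp C (T\<^sub>o (T\<^sub>o A)) (T\<^sub>o (T\<^sub>o ?X)) ?X (Comp C (T\<^sub>o (T\<^sub>o ?X)) (T\<^sub>o ?X) ?X (snd x) (\<mu> ?X))
      (T\<^sub>a (T\<^sub>o A) (T\<^sub>o ?X) (T\<^sub>a A ?X g))"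
    by (rule category_assoc[OF C]) (use A h g in \<open>simp_all add: r\<close>)
  also have "\<dots> = Comp C (T\<^sub>o (T\<^sub>o A)) (T\<^sub>o (T\<^sub>o ?X)) ?X
      (Comp C (T\<^sub>o (T\<^sub>o ?X)) (T\<^sub>o ?X) ?X (snd x) (T\<^sub>a (T\<^sub>o ?X) ?X (snd x)))
      (T\<^sub>a (T\<^sub>o A) (T\<^sub>o ?X) (T\<^sub>a A ?X g))"
    using h by simp
  also have "\<dots> = Comp C (T\<^sub>o (T\<^sub>o A)) (T\<^sub>o ?X) ?X (snd x)
      (Comp C (T\<^sub>o (T\<^sub>o A)) (T\<^sub>o (T\<^sub>o ?X)) (T\<^sub>o ?X) (T\<^sub>a (T\<^sub>o ?X) ?X (snd x)) (T\<^sub>a (T\<^sub>o A) (T\<^sub>o ?X) (T\<^sub>a A ?X g)))"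
    by (rule category_assoc[OF C, symmetric]) (use A h g in \<open>simp_all add: r\<close>)
  also have "\<dots> = Comp C (T\<^sub>o (T\<^sub>o A)) (T\<^sub>o ?X) ?X (snd x)
      (T\<^sub>a (T\<^sub>o A) ?X (Comp C (T\<^sub>o A) (T\<^sub>o ?X) ?X (snd x) (T\<^sub>a A ?X g)))"
    using A h g by (simp add: r)
  finally show ?thesis
    using A h g by (simp add: EM_cat_simps extend_def free_alg_def category_Comp[OF C] r)
qed

lemma extend_unit:
  assumes A: "A \<in> Obj C" and x: "x \<in> Obj (EM_cat C T)" and g: "g \<in> Hom C A (fst x)"
  shows "Comp C A (T\<^sub>o A) (fst x) (extend C T A x g) (\<eta> A) = g"
proof -
  let ?X = "fst x"
  note h = x[unfolded EM_cat_simps]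
  have "Comp C A (T\<^sub>o A) ?X (extend C T A x g) (\<eta> A)
      = Comp C A (T\<^sub>o ?X) ?X (snd x) (Comp C A (T\<^sub>o A) (T\<^sub>o ?X) (T\<^sub>a A ?X g) (\<eta> A))"
    unfolding extend_def
    by (rule category_assoc[OF C, symmetric]) (use A h g in \<open>simp_all add: T_rules\<close>)
  also have "\<dots> = Comp C A (T\<^sub>o ?X) ?X (snd x) (Comp C A ?X (T\<^sub>o ?X) (\<eta> ?X) g)"
    using A h g by (simp add: unit_naturality)
  also have "\<dots> = Comp C A ?X ?X (Comp C ?X (T\<^sub>o ?X) ?X (snd x) (\<eta> ?X)) g"
    by (rule category_assoc[OF C]) (use A h g in \<open>simp_all add: T_rules\<close>)
  also have "\<dots> = g"
    using A h g by (simp add: category_Id_left[OF C])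
  finally show ?thesis .
qed

lemma extend_comp_unit:
  assumes A: "A \<in> Obj C" and x: "x \<in> Obj (EM_cat C T)" and k: "k \<in> Hom (EM_cat C T) (free_alg T A) x"
  shows "extend C T A x (Comp C A (T\<^sub>o A) (fst x) k (\<eta> A)) = k"
proof -
  let ?X = "fst x"
  note h = x[unfolded EM_cat_simps] k[unfolded EM_cat_simps, unfolded free_alg_def, simplified]
  note r = T_rules is_functor_Comp[OF functor_T]
  have "extend C T A x (Comp C A (T\<^sub>o A) ?X k (\<eta> A))
      = Comp C (T\<^sub>o A) (T\<^sub>o ?X) ?X (snd x)
          (Comp C (T\<^sub>o A) (T\<^sub>o (T\<^sub>o A)) (T\<^sub>o ?X) (T\<^sub>a (T\<^sub>o A) ?X k) (T\<^sub>a A (T\<^sub>o A) (\<eta> A)))"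
    unfolding extend_def using A h by (simp add: r)
  also have "\<dots> = Comp C (T\<^sub>o A) (T\<^sub>o (T\<^sub>o A)) ?X
      (Comp C (T\<^sub>o (T\<^sub>o A)) (T\<^sub>o ?X) ?X (snd x) (T\<^sub>a (T\<^sub>o A) ?X k)) (T\<^sub>a A (T\<^sub>o A) (\<eta> A))"
    by (rule category_assoc[OF C]) (use A h in \<open>simp_all add: r\<close>)
  also have "\<dots> = Comp C (T\<^sub>o A) (T\<^sub>o (T\<^sub>o A)) ?X
      (Comp C (T\<^sub>o (T\<^sub>o A)) (T\<^sub>o A) ?X k (\<mu> A)) (T\<^sub>a A (T\<^sub>o A) (\<eta> A))"
    using h by simp
  also have "\<dots> = Comp C (T\<^sub>o A) (T\<^sub>o A) ?X k
      (Comp C (T\<^sub>o A) (T\<^sub>o (T\<^sub>o A)) (T\<^sub>o A) (\<mu> A) (T\<^sub>a A (T\<^sub>o A) (\<eta> A)))"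
    by (rule category_assoc[OF C, symmetric]) (use A h in \<open>simp_all add: r\<close>)
  also have "\<dots> = k"
    using A h by (simp add: monad_laws r category_Id_right[OF C])
  finally show ?thesis .
qed

lemma extend_natural:
  assumes A: "A \<in> Obj C" and x: "x \<in> Obj (EM_cat C T)" and y: "y \<in> Obj (EM_cat C T)"
    and g: "g \<in> Hom C A (fst x)" and m: "m \<in> Hom (EM_cat C T) x y"
  shows "Comp C (T\<^sub>o A) (fst x) (fst y) m (extend C T A x g)
    = extend C T A y (Comp C A (fst x) (fst y) m g)"
proof -
  have k: "Comp C (T\<^sub>o A) (fst x) (fst y) m (extend C T A x g) \<in> Hom (EM_cat C T) (free_alg T A) y"
    using category_Comp[OF category_EM free_alg_EM[OF A] x y extend_Hom[OF A x g] m]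
    by (simp add: EM_cat_simps(4))
  have "Comp C A (T\<^sub>o A) (fst y) (Comp C (T\<^sub>o A) (fst x) (fst y) m (extend C T A x g)) (\<eta> A)
      = Comp C A (fst x) (fst y) m (Comp C A (T\<^sub>o A) (fst x) (extend C T A x g) (\<eta> A))"
    by (rule category_assoc[OF C, symmetric])
      (use A x y m extend_Hom[OF A x g] in \<open>auto simp: EM_cat_simps T_rules\<close>)
  then show ?thesis
    using extend_comp_unit[OF A y k] by (simp add: extend_unit[OF A x g])
qed

end

lemma dense_generatorD:
  fixes E :: "('o, 'u::universe) category"
  assumes "dense_generator E \<A>"
  shows "category E" "locally_small E" "\<A> \<subseteq> Obj E" "small TYPE('u) \<A>"
  using assms by (simp_all add: dense_generator_def)

lemma dense_generator_eqI:
  fixes E :: "('o, 'u::universe) category"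
  assumes dense: "dense_generator E \<A>" and X: "X \<in> Obj E" and Y: "Y \<in> Obj E"
    and f: "f \<in> Hom E X Y" and g: "g \<in> Hom E X Y"
    and eq: "\<And>A x. A \<in> \<A> \<Longrightarrow> x \<in> Hom E A X \<Longrightarrow> Comp E A X Y f x = Comp E A X Y g x"
  shows "f = g"
proof -
  note E = dense_generatorD[OF dense]
  note AE = subsetD[OF E(3)]
  have "\<exists>!h. h \<in> Hom E X Y \<and> (\<forall>A\<in>\<A>. \<forall>x\<in>Hom E A X. Comp E A X Y h x = Comp E A X Y g x)"
    by (rule dense[unfolded dense_generator_iff[OF E], THEN bspec, OF X, THEN bspec, OF Y,
          THEN spec[of _ "\<lambda>A x. Comp E A X Y g x"], THEN mp, THEN mp])
      (use X Y g in \<open>simp_all add: AE category_Comp[OF E(1)] category_assoc[OF E(1)]\<close>)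
  then show ?thesis using f g eq by blast
qed

context monad_on
begin

lemma free_alg_hom_eqI:
  assumes "A \<in> Obj C" "x \<in> Obj (EM_cat C T)"
    and "k \<in> Hom (EM_cat C T) (free_alg T A) x" "k' \<in> Hom (EM_cat C T) (free_alg T A) x"
    and "Comp C A (T\<^sub>o A) (fst x) k (\<eta> A) = Comp C A (T\<^sub>o A) (fst x) k' (\<eta> A)"
  shows "k = k'"
  using extend_comp_unit[OF assms(1,2)] assms(3-5) by metis

text \<open>
  The forgetful functor of any monad has connected factorisations, because
  \<open>B \<rightarrow> T B \<rightarrow> X\<close>, with the unit as first factor, is initial among the factorisations of
  \<open>g : B \<rightarrow> X\<close> through free algebras.
\<close>

lemma connected_factorisations_forgetful:
  assumes A: "\<A> \<subseteq> Obj C"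
  shows "connected_factorisations (EM_cat C T) (Theta T \<A>) C \<A> (forgetful C T)"
proof (rule connected_factorisationsI)
  note AC = subsetD[OF A]
  fix x B g assume x: "x \<in> Obj (EM_cat C T)" and B: "B \<in> \<A>"
    and g: "g \<in> Hom C B (omap (forgetful C T) x)"
  have B': "B \<in> Obj C" and g': "g \<in> Hom C B (fst x)" using AC B g x by auto
  show "\<exists>A\<in>Theta T \<A>. \<exists>p\<in>Hom (EM_cat C T) A x. \<exists>k\<in>Hom C B (omap (forgetful C T) A).
      Comp C B (omap (forgetful C T) A) (omap (forgetful C T) x) (amap (forgetful C T) A x p) k = g"
    unfolding Theta_eq
    by (intro bexI[of _ "free_alg T B"] bexI[of _ "extend C T B x g"] bexI[of _ "\<eta> B"])
      (use B B' g' x in \<open>simp_all add: free_alg_EM extend_Hom extend_unit T_rules\<close>)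
next
  note AC = subsetD[OF A]
  let ?U = "forgetful C T"
  fix x B y y' p p' k k' and Q :: "_ \<Rightarrow> _ \<Rightarrow> bool"
  assume x: "x \<in> Obj (EM_cat C T)" and B: "B \<in> \<A>"
    and Q: "\<And>y y' p f k. y \<in> Theta T \<A> \<Longrightarrow> y' \<in> Theta T \<A> \<Longrightarrow> p \<in> Hom (EM_cat C T) y' x
      \<Longrightarrow> f \<in> Hom (EM_cat C T) y y' \<Longrightarrow> k \<in> Hom C B (omap ?U y)
      \<Longrightarrow> Q (y, Comp (EM_cat C T) y y' x p f) k
        = Q (y', p) (Comp C B (omap ?U y) (omap ?U y') (amap ?U y y' f) k)"
    and h: "y \<in> Theta T \<A>" "y' \<in> Theta T \<A>" "p \<in> Hom (EM_cat C T) y x" "p' \<in> Hom (EM_cat C T) y' x"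
      "k \<in> Hom C B (omap ?U y)" "k' \<in> Hom C B (omap ?U y')"
    and eq: "Comp C B (omap ?U y) (omap ?U x) (amap ?U y x p) k
      = Comp C B (omap ?U y') (omap ?U x) (amap ?U y' x p') k'"
  have B': "B \<in> Obj C" using AC B .
  \<comment> \<open>Invariance along the unique map from the initial factorisation.\<close>
  have init: "Q (y, p) k
      = Q (free_alg T B, extend C T B x (Comp C B (fst y) (fst x) p k)) (\<eta> B)"
    if yT: "y \<in> Theta T \<A>" and p: "p \<in> Hom (EM_cat C T) y x" and k: "k \<in> Hom C B (omap ?U y)"
    for y p k
  proof -
    have y: "y \<in> Obj (EM_cat C T)" using yT AC free_alg_EM by (auto simp: Theta_eq)
    have k: "k \<in> Hom C B (fst y)" using k y by simp
    note f = extend_Hom[OF B' y k]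
    have "Q (free_alg T B, Comp (EM_cat C T) (free_alg T B) y x p (extend C T B y k)) (\<eta> B)
        = Q (y, p) (Comp C B (omap ?U (free_alg T B)) (omap ?U y)
            (amap ?U (free_alg T B) y (extend C T B y k)) (\<eta> B))"
      by (rule Q) (use yT p f B B' in \<open>auto simp: Theta_eq free_alg_EM T_rules\<close>)
    also have "Comp C B (omap ?U (free_alg T B)) (omap ?U y)
        (amap ?U (free_alg T B) y (extend C T B y k)) (\<eta> B) = k"
      using f y by (simp add: free_alg_EM[OF B'] extend_unit[OF B' y k])
    finally show ?thesis
      by (simp add: EM_cat_simps(4) extend_natural[OF B' y x k p])
  qed
  have "y \<in> Obj (EM_cat C T)" "y' \<in> Obj (EM_cat C T)"
    using h(1,2) AC free_alg_EM by (auto simp: Theta_eq)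
  then have "Comp C B (fst y) (fst x) p k = Comp C B (fst y') (fst x) p' k'"
    using eq x h(3,4) by simp
  then show "Q (y, p) k = Q (y', p') k'"
    using init[OF h(1,3,5)] init[OF h(2,4,6)] by simp
qed

text \<open>
  Factorisations of \<open>A \<rightarrow> U G X\<close> through the functor \<open>U G\<close> and of the corresponding
  algebra map \<open>T A \<rightarrow> G X\<close> through \<open>G\<close> are the same, by the adjunction.
\<close>

lemma connected_factorisations_forgetful_comp:
  assumes G: "is_functor D (EM_cat C T) G" and D: "\<D> \<subseteq> Obj D" and A: "\<A> \<subseteq> Obj C"
  shows "connected_factorisations D \<D> C \<A> (comp_ftr D (forgetful C T) G)
    \<longleftrightarrow> connected_factorisations D \<D> (EM_cat C T) (Theta T \<A>) G"
proof
  let ?M = "EM_cat C T" and ?U = "forgetful C T"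
  let ?UG = "comp_ftr D ?U G"
  note sub = subsetD[OF D] subsetD[OF A]
  note cD = is_functor_category(1)[OF G]
  note r = is_functor_rules[OF G]
  have oUG: "omap ?UG X = fst (omap G X)" if "X \<in> Obj D" for X
    using that by (simp add: r)
  have aUG: "amap ?UG X Y f = amap G X Y f" if "X \<in> Obj D" "Y \<in> Obj D" "f \<in> Hom D X Y" for X Y f
    using that by (simp add: r)
  note [simp del] = comp_ftr_simps
  have UG_Hom: "amap G X Y f \<in> Hom C (fst (omap G X)) (fst (omap G Y))"
    if "X \<in> Obj D" "Y \<in> Obj D" "f \<in> Hom D X Y" for X Y f
    using r(2)[OF that] by (simp add: EM_cat_simps)
  have GC: "fst (omap G X) \<in> Obj C" if "X \<in> Obj D" for X
    using r(1)[OF that] by (simp add: EM_cat_simps)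
  have restr: "Comp C B (T\<^sub>o B) (fst (omap G X)) k (\<eta> B) \<in> Hom C B (fst (omap G X))"
    if "B \<in> Obj C" "X \<in> Obj D" "k \<in> Hom ?M (free_alg T B) (omap G X)" for B X k
    using that GC[OF that(2)]
    by (auto simp: EM_cat_simps T_rules intro!: category_Comp[OF C, where Y = "T\<^sub>o B"])
  have restr_nat: "Comp C B (T\<^sub>o B) (fst (omap G Y)) (Comp C (T\<^sub>o B) (fst (omap G X)) (fst (omap G Y)) (amap G X Y f) k) (\<eta> B)
      = Comp C B (fst (omap G X)) (fst (omap G Y)) (amap G X Y f) (Comp C B (T\<^sub>o B) (fst (omap G X)) k (\<eta> B))"
    if "B \<in> Obj C" "X \<in> Obj D" "Y \<in> Obj D" "f \<in> Hom D X Y" "k \<in> Hom ?M (free_alg T B) (omap G X)"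
    for B X Y f k
    by (rule category_assoc[OF C, symmetric])
      (use that in \<open>auto simp: GC UG_Hom T_rules EM_cat_simps(2)\<close>)
  have ext: "extend C T B (omap G X) k \<in> Hom ?M (free_alg T B) (omap G X)"
    if "B \<in> Obj C" "X \<in> Obj D" "k \<in> Hom C B (fst (omap G X))" for B X k
    using that by (simp add: r extend_Hom)
  have ext_nat: "Comp C (T\<^sub>o B) (fst (omap G X)) (fst (omap G Y)) (amap G X Y f) (extend C T B (omap G X) k)
      = extend C T B (omap G Y) (Comp C B (fst (omap G X)) (fst (omap G Y)) (amap G X Y f) k)"
    if "B \<in> Obj C" "X \<in> Obj D" "Y \<in> Obj D" "f \<in> Hom D X Y" "k \<in> Hom C B (fst (omap G X))"
    for B X Y f k
    using that by (simp add: r extend_natural)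
  {
    assume cUG: "connected_factorisations D \<D> C \<A> ?UG"
    show "connected_factorisations D \<D> ?M (Theta T \<A>) G"
    proof (rule connected_factorisationsI)
      fix X b g assume X: "X \<in> Obj D" and b: "b \<in> Theta T \<A>" and g: "g \<in> Hom ?M b (omap G X)"
      obtain B where B: "B \<in> \<A>" and bB: "b = free_alg T B" using b by (auto simp: Theta_eq)
      have B': "B \<in> Obj C" using sub(2)[OF B] .
      let ?g = "Comp C B (T\<^sub>o B) (fst (omap G X)) g (\<eta> B)"
      have "?g \<in> Hom C B (omap ?UG X)"
        using restr[OF B' X] g by (simp only: oUG X bB)
      then obtain Y p k where Y: "Y \<in> \<D>" and p: "p \<in> Hom D Y X" and k: "k \<in> Hom C B (omap ?UG Y)"
        and pk: "Comp C B (omap ?UG Y) (omap ?UG X) (amap ?UG Y X p) k = ?g"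
        using connected_factorisations_exists[OF cUG X B] by metis
      have k: "k \<in> Hom C B (fst (omap G Y))" using k Y sub by (simp add: oUG)
      have "Comp ?M b (omap G Y) (omap G X) (amap G Y X p) (extend C T B (omap G Y) k)
          = extend C T B (omap G X) ?g"
        using pk ext_nat[OF B' sub(1)[OF Y] X p k]
        by (simp only: oUG aUG X Y p sub bB EM_cat_simps(4) fst_free_alg)
      also have "\<dots> = g"
        using extend_comp_unit[OF B' r(1)[OF X]] g bB by simp
      finally show "\<exists>Y\<in>\<D>. \<exists>p\<in>Hom D Y X. \<exists>k\<in>Hom ?M b (omap G Y).
          Comp ?M b (omap G Y) (omap G X) (amap G Y X p) k = g"
        using Y p ext[OF B' sub(1)[OF Y] k] unfolding bB by blast
    next
      fix X b Y Y' p p' k k' and Q :: "_ \<Rightarrow> _ \<Rightarrow> bool"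
      assume X: "X \<in> Obj D" and b: "b \<in> Theta T \<A>"
        and Q: "\<And>Y Y' p f k. Y \<in> \<D> \<Longrightarrow> Y' \<in> \<D> \<Longrightarrow> p \<in> Hom D Y' X \<Longrightarrow> f \<in> Hom D Y Y'
          \<Longrightarrow> k \<in> Hom ?M b (omap G Y) \<Longrightarrow> Q (Y, Comp D Y Y' X p f) k
            = Q (Y', p) (Comp ?M b (omap G Y) (omap G Y') (amap G Y Y' f) k)"
        and h: "Y \<in> \<D>" "Y' \<in> \<D>" "p \<in> Hom D Y X" "p' \<in> Hom D Y' X"
          "k \<in> Hom ?M b (omap G Y)" "k' \<in> Hom ?M b (omap G Y')"
        and eq: "Comp ?M b (omap G Y) (omap G X) (amap G Y X p) k
          = Comp ?M b (omap G Y') (omap G X) (amap G Y' X p') k'"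
      obtain B where B: "B \<in> \<A>" and bB: "b = free_alg T B" using b by (auto simp: Theta_eq)
      have B': "B \<in> Obj C" using sub(2)[OF B] .
      have kB: "k \<in> Hom ?M (free_alg T B) (omap G Y)" "k' \<in> Hom ?M (free_alg T B) (omap G Y')"
        using h(5,6) bB by simp_all
      define Q' where "Q' = (\<lambda>(Y, p) k. Q (Y, p) (extend C T B (omap G Y) k))"
      have "Q' (Y, p) (Comp C B (T\<^sub>o B) (fst (omap G Y)) k (\<eta> B))
          = Q' (Y', p') (Comp C B (T\<^sub>o B) (fst (omap G Y')) k' (\<eta> B))"
      proof (rule connected_factorisations_invariant[OF cUG X B, where Q = Q'])
        fix Y Y' p f k assume i: "Y \<in> \<D>" "Y' \<in> \<D>" "p \<in> Hom D Y' X" "f \<in> Hom D Y Y'"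
          "k \<in> Hom C B (omap ?UG Y)"
        then have k: "k \<in> Hom C B (fst (omap G Y))" using sub by (simp add: oUG)
        have "Q (Y, Comp D Y Y' X p f) (extend C T B (omap G Y) k)
            = Q (Y', p) (Comp C (T\<^sub>o B) (fst (omap G Y)) (fst (omap G Y')) (amap G Y Y' f) (extend C T B (omap G Y) k))"
          using Q[OF i(1-4), of "extend C T B (omap G Y) k"] ext[OF B' sub(1)[OF i(1)] k]
          by (simp add: bB EM_cat_simps(4))
        then show "Q' (Y, Comp D Y Y' X p f) k
            = Q' (Y', p) (Comp C B (omap ?UG Y) (omap ?UG Y') (amap ?UG Y Y' f) k)"
          using i(1-4) sub by (simp add: Q'_def oUG aUG ext_nat[OF B' sub(1)[OF i(1)] sub(1)[OF i(2)] i(4) k])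
      next
        show "Comp C B (omap ?UG Y) (omap ?UG X) (amap ?UG Y X p) (Comp C B (T\<^sub>o B) (fst (omap G Y)) k (\<eta> B))
          = Comp C B (omap ?UG Y') (omap ?UG X) (amap ?UG Y' X p') (Comp C B (T\<^sub>o B) (fst (omap G Y')) k' (\<eta> B))"
          using eq h(1-4) sub
            restr_nat[OF B' sub(1)[OF h(1)] X h(3) kB(1)] restr_nat[OF B' sub(1)[OF h(2)] X h(4) kB(2)]
          by (simp add: oUG aUG X bB EM_cat_simps(4))
      qed (use h sub X restr[OF B' _ kB(1)] restr[OF B' _ kB(2)] in
          \<open>simp_all add: oUG\<close>)
      then show "Q (Y, p) k = Q (Y', p') k'"
        using extend_comp_unit[OF B' r(1) kB(1)] extend_comp_unit[OF B' r(1) kB(2)] h(1,2) sub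
        by (simp add: Q'_def)
    qed
  next
    assume cG: "connected_factorisations D \<D> ?M (Theta T \<A>) G"
    show "connected_factorisations D \<D> C \<A> ?UG"
    proof (rule connected_factorisations_comp_ftr[OF G functor_U D _ A cG
          connected_factorisations_forgetful[OF A]])
      show "Theta T \<A> \<subseteq> Obj ?M" using sub(2) free_alg_EM by (auto simp: Theta_eq)
    qed
  }
qed

end

text \<open>
  The nerve theorem. A map \<open>\<phi>\<close> between the nerves of the algebras \<open>x\<close>, \<open>y\<close> restricts, along
  the free functor, to a map between the nerves of their underlying objects, hence comes from an arrow
  \<open>f\<close> between these. Density reduces the equation saying that \<open>f\<close> is an algebra map to arrows
  \<open>B \<rightarrow> T X\<close>; these factor as \<open>B \<rightarrow> T A \<rightarrow> T X\<close>, and then the equation is naturality of \<open>\<phi>\<close>.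
\<close>

proposition dense_generator_Theta:
  fixes E :: "('o, 'u::universe) category"
  assumes dense: "dense_generator E \<A>" and monad: "monad E T"
    and conn: "connected_factorisations E \<A> E \<A> (mfun T)"
  shows "dense_generator (EM_cat E T) (Theta T \<A>)"
proof -
  interpret monad_on E T by (unfold_locales) (fact monad)
  let ?M = "EM_cat E T"
  note E = dense_generatorD[OF dense]
  note AE = subsetD[OF E(3)]
  have Hom_sub: "Hom ?M x y \<subseteq> Hom E (fst x) (fst y)" for x y by (auto simp: EM_cat_simps)
  have "small TYPE('u) (Hom ?M x y)" if "x \<in> Obj ?M" "y \<in> Obj ?M" for x y
  proof -
    have "Hom E (fst x) (fst y) \<prec> (UNIV :: 'u set)"
      using locally_smallD[OF E(2)] that by (auto simp: EM_cat_simps small_def)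
    then show ?thesis
      unfolding small_def by (rule lesspoll_trans1[OF subset_imp_lepoll[OF Hom_sub]])
  qed
  then have M: "category ?M" "locally_small ?M" "Theta T \<A> \<subseteq> Obj ?M" "small TYPE('u) (Theta T \<A>)"
    using category_EM AE free_alg_EM small_image[OF E(4)]
    by (auto simp: locally_small_def Theta_eq)
  show ?thesis
    unfolding dense_generator_iff[OF M]
  proof (intro ballI allI impI)
    fix x y \<phi> assume x: "x \<in> Obj ?M" and y: "y \<in> Obj ?M"
      and 1: "\<forall>a\<in>Theta T \<A>. \<forall>k\<in>Hom ?M a x. \<phi> a k \<in> Hom ?M a y"
      and 2: "\<forall>a\<in>Theta T \<A>. \<forall>b\<in>Theta T \<A>. \<forall>f\<in>Hom ?M b a. \<forall>k\<in>Hom ?M a x.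
        \<phi> b (Comp ?M b a x k f) = Comp ?M b a y (\<phi> a k) f"
    have \<phi>: "\<phi> (free_alg T A) k \<in> Hom ?M (free_alg T A) y"
        if "A \<in> \<A>" "k \<in> Hom ?M (free_alg T A) x" for A k
      using 1 that by (simp add: Theta_eq)
    have \<phi>_nat: "\<phi> (free_alg T B) (Comp E (T\<^sub>o B) (T\<^sub>o A) (fst x) k f)
          = Comp E (T\<^sub>o B) (T\<^sub>o A) (fst y) (\<phi> (free_alg T A) k) f"
        if "A \<in> \<A>" "B \<in> \<A>" "f \<in> Hom ?M (free_alg T B) (free_alg T A)" "k \<in> Hom ?M (free_alg T A) x"
        for A B f k
      using 2 that by (simp add: Theta_eq EM_cat_simps(4))
    let ?X = "fst x" and ?Y = "fst y"
    note hx = x[unfolded EM_cat_simps] and hy = y[unfolded EM_cat_simps]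
    have X: "?X \<in> Obj E" and Y: "?Y \<in> Obj E" using hx hy by auto
    \<comment> \<open>The restriction of \<open>\<phi>\<close> along the free functor, as a map \<open>Hom A X \<rightarrow> Hom A Y\<close>.\<close>
    define \<psi> where "\<psi> A g = Comp E A (T\<^sub>o A) ?Y (\<phi> (free_alg T A) (extend E T A x g)) (\<eta> A)" for A g
    have \<phi>_Hom: "\<phi> (free_alg T A) k \<in> Hom E (T\<^sub>o A) ?Y"
      if "A \<in> \<A>" "k \<in> Hom ?M (free_alg T A) x" for A k
      using \<phi>[OF that] by (simp add: EM_cat_simps(2))
    have ext_Hom: "extend E T A x g \<in> Hom E (T\<^sub>o A) ?X" if "A \<in> \<A>" "g \<in> Hom E A ?X" for A g
      using extend_Hom[OF AE x] that by (simp add: EM_cat_simps(2))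
    have \<psi>_extend: "\<psi> B (Comp E B (T\<^sub>o A) ?X k l) = Comp E B (T\<^sub>o A) ?Y (\<phi> (free_alg T A) k) l"
      if A: "A \<in> \<A>" and B: "B \<in> \<A>" and k: "k \<in> Hom ?M (free_alg T A) x" and l: "l \<in> Hom E B (T\<^sub>o A)"
      for A B k l
    proof -
      let ?l = "extend E T B (free_alg T A) l"
      have l': "l \<in> Hom E B (fst (free_alg T A))" using l by simp
      note lM = extend_Hom[OF AE[OF B] free_alg_EM[OF AE[OF A]] l']
      have lE: "?l \<in> Hom E (T\<^sub>o B) (T\<^sub>o A)" using lM by (simp add: EM_cat_simps(2))
      have "extend E T B x (Comp E B (T\<^sub>o A) ?X k l) = Comp E (T\<^sub>o B) (T\<^sub>o A) ?X k ?l"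
        using extend_natural[OF AE[OF B] free_alg_EM[OF AE[OF A]] x l' k] by simp
      then have "\<psi> B (Comp E B (T\<^sub>o A) ?X k l)
          = Comp E B (T\<^sub>o B) ?Y (Comp E (T\<^sub>o B) (T\<^sub>o A) ?Y (\<phi> (free_alg T A) k) ?l) (\<eta> B)"
        by (simp add: \<psi>_def \<phi>_nat[OF A B lM k])
      also have "\<dots> = Comp E B (T\<^sub>o A) ?Y (\<phi> (free_alg T A) k) (Comp E B (T\<^sub>o B) (T\<^sub>o A) ?l (\<eta> B))"
        by (rule category_assoc[OF E(1), symmetric])
          (use A B Y lE \<phi>_Hom[OF A k] in \<open>simp_all add: AE T_rules\<close>)
      also have "\<dots> = Comp E B (T\<^sub>o A) ?Y (\<phi> (free_alg T A) k) l"
        using extend_unit[OF AE[OF B] free_alg_EM[OF AE[OF A]] l'] by simp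
      finally show ?thesis .
    qed
    \<comment> \<open>By the previous fact, naturality of \<open>\<psi>\<close> needs no more than rewriting \<open>g \<circ> f\<close> as the
      extension of \<open>g\<close> composed with \<open>\<eta> \<circ> f\<close>.\<close>
    have "\<exists>!f. f \<in> Hom E ?X ?Y \<and> (\<forall>A\<in>\<A>. \<forall>g\<in>Hom E A ?X. Comp E A ?X ?Y f g = \<psi> A g)"
    proof (rule dense[unfolded dense_generator_iff[OF E], THEN bspec, OF X, THEN bspec, OF Y,
          THEN spec[of _ \<psi>], THEN mp, THEN mp])
      show "\<forall>A\<in>\<A>. \<forall>g\<in>Hom E A ?X. \<psi> A g \<in> Hom E A ?Y"
        unfolding \<psi>_def using Y
        by (auto intro!: category_Comp[OF E(1)] \<phi>_Hom extend_Hom x simp: AE T_rules)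
      show "\<forall>A\<in>\<A>. \<forall>B\<in>\<A>. \<forall>f\<in>Hom E B A. \<forall>g\<in>Hom E A ?X.
          \<psi> B (Comp E B A ?X g f) = Comp E B A ?Y (\<psi> A g) f"
      proof (intro ballI)
        fix A B f g assume A: "A \<in> \<A>" and B: "B \<in> \<A>" and f: "f \<in> Hom E B A" and g: "g \<in> Hom E A ?X"
        note g' = extend_Hom[OF AE[OF A] x g]
        have \<eta>f: "Comp E B A (T\<^sub>o A) (\<eta> A) f \<in> Hom E B (T\<^sub>o A)"
          using A B f by (intro category_Comp[OF E(1)]) (auto simp: AE T_rules)
        have "Comp E B A ?X g f = Comp E B A ?X (Comp E A (T\<^sub>o A) ?X (extend E T A x g) (\<eta> A)) f"
          by (simp add: extend_unit[OF AE[OF A] x g])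
        also have "\<dots> = Comp E B (T\<^sub>o A) ?X (extend E T A x g) (Comp E B A (T\<^sub>o A) (\<eta> A) f)"
          by (rule category_assoc[OF E(1), symmetric])
            (use A B X f ext_Hom[OF A g] in \<open>simp_all add: AE T_rules\<close>)
        finally have "\<psi> B (Comp E B A ?X g f)
            = Comp E B (T\<^sub>o A) ?Y (\<phi> (free_alg T A) (extend E T A x g)) (Comp E B A (T\<^sub>o A) (\<eta> A) f)"
          using \<psi>_extend[OF A B g' \<eta>f] by simp
        also have "\<dots> = Comp E B A ?Y (\<psi> A g) f"
          unfolding \<psi>_def
          by (rule category_assoc[OF E(1)]) (use A B Y f \<phi>_Hom[OF A g'] in \<open>simp_all add: AE T_rules\<close>)
        finally show "\<psi> B (Comp E B A ?X g f) = Comp E B A ?Y (\<psi> A g) f" .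
      qed
    qed
    then obtain f where f: "f \<in> Hom E ?X ?Y"
      and f\<psi>: "\<And>A g. A \<in> \<A> \<Longrightarrow> g \<in> Hom E A ?X \<Longrightarrow> Comp E A ?X ?Y f g = \<psi> A g"
      by blast
    have "Comp E (T\<^sub>o ?X) ?X ?Y f (snd x) = Comp E (T\<^sub>o ?X) (T\<^sub>o ?Y) ?Y (snd y) (T\<^sub>a ?X ?Y f)"
    proof (rule dense_generator_eqI[OF dense])
      fix B g assume B: "B \<in> \<A>" and g: "g \<in> Hom E B (T\<^sub>o ?X)"
      obtain A p k where A: "A \<in> \<A>" and p: "p \<in> Hom E A ?X" and k: "k \<in> Hom E B (T\<^sub>o A)"
        and g: "Comp E B (T\<^sub>o A) (T\<^sub>o ?X) (T\<^sub>a A ?X p) k = g"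
        by (rule connected_factorisations_exists[OF conn X B g])
      note h = AE[OF A] AE[OF B] X Y hx hy f p k and r = T_rules is_functor_Comp[OF functor_T]
      note p' = extend_Hom[OF AE[OF A] x p]
      have "Comp E B (T\<^sub>o ?X) ?Y (Comp E (T\<^sub>o ?X) ?X ?Y f (snd x)) g
          = Comp E B ?X ?Y f (Comp E B (T\<^sub>o ?X) ?X (snd x) g)"
        by (rule category_assoc[OF E(1), symmetric])
          (use h in \<open>simp_all add: r g[symmetric] category_Comp[OF E(1)]\<close>)
      also have "Comp E B (T\<^sub>o ?X) ?X (snd x) g = Comp E B (T\<^sub>o A) ?X (extend E T A x p) k"
        unfolding g[symmetric] extend_def
        by (rule category_assoc[OF E(1)]) (use h in \<open>simp_all add: r\<close>)
      also have "Comp E B ?X ?Y f (Comp E B (T\<^sub>o A) ?X (extend E T A x p) k)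
          = Comp E B (T\<^sub>o A) ?Y (\<phi> (free_alg T A) (extend E T A x p)) k"
      proof -
        have "Comp E B (T\<^sub>o A) ?X (extend E T A x p) k \<in> Hom E B ?X"
          using h ext_Hom[OF A p] by (intro category_Comp[OF E(1)]) (auto simp: r)
        then show ?thesis
          by (simp add: f\<psi>[OF B] \<psi>_extend[OF A B p' k])
      qed
      also have "\<phi> (free_alg T A) (extend E T A x p) = extend E T A y (Comp E A ?X ?Y f p)"
        using extend_comp_unit[OF AE[OF A] y \<phi>[OF A p']] f\<psi>[OF A p] by (simp add: \<psi>_def)
      also have "\<dots> = Comp E (T\<^sub>o A) (T\<^sub>o ?X) ?Y (Comp E (T\<^sub>o ?X) (T\<^sub>o ?Y) ?Y (snd y) (T\<^sub>a ?X ?Y f)) (T\<^sub>a A ?X p)"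
        unfolding extend_def using h by (simp add: r category_assoc[OF E(1)])
      also have "Comp E B (T\<^sub>o A) ?Y \<dots> k
          = Comp E B (T\<^sub>o ?X) ?Y (Comp E (T\<^sub>o ?X) (T\<^sub>o ?Y) ?Y (snd y) (T\<^sub>a ?X ?Y f)) g"
        unfolding g[symmetric]
        by (rule category_assoc[OF E(1), symmetric])
          (use h in \<open>simp_all add: r category_Comp[OF E(1), where Y = "T\<^sub>o ?Y"]\<close>)
      finally show "Comp E B (T\<^sub>o ?X) ?Y (Comp E (T\<^sub>o ?X) ?X ?Y f (snd x)) g
          = Comp E B (T\<^sub>o ?X) ?Y (Comp E (T\<^sub>o ?X) (T\<^sub>o ?Y) ?Y (snd y) (T\<^sub>a ?X ?Y f)) g" .
    next
      show "Comp E (T\<^sub>o ?X) ?X ?Y f (snd x) \<in> Hom E (T\<^sub>o ?X) ?Y"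
        by (rule category_Comp[OF E(1), where Y = ?X]) (use X Y hx f in \<open>simp_all add: T_rules\<close>)
      show "Comp E (T\<^sub>o ?X) (T\<^sub>o ?Y) ?Y (snd y) (T\<^sub>a ?X ?Y f) \<in> Hom E (T\<^sub>o ?X) ?Y"
        by (rule category_Comp[OF E(1), where Y = "T\<^sub>o ?Y"]) (use X Y hy f in \<open>simp_all add: T_rules\<close>)
    qed (use X Y in \<open>simp_all add: T_rules\<close>)
    with f have fM: "f \<in> Hom ?M x y" by (simp add: EM_cat_simps(2))
    show "\<exists>!f. f \<in> Hom ?M x y \<and> (\<forall>a\<in>Theta T \<A>. \<forall>k\<in>Hom ?M a x. Comp ?M a x y f k = \<phi> a k)"
    proof (rule ex1I[of _ f])
      have "Comp E (T\<^sub>o A) ?X ?Y f k = \<phi> (free_alg T A) k"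
        if A: "A \<in> \<A>" and k: "k \<in> Hom ?M (free_alg T A) x" for A k
      proof (rule free_alg_hom_eqI[OF AE[OF A] y _ \<phi>[OF A k]])
        show "Comp E (T\<^sub>o A) ?X ?Y f k \<in> Hom ?M (free_alg T A) y"
          using category_Comp[OF M(1) free_alg_EM[OF AE[OF A]] x y k fM] by (simp add: EM_cat_simps(4))
        have kE: "k \<in> Hom E (T\<^sub>o A) ?X" using k by (simp add: EM_cat_simps(2))
        have "Comp E A (T\<^sub>o A) ?Y (Comp E (T\<^sub>o A) ?X ?Y f k) (\<eta> A)
            = Comp E A ?X ?Y f (Comp E A (T\<^sub>o A) ?X k (\<eta> A))"
          by (rule category_assoc[OF E(1), symmetric])
            (use X Y f kE A in \<open>simp_all add: AE T_rules\<close>)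
        also have "\<dots> = \<psi> A (Comp E A (T\<^sub>o A) ?X k (\<eta> A))"
          by (rule f\<psi>[OF A]) (use X kE A in \<open>simp add: AE T_rules category_Comp[OF E(1)]\<close>)
        also have "\<dots> = Comp E A (T\<^sub>o A) ?Y (\<phi> (free_alg T A) k) (\<eta> A)"
          by (simp add: \<psi>_def extend_comp_unit[OF AE[OF A] x k])
        finally show "Comp E A (T\<^sub>o A) ?Y (Comp E (T\<^sub>o A) ?X ?Y f k) (\<eta> A)
            = Comp E A (T\<^sub>o A) ?Y (\<phi> (free_alg T A) k) (\<eta> A)" .
      qed
      then show "f \<in> Hom ?M x y \<and> (\<forall>a\<in>Theta T \<A>. \<forall>k\<in>Hom ?M a x. Comp ?M a x y f k = \<phi> a k)"
        using fM by (simp add: Theta_eq EM_cat_simps(4))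
    next
      fix f' assume f': "f' \<in> Hom ?M x y \<and> (\<forall>a\<in>Theta T \<A>. \<forall>k\<in>Hom ?M a x. Comp ?M a x y f' k = \<phi> a k)"
      then have f'E: "f' \<in> Hom E ?X ?Y" by (simp add: EM_cat_simps(2))
      show "f' = f"
      proof (rule dense_generator_eqI[OF dense X Y f'E f])
        fix A g assume A: "A \<in> \<A>" and g: "g \<in> Hom E A ?X"
        have "Comp E A ?X ?Y f' g = Comp E A ?X ?Y f' (Comp E A (T\<^sub>o A) ?X (extend E T A x g) (\<eta> A))"
          by (simp add: extend_unit[OF AE[OF A] x g])
        also have "\<dots> = Comp E A (T\<^sub>o A) ?Y (Comp E (T\<^sub>o A) ?X ?Y f' (extend E T A x g)) (\<eta> A)"
          by (rule category_assoc[OF E(1)])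
            (use X Y f'E A ext_Hom[OF A g] in \<open>simp_all add: AE T_rules\<close>)
        also have "\<dots> = Comp E A ?X ?Y f g"
          using f' extend_Hom[OF AE[OF A] x g] A
          by (simp add: f\<psi>[OF A g] \<psi>_def Theta_eq EM_cat_simps(4))
        finally show "Comp E A ?X ?Y f' g = Comp E A ?X ?Y f g" .
      qed
    qed
  qed
qed


section \<open>The Eilenberg-Moore object\<close>

lemma arity_hom_simps [simp]:
  "Obj (arity_hom D \<D> E \<A>) = {G. arity_respecting D \<D> E \<A> G}"
  "Hom (arity_hom D \<D> E \<A>) F G = {\<alpha>. nat_trans D E F G \<alpha>}"
  "Id (arity_hom D \<D> E \<A>) G = (\<lambda>X\<in>Obj D. Id E (omap G X))"
  "Comp (arity_hom D \<D> E \<A>) F G H \<beta> \<alpha>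
     = (\<lambda>X\<in>Obj D. Comp E (omap F X) (omap G X) (omap H X) (\<beta> X) (\<alpha> X))"
  by (simp_all add: arity_hom_def)

lemma arity_respecting_functor: "arity_respecting D \<D> E \<A> G \<Longrightarrow> is_functor D E G"
  by (simp add: arity_respecting_def)

lemma category_arity_hom:
  assumes "category D" "category E"
  shows "category (arity_hom D \<D> E \<A>)"
  unfolding arity_hom_def
  by (rule category_full_sub[OF category_functor_cat[OF assms]]) (auto dest: arity_respecting_functor)

lemma arity_respecting_dense_iff:
  assumes "dense_generator E \<A>" "dense_generator F \<B>"
  shows "arity_respecting E \<A> F \<B> H \<longleftrightarrow> is_functor E F H \<and> connected_factorisations E \<A> F \<B> H"
  using arity_respecting_iff dense_generatorD[OF assms(1)] dense_generatorD[OF assms(2)] by blast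

lemma arity_respecting_comp_ftr:
  assumes "dense_generator D \<D>" "dense_generator E \<A>" "dense_generator F \<B>"
    and "arity_respecting D \<D> E \<A> G" "arity_respecting E \<A> F \<B> H"
  shows "arity_respecting D \<D> F \<B> (comp_ftr D H G)"
  using assms(4,5)
  unfolding arity_respecting_dense_iff[OF assms(1,2)] arity_respecting_dense_iff[OF assms(2,3)]
    arity_respecting_dense_iff[OF assms(1,3)]
  using is_functor_comp_ftr connected_factorisations_comp_ftr dense_generatorD(3) assms(1-3)
  by metis

lemma restrict_eq_iff: "restrict f A = restrict g A \<longleftrightarrow> (\<forall>x\<in>A. f x = g x)"
  by (auto simp: restrict_def fun_eq_iff)

lemma is_functor_hom_monad:
  assumes D: "dense_generator D \<D>" and E: "dense_generator E \<A>"
    and T: "arity_respecting E \<A> E \<A> (mfun T)"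
  shows "is_functor (arity_hom D \<D> E \<A>) (arity_hom D \<D> E \<A>) (mfun (hom_monad D \<D> E \<A> T))"
proof -
  note cat = category_arity_hom[OF dense_generatorD(1)[OF D] dense_generatorD(1)[OF E]]
  note fT = arity_respecting_functor[OF T]
  show ?thesis
    unfolding hom_monad_def monad.simps
  proof (rule is_functorI[OF cat cat])
    fix G assume "G \<in> Obj (arity_hom D \<D> E \<A>)"
    then show "comp_ftr D (mfun T) G \<in> Obj (arity_hom D \<D> E \<A>)"
      using arity_respecting_comp_ftr[OF D E E _ T] by simp
    show "post_whisker D (mfun T) G G (Id (arity_hom D \<D> E \<A>) G)
        = Id (arity_hom D \<D> E \<A>) (comp_ftr D (mfun T) G)"
      using is_functor_omap[OF arity_respecting_functor[of D \<D> E \<A> G]] \<open>G \<in> _\<close>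
      by (auto simp: is_functor_Id[OF fT] post_whisker_def intro!: restrict_ext)
  next
    fix G H \<alpha> assume "\<alpha> \<in> Hom (arity_hom D \<D> E \<A>) G H"
    then show "post_whisker D (mfun T) G H \<alpha>
        \<in> Hom (arity_hom D \<D> E \<A>) (comp_ftr D (mfun T) G) (comp_ftr D (mfun T) H)"
      using nat_trans_post_whisker[OF _ fT] by simp
  next
    fix F G H \<alpha> \<beta> assume "\<alpha> \<in> Hom (arity_hom D \<D> E \<A>) F G" "\<beta> \<in> Hom (arity_hom D \<D> E \<A>) G H"
    then have a: "nat_trans D E F G \<alpha>" and b: "nat_trans D E G H \<beta>" by simp_all
    show "post_whisker D (mfun T) F H (Comp (arity_hom D \<D> E \<A>) F G H \<beta> \<alpha>)
        = Comp (arity_hom D \<D> E \<A>) (comp_ftr D (mfun T) F) (comp_ftr D (mfun T) G)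
            (comp_ftr D (mfun T) H) (post_whisker D (mfun T) G H \<beta>) (post_whisker D (mfun T) F G \<alpha>)"
      using is_functor_Comp[OF fT] is_functor_omap[OF nat_trans_functors(1)[OF a]]
        is_functor_omap[OF nat_trans_functors(1)[OF b]] is_functor_omap[OF nat_trans_functors(2)[OF b]]
        nat_trans_comp_in_Hom[OF a] nat_trans_comp_in_Hom[OF b]
      by (auto simp: post_whisker_def intro!: restrict_ext)
  qed
qed

text \<open>An action of \<open>T\<close> on a functor is a natural family of algebra structures on its values.\<close>

lemma algebras_on_Obj_iff:
  assumes D: "dense_generator D \<D>" and E: "dense_generator E \<A>"
    and T: "arity_respecting E \<A> E \<A> (mfun T)"
  shows "(G, \<gamma>) \<in> Obj (algebras_on D \<D> E \<A> T) \<longleftrightarrow> arity_respecting D \<D> E \<A> G \<and>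
    nat_trans D E (comp_ftr D (mfun T) G) G \<gamma> \<and> (\<forall>X\<in>Obj D. (omap G X, \<gamma> X) \<in> Obj (EM_cat E T))"
proof (cases "arity_respecting D \<D> E \<A> G")
  case G: True
  let ?TG = "comp_ftr D (mfun T) G"
  have TG: "arity_respecting D \<D> E \<A> ?TG"
    by (rule arity_respecting_comp_ftr[OF D E E G T])
  note fT = arity_respecting_functor[OF T] and fG = is_functor_rules[OF arity_respecting_functor[OF G]]
  show ?thesis
  proof (cases "nat_trans D E ?TG G \<gamma>")
    case True
    have \<gamma>: "\<gamma> X \<in> Hom E (omap (mfun T) (omap G X)) (omap G X)" if "X \<in> Obj D" for X
      using nat_trans_comp_in_Hom[OF True that] that by simp
    show ?thesis
      using G TG True \<gamma>
      by (auto simp: algebras_on_def EM_cat_simps hom_monad_def restrict_eq_iff post_whisker_def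
          pre_whisker_def fG)
  next
    case False
    then show ?thesis
      using G by (auto simp: algebras_on_def EM_cat_simps hom_monad_def)
  qed
next
  case False
  then show ?thesis by (simp add: algebras_on_def EM_cat_simps)
qed

lemma algebras_on_Hom_iff:
  assumes D: "dense_generator D \<D>" and E: "dense_generator E \<A>"
    and T: "arity_respecting E \<A> E \<A> (mfun T)"
    and G: "arity_respecting D \<D> E \<A> G" and H: "arity_respecting D \<D> E \<A> H"
  shows "\<alpha> \<in> Hom (algebras_on D \<D> E \<A> T) (G, \<gamma>) (H, \<delta>) \<longleftrightarrow> nat_trans D E G H \<alpha> \<and>
    (\<forall>X\<in>Obj D. \<alpha> X \<in> Hom (EM_cat E T) (omap G X, \<gamma> X) (omap H X, \<delta> X))"
proof (cases "nat_trans D E G H \<alpha>")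
  case True
  then show ?thesis
    using G H nat_trans_comp_in_Hom[OF True]
    by (auto simp: algebras_on_def EM_cat_simps hom_monad_def restrict_eq_iff post_whisker_def)
next
  case False
  then show ?thesis by (simp add: algebras_on_def EM_cat_simps)
qed

lemma category_algebras_on:
  assumes "dense_generator D \<D>" "dense_generator E \<A>" "arity_respecting E \<A> E \<A> (mfun T)"
  shows "category (algebras_on D \<D> E \<A> T)"
  unfolding algebras_on_def by (rule category_EM_cat[OF is_functor_hom_monad[OF assms]])

lemma (in monad_on) nat_trans_EM_action:
  "nat_trans (EM_cat C T) C (comp_ftr (EM_cat C T) (mfun T) (forgetful C T)) (forgetful C T) (EM_action C T)"
proof (rule nat_transI[OF is_functor_comp_ftr[OF functor_U functor_T] functor_U])
qed (simp_all add: EM_action_def EM_cat_simps)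

lemma (in monad_on) post_whisker_forgetful:
  assumes a: "nat_trans D (EM_cat C T) G H \<alpha>"
  shows "post_whisker D (forgetful C T) G H \<alpha> = \<alpha>"
proof (rule extensionalityI)
  show "\<alpha> \<in> extensional (Obj D)" by (rule nat_trans_extensional[OF a])
  show "post_whisker D (forgetful C T) G H \<alpha> \<in> extensional (Obj D)" by (simp add: post_whisker_def)
qed (simp add: post_whisker_def nat_trans_comp_in_Hom[OF a] is_functor_omap[OF nat_trans_functors(1)[OF a]]
    is_functor_omap[OF nat_trans_functors(2)[OF a]])

lemma iso_of_categories_comparison:
  fixes E :: "('o, 'u::universe) category" and D :: "('d, 'u) category"
  assumes E: "dense_generator E \<A>" and monad: "monad E T"
    and T: "arity_respecting E \<A> E \<A> (mfun T)" and D: "dense_generator D \<D>"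
  shows "iso_of_categories (arity_hom D \<D> (EM_cat E T) (Theta T \<A>)) (algebras_on D \<D> E \<A> T)
    (comparison D \<D> (EM_cat E T) (Theta T \<A>) (forgetful E T) (EM_action E T))"
proof -
  interpret monad_on E T by (unfold_locales) (fact monad)
  let ?M = "EM_cat E T" and ?U = "forgetful E T" and ?\<xi> = "EM_action E T"
  let ?K = "arity_hom D \<D> ?M (Theta T \<A>)" and ?L = "algebras_on D \<D> E \<A> T"
  let ?F = "comparison D \<D> ?M (Theta T \<A>) ?U ?\<xi>"
  have M: "dense_generator ?M (Theta T \<A>)"
    using T by (intro dense_generator_Theta[OF E monad]) (simp add: arity_respecting_dense_iff[OF E E])
  note DD = dense_generatorD[OF D] and DE = dense_generatorD[OF E] and DM = dense_generatorD[OF M]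
  let ?fo = "\<lambda>G. (comp_ftr D ?U G, pre_whisker D ?\<xi> G)"
  have oF: "omap ?F G = ?fo G" if "G \<in> Obj ?K" for G
    using that by (simp add: comparison_def)
  have resp_iff: "arity_respecting D \<D> ?M (Theta T \<A>) G \<longleftrightarrow>
      is_functor D ?M G \<and> arity_respecting D \<D> E \<A> (comp_ftr D ?U G)" for G
    unfolding arity_respecting_dense_iff[OF D M] arity_respecting_dense_iff[OF D E]
    using connected_factorisations_forgetful_comp[OF _ DD(3) DE(3)]
      is_functor_comp_ftr[OF _ functor_U] by blast
  have pt: "omap (comp_ftr D ?U G) X = fst (omap G X)" "pre_whisker D ?\<xi> G X = snd (omap G X)"
    if "is_functor D ?M G" "X \<in> Obj D" for G X
    using that is_functor_omap[OF that] by (simp_all add: pre_whisker_def EM_action_def)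
  have pta: "amap (comp_ftr D ?U G) X Y f = amap G X Y f"
    if "is_functor D ?M G" "X \<in> Obj D" "Y \<in> Obj D" "f \<in> Hom D X Y" for G X Y f
    using that is_functor_rules[OF that(1)] by simp
  have obj: "?fo G \<in> Obj ?L" if G: "arity_respecting D \<D> ?M (Theta T \<A>) G" for G
    unfolding algebras_on_Obj_iff[OF D E T]
  proof (intro conjI ballI)
    note fG = arity_respecting_functor[OF G]
    show "arity_respecting D \<D> E \<A> (comp_ftr D ?U G)" using G resp_iff by blast
    show "nat_trans D E (comp_ftr D (mfun T) (comp_ftr D ?U G)) (comp_ftr D ?U G) (pre_whisker D ?\<xi> G)"
      using nat_trans_pre_whisker[OF nat_trans_EM_action fG] by (simp add: comp_ftr_assoc[OF fG])
    fix X assume X: "X \<in> Obj D"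
    then show "(omap (comp_ftr D ?U G) X, pre_whisker D ?\<xi> G X) \<in> Obj ?M"
      unfolding pt[OF fG X] using is_functor_omap[OF fG X] by simp
  qed
  \<comment> \<open>As an algebra map is an arrow of \<open>E\<close>, the comparison functor is the identity on 2-cells, and
    full faithfulness is an equality of hom-sets.\<close>
  have hom: "Hom ?L (?fo G) (?fo H) = Hom ?K G H"
    if G: "arity_respecting D \<D> ?M (Theta T \<A>) G" and H: "arity_respecting D \<D> ?M (Theta T \<A>) H" for G H
  proof -
    note fG = arity_respecting_functor[OF G] and fH = arity_respecting_functor[OF H]
    have UG: "arity_respecting D \<D> E \<A> (comp_ftr D ?U G)" "arity_respecting D \<D> E \<A> (comp_ftr D ?U H)"
      using G H resp_iff by blast+
    have "nat_trans D E (comp_ftr D ?U G) (comp_ftr D ?U H) \<alpha> \<and>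
        (\<forall>X\<in>Obj D. \<alpha> X \<in> Hom ?M (omap G X) (omap H X)) \<longleftrightarrow> nat_trans D ?M G H \<alpha>" for \<alpha>
    proof
      assume *: "nat_trans D E (comp_ftr D ?U G) (comp_ftr D ?U H) \<alpha> \<and>
        (\<forall>X\<in>Obj D. \<alpha> X \<in> Hom ?M (omap G X) (omap H X))"
      show "nat_trans D ?M G H \<alpha>"
      proof (rule nat_transI[OF fG fH])
        show "\<alpha> \<in> extensional (Obj D)" using * nat_trans_extensional by blast
        fix X Y f assume h: "X \<in> Obj D" "Y \<in> Obj D" "f \<in> Hom D X Y"
        show "Comp ?M (omap G X) (omap G Y) (omap H Y) (\<alpha> Y) (amap G X Y f)
            = Comp ?M (omap G X) (omap H X) (omap H Y) (amap H X Y f) (\<alpha> X)"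
          using nat_trans_naturality[OF conjunct1[OF *] h]
          by (simp only: pt[OF fG] pt[OF fH] pta[OF fG] pta[OF fH] h EM_cat_simps(4))
      qed (use * in blast)
    next
      assume *: "nat_trans D ?M G H \<alpha>"
      then have "nat_trans D E (comp_ftr D ?U G) (comp_ftr D ?U H) (post_whisker D ?U G H \<alpha>)"
        by (rule nat_trans_post_whisker[OF _ functor_U])
      then show "nat_trans D E (comp_ftr D ?U G) (comp_ftr D ?U H) \<alpha> \<and>
        (\<forall>X\<in>Obj D. \<alpha> X \<in> Hom ?M (omap G X) (omap H X))"
        using * by (simp add: post_whisker_forgetful[OF *] nat_trans_comp_in_Hom)
    qed
    then show ?thesis
      using algebras_on_Hom_iff[OF D E T UG]
      by (auto simp: pt[OF fG] pt[OF fH] simp del: comp_ftr_simps)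
  qed
  have aF: "amap ?F G H \<alpha> = \<alpha>"
    if "G \<in> Obj ?K" "H \<in> Obj ?K" "\<alpha> \<in> Hom ?K G H" for G H \<alpha>
    using that post_whisker_forgetful by (simp add: comparison_def)
  have "is_functor ?K ?L ?F"
    unfolding comparison_def
  proof (rule is_functorI[OF category_arity_hom[OF DD(1) DM(1)] category_algebras_on[OF D E T]])
    fix G assume "G \<in> Obj ?K"
    then have G: "arity_respecting D \<D> ?M (Theta T \<A>) G" by simp
    then show "?fo G \<in> Obj ?L" by (rule obj)
    note fG = arity_respecting_functor[OF G]
    have "post_whisker D ?U G G (Id ?K G) = Id ?K G"
      by (rule post_whisker_forgetful) (use nat_trans_Id[OF fG] in simp)
    then show "post_whisker D ?U G G (Id ?K G) = Id ?L (?fo G)"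
      by (auto simp: algebras_on_def EM_cat_simps(3) pt[OF fG] simp del: comp_ftr_simps intro!: restrict_ext)
  next
    fix G H \<alpha> assume h: "G \<in> Obj ?K" "H \<in> Obj ?K" "\<alpha> \<in> Hom ?K G H"
    then show "post_whisker D ?U G H \<alpha> \<in> Hom ?L (?fo G) (?fo H)"
      using hom[of G H] by (simp add: post_whisker_forgetful)
  next
    fix G H K \<alpha> \<beta> assume h: "G \<in> Obj ?K" "H \<in> Obj ?K" "K \<in> Obj ?K" "\<alpha> \<in> Hom ?K G H" "\<beta> \<in> Hom ?K H K"
    then have f: "is_functor D ?M G" "is_functor D ?M H" "is_functor D ?M K"
      using arity_respecting_functor by auto
    have a: "nat_trans D ?M G H \<alpha>" and b: "nat_trans D ?M H K \<beta>" using h by simp_all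
    have "post_whisker D ?U G K (Comp ?K G H K \<beta> \<alpha>) = Comp ?K G H K \<beta> \<alpha>"
      by (rule post_whisker_forgetful) (use nat_trans_Comp[OF a b] in simp)
    then show "post_whisker D ?U G K (Comp ?K G H K \<beta> \<alpha>)
        = Comp ?L (?fo G) (?fo H) (?fo K) (post_whisker D ?U H K \<beta>) (post_whisker D ?U G H \<alpha>)"
      by (auto simp: post_whisker_forgetful[OF a] post_whisker_forgetful[OF b] algebras_on_def
          EM_cat_simps(4) pt[OF f(1)] pt[OF f(2)] pt[OF f(3)] simp del: comp_ftr_simps intro!: restrict_ext)
  qed
  moreover have "bij_betw (amap ?F G H) (Hom ?K G H) (Hom ?L (omap ?F G) (omap ?F H))"
    if G: "G \<in> Obj ?K" and H: "H \<in> Obj ?K" for G H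
  proof -
    have "bij_betw (\<lambda>\<alpha>. \<alpha>) (Hom ?K G H) (Hom ?L (omap ?F G) (omap ?F H))"
      using hom[of G H] G H unfolding oF[OF G] oF[OF H] by (simp add: bij_betw_def)
    then show ?thesis
      by (rule bij_betw_cong[THEN iffD1, rotated]) (simp add: aF[OF G H])
  qed
  moreover have "bij_betw (omap ?F) (Obj ?K) (Obj ?L)"
  proof -
    have "inj_on ?fo (Obj ?K)"
    proof (rule inj_onI)
      fix G H assume "G \<in> Obj ?K" "H \<in> Obj ?K" and eq: "?fo G = ?fo H"
      then have fG: "is_functor D ?M G" and fH: "is_functor D ?M H"
        using arity_respecting_functor by auto
      show "G = H"
      proof (rule is_functor_eqI[OF fG fH])
        fix X assume X: "X \<in> Obj D"
        show "omap G X = omap H X"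
          using eq pt[OF fG X] pt[OF fH X] by (auto intro: prod_eqI simp del: comp_ftr_simps)
        fix Y f assume Y: "Y \<in> Obj D" and f: "f \<in> Hom D X Y"
        show "amap G X Y f = amap H X Y f"
          using eq pta[OF fG X Y f] pta[OF fH X Y f] by (simp del: comp_ftr_simps)
      qed
    qed
    moreover have "?fo ` Obj ?K = Obj ?L"
    proof
      show "?fo ` Obj ?K \<subseteq> Obj ?L" using obj by auto
      show "Obj ?L \<subseteq> ?fo ` Obj ?K"
      proof
        fix z assume z: "z \<in> Obj ?L"
        obtain G \<gamma> where zG: "z = (G, \<gamma>)" by (cases z)
        have G: "arity_respecting D \<D> E \<A> G" and \<gamma>: "nat_trans D E (comp_ftr D (mfun T) G) G \<gamma>"
          and alg: "\<And>X. X \<in> Obj D \<Longrightarrow> (omap G X, \<gamma> X) \<in> Obj ?M"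
          using z unfolding zG algebras_on_Obj_iff[OF D E T] by auto
        note fG = arity_respecting_functor[OF G]
        \<comment> \<open>Naturality of \<open>\<gamma>\<close> says that \<open>G\<close> takes its values on arrows in algebra maps.\<close>
        let ?G = "mk_ftr D (\<lambda>X. (omap G X, \<gamma> X)) (amap G)"
        have f: "is_functor D ?M ?G"
        proof (rule is_functorI[OF DD(1) DM(1)])
          fix X Y f assume h: "X \<in> Obj D" "Y \<in> Obj D" "f \<in> Hom D X Y"
          then show "amap G X Y f \<in> Hom ?M (omap G X, \<gamma> X) (omap G Y, \<gamma> Y)"
            using nat_trans_naturality[OF \<gamma> h] is_functor_amap[OF fG h] by (simp add: EM_cat_simps(2))
        qed (simp_all add: alg EM_cat_simps(3,4) is_functor_rules[OF fG])
        have UG: "comp_ftr D ?U ?G = G"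
          by (rule is_functor_eqI[OF is_functor_comp_ftr[OF f functor_U] fG])
            (simp_all add: pt[OF f] pta[OF f] del: comp_ftr_simps)
        moreover have "pre_whisker D ?\<xi> ?G = \<gamma>"
        proof (rule extensionalityI)
          show "\<gamma> \<in> extensional (Obj D)" by (rule nat_trans_extensional[OF \<gamma>])
          show "pre_whisker D ?\<xi> ?G \<in> extensional (Obj D)" by (simp add: pre_whisker_def)
        qed (simp add: pt[OF f])
        moreover have "?G \<in> Obj ?K" using resp_iff[of ?G] f UG G by simp
        ultimately show "z \<in> ?fo ` Obj ?K" unfolding zG by (intro image_eqI[of _ _ ?G]) simp_all
      qed
    qed
    ultimately have "bij_betw ?fo (Obj ?K) (Obj ?L)" by (simp add: bij_betw_def)
    then show ?thesis
      by (rule bij_betw_cong[THEN iffD1, rotated]) (simp add: oF)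
  qed
  ultimately show ?thesis
    by (simp add: iso_of_categories_def fully_faithful_def)
qed

theorem proposition2p3:
  fixes E :: "('o, 'u::universe) category" and \<A> :: "'o set" and T :: "('o, 'u) monad"
  assumes "dense_generator E \<A>" and "monad E T"
  shows "(has_arities E \<A> T \<longleftrightarrow> arity_respecting E \<A> E \<A> (mfun T)) \<and>
         (has_arities E \<A> T \<longrightarrow>
            EM_object TYPE('d) E \<A> T (EM_cat E T) (Theta T \<A>) (forgetful E T) (EM_action E T))"
proof (intro conjI impI)
  interpret monad_on E T by (unfold_locales) (fact assms(2))
  show iff: "has_arities E \<A> T \<longleftrightarrow> arity_respecting E \<A> E \<A> (mfun T)"
    using functor_T by (simp add: has_arities_def arity_respecting_def)
  assume "has_arities E \<A> T"
  then have T: "arity_respecting E \<A> E \<A> (mfun T)" using iff by simp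
  then have M: "dense_generator (EM_cat E T) (Theta T \<A>)"
    by (intro dense_generator_Theta[OF assms]) (simp add: arity_respecting_dense_iff[OF assms(1,1)])
  have "arity_respecting (EM_cat E T) (Theta T \<A>) E \<A> (forgetful E T)"
    using functor_U connected_factorisations_forgetful dense_generatorD(3)[OF assms(1)]
    by (simp add: arity_respecting_dense_iff[OF M assms(1)])
  then have "(forgetful E T, EM_action E T) \<in> Obj (algebras_on (EM_cat E T) (Theta T \<A>) E \<A> T)"
    using nat_trans_EM_action by (simp add: algebras_on_Obj_iff[OF M assms(1) T] EM_action_def)
  then show "EM_object TYPE('d) E \<A> T (EM_cat E T) (Theta T \<A>) (forgetful E T) (EM_action E T)"
    unfolding EM_object_def arity_monad_def
    by (intro conjI allI impI assms T M iso_of_categories_comparison)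
qed

end
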